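(* Let $n\ge 3$ be an integer and let $\mathcal{X}\subseteq\mathbb{C}$ be a perfect set such that the space $\mathcal{C}^n(\mathcal{X})$ of $n$-tuples of distinct elements of $\mathcal{X}$ is connected. (1) The continuous CS preservers $\phi:\sigma^-_{\perp}(\mathcal{X})\to M_n(\mathbb{C})$ on normal $n\times n$ matrices with spectrum contained in $\mathcal{X}$ are precisely the (restrictions of) conjugations and transpose conjugations. (2) The continuous CS preservers $\phi:\sigma^-_{ss}(\mathcal{X})\to M_n(\mathbb{C})$ on semisimple $n\times n$ matrices with spectrum contained in $\mathcal{X}$ are precisely: the conjugations, the transpose conjugations, and, precisely when $\Delta^{n-1}\overline{(-)}$, as a function on $\mathcal{C}^n(\mathcal{X})$, is locally bounded around every $(z,\dots,z)\in\mathcal{X}^n$ ($z\in\mathcal{X}$), also the compositions $\alpha\circ\Phi$ with $\alpha$ a conjugation or transpose conjugation. (3) The continuous CS preservers $\phi:\sigma^-(\mathcal{X})\to M_n(\mathbb{C})$ on arbitrary $n\times n$ matrices with spectrum contained in $\mathcal{X}$ are precisely: the conjugations, the transpose conjugations, and, precisely when $\Delta^{n-1}\overline{(-)}$, as a function on $\mathcal{C}^n(\mathcal{X})$, has a finite limit at every $(z,\dots,z)\in\mathcal{X}^n$ ($z\in\mathcal{X}$), also the compositions $\alpha\circ\widetilde\Phi$ with $\alpha$ a conjugation or transpose conjugation and $\widetilde\Phi:\sigma^-(\mathcal{X})\to M_n(\mathbb{C})$ the unique continuous extension of $\Phi|_{\sigma^-_{ss}(\mathcal{X})}$.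
   Context: A topological space $\mathcal{X}$ is perfect if every $x\in\mathcal{X}$ lies in the closure of $\mathcal{X}\setminus\{x\}$ (subsets of $\mathbb{C}$ carry the subspace topology; closedness in $\mathbb{C}$ is not required). $\mathcal{C}^n(\mathcal{X})=\{(x_1,\dots,x_n)\in\mathcal{X}^n: x_i \text{ distinct}\}$, with the topology induced from $\mathcal{X}^n$. $\sigma(T)$ is the spectrum (set of eigenvalues) of $T\in M_n(\mathbb{C})$. $\sigma^-(\mathcal{X})$, $\sigma^-_{ss}(\mathcal{X})$, $\sigma^-_\perp(\mathcal{X})$ denote the sets of all, respectively all semisimple (i.e. diagonalizable), respectively all normal, matrices $T\in M_n(\mathbb{C})$ with $\sigma(T)\subseteq\mathcal{X}$. A CS (commutativity and spectrum) preserver on a set $\mathcal{S}\subseteq M_n(\mathbb{C})$ is a map $\phi:\mathcal{S}\to M_n(\mathbb{C})$ (not assumed linear) with $\sigma(\phi(A))=\sigma(A)$ for all $A\in\mathcal{S}$, and $\phi(A)\phi(B)=\phi(B)\phi(A)$ whenever $A,B\in\mathcal{S}$ and $AB=BA$. A conjugation is a map $\mathrm{Ad}_T: A\mapsto TAT^{-1}$ with $T\in\mathrm{GL}_n(\mathbb{C})$; a transpose conjugation is a map $A\mapsto TA^tT^{-1}$ with $T\in \mathrm{GL}_n(\mathbb{C})$ ($A^t$ the transpose). Both are understood as restricted to the domain in question. $\Phi$ is the (well-defined) map on semisimple matrices given by $\Phi(SNS^{-1})=S^{-1}NS$ for $S$ positive (semidefinite) and invertible and $N$ normal. (Every semisimple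 matrix is of the form $SNS^{-1}$ with such $S$, $N$.) For a symmetric complex-valued function $f$ of $m$ distinct variables in $\mathcal{X}$, $\Delta f$ is the symmetric function of $m+1$ distinct variables in $\mathcal{X}$ $$\Delta f(z_0,\dots,z_m):=\frac{f(z_1,\dots,z_m)-f(z_0,\dots,z_{m-1})}{z_m-z_0},$$ and $\Delta^k$ is the $k$-fold iterate of $\Delta$. Thus $\Delta^{n-1}\overline{(-)}$ is the function on $\mathcal{C}^n(\mathcal{X})$ obtained by applying $\Delta^{n-1}$ to the one-variable complex conjugation function $z\mapsto\overline z$ on $\mathcal{X}$. Local boundedness around (respectively existence of a finite limit at) $(z,\dots,z)\in \mathcal{X}^n$ means: boundedness on $U\cap\mathcal{C}^n(\mathcal{X})$ for some neighborhood $U$ of $(z,\dots,z)$ in $\mathcal{X}^n$ (respectively existence of a finite limit as points of $\mathcal{C}^n(\mathcal{X})$ tend to $(z,\dots,z)$). *)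

theory Defs
  imports "HOL-Analysis.Analysis"
begin

section \<open>Matrices\<close>

definition matrix_spectrum :: "complex^'n^'n \<Rightarrow> complex set" where
  "matrix_spectrum A = {c. \<exists>v. v \<noteq> 0 \<and> A *v v = c *s v}"

definition conj_transpose :: "complex^'n^'n \<Rightarrow> complex^'n^'n" where
  "conj_transpose A = (\<chi> i j. cnj (A $ j $ i))"

definition normal_matrix :: "complex^'n^'n \<Rightarrow> bool" where
  "normal_matrix A \<longleftrightarrow> A ** conj_transpose A = conj_transpose A ** A"

definition diagonal_matrix :: "complex^'n^'n \<Rightarrow> bool" where
  "diagonal_matrix D \<longleftrightarrow> (\<forall>i j. i \<noteq> j \<longrightarrow> D $ i $ j = 0)"

definition semisimple_matrix :: "complex^'n^'n \<Rightarrow> bool" where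
  "semisimple_matrix A \<longleftrightarrow>
     (\<exists>(P :: complex^'n^'n) (D :: complex^'n^'n). invertible P \<and>
        diagonal_matrix D \<and> A = P ** D ** matrix_inv P)"

definition positive_matrix :: "complex^'n^'n \<Rightarrow> bool" where
  "positive_matrix S \<longleftrightarrow> conj_transpose S = S \<and>
     (\<forall>v. (\<Sum>i\<in>UNIV. cnj (v $ i) * (S *v v) $ i) \<in> \<real>\<^sub>\<ge>\<^sub>0)"

definition spec_all :: "complex set \<Rightarrow> (complex^'n^'n) set" where
  "spec_all X = {A. matrix_spectrum A \<subseteq> X}"

definition spec_semisimple :: "complex set \<Rightarrow> (complex^'n^'n) set" where
  "spec_semisimple X = {A. semisimple_matrix A \<and> matrix_spectrum A \<subseteq> X}"

definition spec_normal :: "complex set \<Rightarrow> (complex^'n^'n) set" where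
  "spec_normal X = {A. normal_matrix A \<and> matrix_spectrum A \<subseteq> X}"


section \<open>Preservers\<close>

text \<open>Maps on a set \<open>S\<close> of matrices are total functions of which only the values on \<open>S\<close> matter.\<close>

definition CS_preserver ::
  "(complex^'n^'n) set \<Rightarrow> (complex^'n^'n \<Rightarrow> complex^'n^'n) \<Rightarrow> bool" where
  "CS_preserver S \<phi> \<longleftrightarrow>
     (\<forall>A\<in>S. matrix_spectrum (\<phi> A) = matrix_spectrum A) \<and>
     (\<forall>A\<in>S. \<forall>B\<in>S. A ** B = B ** A \<longrightarrow> \<phi> A ** \<phi> B = \<phi> B ** \<phi> A)"

definition continuous_CS_preserver ::
  "(complex^'n^'n) set \<Rightarrow> (complex^'n^'n \<Rightarrow> complex^'n^'n) \<Rightarrow> bool" where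
  "continuous_CS_preserver S \<phi> \<longleftrightarrow> continuous_on S \<phi> \<and> CS_preserver S \<phi>"

definition matrix_conjugations :: "(complex^'n^'n \<Rightarrow> complex^'n^'n) set" where
  "matrix_conjugations = {\<lambda>A. T ** A ** matrix_inv T | T. invertible T}"

definition transpose_conjugations :: "(complex^'n^'n \<Rightarrow> complex^'n^'n) set" where
  "transpose_conjugations = {\<lambda>A. T ** transpose A ** matrix_inv T | T. invertible T}"

definition Phi :: "complex^'n^'n \<Rightarrow> complex^'n^'n" where
  "Phi A = (THE B. \<exists>S N. positive_matrix S \<and> invertible S \<and> normal_matrix N \<and>
     A = S ** N ** matrix_inv S \<and> B = matrix_inv S ** N ** S)"

text \<open>Extensionality outside \<open>T\<close> makes an extension to \<open>T\<close> unique as a HOL function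
  exactly when it is unique as a map on \<open>T\<close>.\<close>

definition is_continuous_extension ::
  "'a::topological_space set \<Rightarrow> 'a set \<Rightarrow> ('a \<Rightarrow> 'b::topological_space) \<Rightarrow> ('a \<Rightarrow> 'b) \<Rightarrow> bool" where
  "is_continuous_extension S T f g \<longleftrightarrow>
     g \<in> extensional T \<and> continuous_on T g \<and> (\<forall>x\<in>S. g x = f x)"


section \<open>Configuration spaces and iterated differences\<close>

definition perfect_set :: "'a::topological_space set \<Rightarrow> bool" where
  "perfect_set X \<longleftrightarrow> (\<forall>x\<in>X. x \<in> closure (X - {x}))"

text \<open>Points of \<open>X\<^sup>n\<close> are extensional functions on \<open>{..<n}\<close>. All of them agree outside
  \<open>{..<n}\<close>, so the topology inherited from the product topology of the type
  \<open>nat \<Rightarrow> complex\<close> is the topology of \<open>X\<^sup>n\<close>.\<close>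

definition config_space :: "nat \<Rightarrow> complex set \<Rightarrow> (nat \<Rightarrow> complex) set" where
  "config_space n X = {x \<in> {..<n} \<rightarrow>\<^sub>E X. inj_on x {..<n}}"

definition diagonal_point :: "nat \<Rightarrow> complex \<Rightarrow> (nat \<Rightarrow> complex)" where
  "diagonal_point n z = (\<lambda>i\<in>{..<n}. z)"

text \<open>Functions of \<open>m\<close> variables are represented by functions on lists, considered on lists of
  length \<open>m\<close>; the operator below takes a function of \<open>m\<close> variables to one of \<open>m + 1\<close> variables.\<close>

definition Delta :: "(complex list \<Rightarrow> complex) \<Rightarrow> complex list \<Rightarrow> complex" where
  "Delta f zs = (f (tl zs) - f (butlast zs)) / (last zs - hd zs)"

definition Delta_cnj :: "nat \<Rightarrow> (nat \<Rightarrow> complex) \<Rightarrow> complex" where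
  "Delta_cnj n x = (Delta ^^ (n - 1)) (\<lambda>zs. cnj (hd zs)) (map x [0..<n])"

definition Delta_cnj_locally_bounded :: "nat \<Rightarrow> complex set \<Rightarrow> bool" where
  "Delta_cnj_locally_bounded n X \<longleftrightarrow>
     (\<forall>z\<in>X. \<exists>U. open U \<and> diagonal_point n z \<in> U \<and>
        bounded (Delta_cnj n ` (U \<inter> config_space n X)))"

definition Delta_cnj_has_limits :: "nat \<Rightarrow> complex set \<Rightarrow> bool" where
  "Delta_cnj_has_limits n X \<longleftrightarrow>
     (\<forall>z\<in>X. \<exists>l. (Delta_cnj n \<longlongrightarrow> l) (at (diagonal_point n z) within config_space n X))"

end

theory Submission
  imports Defs "HOL-Computational_Algebra.Fundamental_Theorem_Algebra" "HOL-Combinatorics.Permutations"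
begin

text \<open>
  For a fixed orthonormal frame, the images of the matrices that are diagonal in it with distinct
  eigenvalues commute; connectedness of the configuration space forces the eigenlines of the image
  not to depend on the eigenvalues, and letting eigenvalues collide (perfectness) shows that each of
  them depends on the corresponding line only. The result is a continuous map \<open>Q\<close> from lines to
  rank-one idempotents that carries orthonormal frames to complete systems of orthogonal
  idempotents. In homogeneous coordinates it is given by functions \<open>\<sigma>\<^sub>j\<close> of one variable, and
  orthogonality turns them into multiples of one continuous ring endomorphism of the complex
  numbers, so \<open>Q\<close> is a conjugation or a transpose conjugation.

  On semisimple matrices this applies to each orbit \<open>S N S\<inverse>\<close> (\<open>N\<close> normal, \<open>S\<close> fixed). Once \<open>\<phi>\<close> is
  the identity on normal matrices, an idempotent \<open>x y\<^sup>*\<close> is mapped into the corner spanned by \<open>x\<close> and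
  \<open>y\<close>, and for diagonal \<open>S\<close> and \<open>n \<ge> 3\<close> this leaves only the multiplication by \<open>1\<close> or by \<open>S\<^sup>-\<^sup>2\<close>,
  that is, the identity or \<open>\<Phi>\<close>.

  Finally \<open>\<Phi> A\<close> is the adjoint of complex conjugation applied to \<open>A\<close> by functional calculus, so
  Newton interpolation expresses it through divided differences of complex conjugation; bidiagonal
  matrices show that nothing less than their boundedness (convergence) at the diagonal suffices.
\<close>

section \<open>Matrix algebra\<close>

text \<open>Commutation and spectra are the only information about \<phi>, and 0 and 1 need not lie
  in \<open>X\<close>; idempotents are therefore encoded by matrices with two eigenvalues from
  \<open>X\<close>. The line map obtained on normal matrices is not known to be injective, so the
  fundamental theorem of projective geometry does not apply directly: a continuity argument along a
  segment first shows that no two lines receive the same range. The bound n >= 3 supplies a vector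
  orthogonal to two given ones, or a third coordinate, and so links quantities that would otherwise
  stay independent. For a diagonal matrix with entries b_i^(-1/2) the link says that the unknown
  weights are affine in b; consistency under exchange of two indices leaves the constants and the
  multiples of b, and the latter are the source of \<Phi>. Boundedness suffices on semisimple
  matrices because a semisimple limit is annihilated by the product of its distinct linear factors:
  a Newton coefficient that is merely bounded meets a factor tending to 0. A nilpotent part removes
  this cancellation, hence the demand for limits.\<close>

lemma matrix_add_rdistrib': "(A + B) ** C = A ** C + B ** (C :: 'a::comm_ring_1^'p^'n)"
  by (simp add: matrix_matrix_mult_def vec_eq_iff sum.distrib distrib_right)

lemma matrix_sub_ldistrib: "A ** (B - C) = A ** B - A ** (C :: 'a::comm_ring_1^'p^'n)"
  by (simp add: matrix_matrix_mult_def vec_eq_iff sum_subtractf right_diff_distrib)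

lemma matrix_sub_rdistrib: "(A - B) ** C = A ** C - B ** (C :: 'a::comm_ring_1^'p^'n)"
  by (simp add: matrix_matrix_mult_def vec_eq_iff sum_subtractf left_diff_distrib)

lemmas matrix_distribs = matrix_add_ldistrib matrix_add_rdistrib' matrix_sub_ldistrib matrix_sub_rdistrib

lemma matrix_sum_ldistrib: "A ** (\<Sum>i\<in>S. f i) = (\<Sum>i\<in>S. A ** (f i :: 'a::comm_ring_1^'p^'n))"
  by (induction S rule: infinite_finite_induct) (auto simp: matrix_add_ldistrib)

lemma matrix_sum_rdistrib: "(\<Sum>i\<in>S. f i) ** A = (\<Sum>i\<in>S. f i ** (A :: 'a::comm_ring_1^'p^'n))"
  by (induction S rule: infinite_finite_induct) (auto simp: matrix_add_rdistrib')

lemma matrix_vector_sum_distrib: "(\<Sum>i\<in>S. f i) *v v = (\<Sum>i\<in>S. f i *v (v :: 'a::comm_ring_1^'n))"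
  by (induction S rule: infinite_finite_induct) (auto simp: matrix_vector_mult_add_rdistrib)

lemma mat_mult_nth: "(mat c ** A) $ i $ j = c * (A $ i $ j :: 'a::comm_ring_1)"
  by (simp add: matrix_matrix_mult_def mat_def if_distrib[where f="\<lambda>x. x * _"] cong: if_cong)

lemma mat_mult_vec: "mat c *v v = c *s (v :: 'a::comm_ring_1^'n)"
  by (simp add: matrix_vector_mult_def mat_def vec_eq_iff if_distrib[where f="\<lambda>x. x * _"] cong: if_cong)

lemma mat_commute: "A ** mat c = mat c ** (A :: 'a::comm_ring_1^'n^'n)"
  by (simp add: vec_eq_iff mat_mult_nth)
     (simp add: matrix_matrix_mult_def mat_def if_distrib[where f="\<lambda>x. _ * x"] mult.commute cong: if_cong)

lemma mat_mat: "mat c ** mat d = (mat (c * d) :: 'a::comm_ring_1^'n^'n)"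
  by (simp add: vec_eq_iff mat_mult_nth) (simp add: mat_def)

lemma mat_nth: "mat c $ i $ j = (if i = j then c else 0)"
  by (simp add: mat_def)

lemma matrix_vector_smult: "A *v (c *s v) = c *s (A *v (v :: 'a::comm_ring_1^'n))"
  by (simp add: matrix_vector_mult_def vec_eq_iff sum_distrib_left mult_ac)

lemma matrix_inv_mult:
  assumes "invertible (P :: 'a::field^'n^'n)"
  shows "P ** matrix_inv P = mat 1" "matrix_inv P ** P = mat 1"
proof -
  have "P ** matrix_inv P = mat 1 \<and> matrix_inv P ** P = mat 1"
    unfolding matrix_inv_def using assms unfolding invertible_def by (rule someI_ex)
  thus "P ** matrix_inv P = mat 1" "matrix_inv P ** P = mat 1" by auto
qed

lemma invertibleI: "P ** P' = mat 1 \<Longrightarrow> invertible (P :: 'a::field^'n^'n)"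
  using invertible_right_inverse by blast

lemma matrix_inv_eqI:
  assumes "P ** P' = mat 1" shows "matrix_inv (P :: 'a::field^'n^'n) = P'"
proof -
  have i: "invertible P" using assms by (rule invertibleI)
  have "matrix_inv P = matrix_inv P ** (P ** P')" by (simp add: assms)
  also have "\<dots> = P'" by (simp add: matrix_mul_assoc matrix_inv_mult i)
  finally show ?thesis .
qed

lemma invertible_matrix_inv: "invertible (P :: 'a::field^'n^'n) \<Longrightarrow> invertible (matrix_inv P)"
  by (rule invertibleI[OF matrix_inv_mult(2)])

lemma matrix_inv_inv: "invertible (P :: 'a::field^'n^'n) \<Longrightarrow> matrix_inv (matrix_inv P) = P"
  by (rule matrix_inv_eqI) (rule matrix_inv_mult)

lemma matrix_inv_mul:
  assumes "invertible (P :: 'a::field^'n^'n)" "invertible (Q :: 'a::field^'n^'n)"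
  shows "matrix_inv (P ** Q) = matrix_inv Q ** matrix_inv P"
proof (rule matrix_inv_eqI)
  have "P ** Q ** (matrix_inv Q ** matrix_inv P) = P ** (Q ** matrix_inv Q) ** matrix_inv P"
    by (simp add: matrix_mul_assoc)
  thus "P ** Q ** (matrix_inv Q ** matrix_inv P) = mat 1"
    using assms by (simp add: matrix_inv_mult)
qed

lemma invertible_ker:
  "invertible (P :: 'a::field^'n^'n) \<longleftrightarrow> (\<forall>x. P *v x = 0 \<longrightarrow> x = 0)"
  by (metis invertible_left_inverse matrix_left_invertible_ker)

lemma invertible_det_iff: "invertible (A :: complex^'n^'n) \<longleftrightarrow> det A \<noteq> 0"
  by (rule invertible_det_nz)

section \<open>Conjugation by an invertible matrix as an algebra homomorphism\<close>

definition conjug :: "'a::field^'n^'n \<Rightarrow> 'a^'n^'n \<Rightarrow> 'a^'n^'n" where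
  "conjug P A = P ** A ** matrix_inv P"

lemma conjug_mult: "invertible P \<Longrightarrow> conjug P (A ** B) = conjug P A ** conjug P B"
proof -
  assume P: "invertible P"
  have "conjug P A ** conjug P B = P ** A ** (matrix_inv P ** P) ** B ** matrix_inv P"
    by (simp add: conjug_def matrix_mul_assoc)
  thus ?thesis using P by (simp add: matrix_inv_mult conjug_def matrix_mul_assoc)
qed

lemma conjug_add: "conjug P (A + B) = conjug P A + conjug P B"
  by (simp add: conjug_def matrix_distribs)

lemma conjug_diff: "conjug P (A - B) = conjug P A - conjug P B"
  by (simp add: conjug_def matrix_distribs)

lemma conjug_0 [simp]: "conjug P 0 = 0"
  by (simp add: conjug_def)

lemma conjug_sum: "conjug P (\<Sum>i\<in>S. f i) = (\<Sum>i\<in>S. conjug P (f i))"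
  by (simp add: conjug_def matrix_sum_ldistrib matrix_sum_rdistrib)

lemma conjug_mat [simp]: "invertible P \<Longrightarrow> conjug P (mat c) = mat c"
proof -
  assume P: "invertible P"
  have "conjug P (mat c) = mat c ** (P ** matrix_inv P)"
    by (simp add: conjug_def mat_commute matrix_mul_assoc)
  thus ?thesis using P by (simp add: matrix_inv_mult)
qed

lemma conjug_conjug: "invertible P \<Longrightarrow> invertible Q \<Longrightarrow> conjug P (conjug Q A) = conjug (P ** Q) A"
  by (simp add: conjug_def matrix_inv_mul matrix_mul_assoc)

lemma conjug_mat1 [simp]: "conjug (mat 1) A = A"
  by (simp add: conjug_def matrix_inv_eqI[of "mat 1" "mat 1"])

lemma conjug_inv_cancel [simp]:
  assumes "invertible P"
  shows "conjug (matrix_inv P) (conjug P A) = A" "conjug P (conjug (matrix_inv P) A) = A"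
  using assms by (simp_all add: conjug_conjug invertible_matrix_inv matrix_inv_mult)

lemma conjug_smult: "invertible P \<Longrightarrow> conjug P (mat c ** A) = mat c ** conjug P A"
  by (simp add: conjug_mult)

lemma conjug_eq_iff: "invertible P \<Longrightarrow> conjug P A = conjug P B \<longleftrightarrow> A = B"
  by (metis conjug_inv_cancel(1))

lemma conjug_eqI: "invertible P \<Longrightarrow> A ** P = P ** D \<Longrightarrow> A = conjug P D"
  by (metis conjug_def matrix_inv_mult(1) matrix_mul_assoc matrix_mul_rid)

lemma conjug_eqD: "invertible P \<Longrightarrow> A = conjug P D \<Longrightarrow> A ** P = P ** D"
  by (metis conjug_def matrix_inv_mult(2) matrix_mul_assoc matrix_mul_rid)

section \<open>Diagonal matrices and their commutants\<close>

definition diagm :: "('n \<Rightarrow> 'a::zero) \<Rightarrow> 'a^'n^'n" where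
  "diagm d = (\<chi> i j. if i = j then d i else 0)"

lemma diagm_nth: "diagm d $ i $ j = (if i = j then d i else 0)"
  by (simp add: diagm_def)

lemma diagm_mult_nth: "(diagm d ** A) $ i $ j = d i * (A $ i $ j :: 'a::comm_ring_1)"
  by (simp add: matrix_matrix_mult_def diagm_def if_distrib[where f="\<lambda>x. x * _"] cong: if_cong)

lemma mult_diagm_nth: "(A ** diagm d) $ i $ j = A $ i $ j * (d j :: 'a::comm_ring_1)"
  by (simp add: matrix_matrix_mult_def diagm_def if_distrib[where f="\<lambda>x. _ * x"] cong: if_cong)

lemma diagm_vec: "(diagm d *v v) $ i = d i * (v $ i :: 'a::comm_ring_1)"
  by (simp add: matrix_vector_mult_def diagm_def if_distrib[where f="\<lambda>x. x * _"] cong: if_cong)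

lemma diagm_mult: "diagm d ** diagm e = diagm (\<lambda>i. d i * (e i :: 'a::comm_ring_1))"
  by (simp add: vec_eq_iff diagm_mult_nth) (simp add: diagm_nth)

lemma diagm_commute: "diagm d ** diagm e = diagm e ** diagm (d :: 'n::finite \<Rightarrow> 'a::comm_ring_1)"
  by (simp add: diagm_mult mult.commute)

lemma diagm_const: "diagm (\<lambda>_. c) = mat c"
  by (simp add: diagm_def mat_def)

lemma diagm_diff: "diagm d - diagm e = diagm (\<lambda>i. d i - (e i :: 'a::comm_ring_1))"
  by (simp add: vec_eq_iff diagm_nth)

lemma diagm_inj: "diagm d = diagm e \<Longrightarrow> d = e"
  by (rule ext) (metis diagm_nth)

lemma transpose_diagm [simp]: "transpose (diagm d) = diagm d"
  by (simp add: vec_eq_iff transpose_def diagm_nth)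

lemma diagm_sum: "diagm d = (\<Sum>i\<in>UNIV. mat (d i) ** diagm (\<lambda>j. if j = i then 1 else (0 :: 'a::comm_ring_1)))"
  by (auto simp: vec_eq_iff mat_mult_nth diagm_nth if_distrib[where f="\<lambda>x. _ * x"] cong: if_cong)

lemma invertible_diagm: "(\<And>i. d i \<noteq> 0) \<Longrightarrow> invertible (diagm d :: 'a::field^'n^'n)"
  by (rule invertibleI[of _ "diagm (\<lambda>i. inverse (d i))"]) (simp add: diagm_mult diagm_const)

lemma matrix_inv_diagm: "(\<And>i. d i \<noteq> 0) \<Longrightarrow> matrix_inv (diagm d :: 'a::field^'n^'n) = diagm (\<lambda>i. inverse (d i))"
  by (rule matrix_inv_eqI) (simp add: diagm_mult diagm_const)

lemma commute_diagm_inj: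
  assumes "inj d" "A ** diagm d = diagm d ** (A :: 'a::idom^'n^'n)"
  shows "A = diagm (\<lambda>i. A $ i $ i)"
proof -
  have "A $ i $ j = 0" if "i \<noteq> j" for i j
  proof -
    have "A $ i $ j * d j = d i * A $ i $ j"
      using assms(2) by (metis diagm_mult_nth mult_diagm_nth)
    hence "A $ i $ j * (d j - d i) = 0" by (simp add: algebra_simps)
    thus ?thesis using assms(1) that by (auto dest: injD)
  qed
  thus ?thesis by (auto simp: vec_eq_iff diagm_nth)
qed

lemma diagonal_matrix_iff: "diagonal_matrix D \<longleftrightarrow> (\<exists>d. D = diagm d)"
proof
  assume "diagonal_matrix D"
  hence "D = diagm (\<lambda>i. D $ i $ i)"
    by (auto simp: diagonal_matrix_def vec_eq_iff diagm_nth)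
  thus "\<exists>d. D = diagm d" by blast
qed (auto simp: diagonal_matrix_def diagm_nth)

lemma semisimple_matrix_iff: "semisimple_matrix A \<longleftrightarrow> (\<exists>P d. invertible P \<and> A = conjug P (diagm d))"
  unfolding semisimple_matrix_def diagonal_matrix_iff conjug_def by blast

subsection \<open>Spectrum\<close>

lemma matrix_spectrum_iff: "c \<in> matrix_spectrum A \<longleftrightarrow> \<not> invertible (A - mat c)"
proof -
  have "A *v v = c *s v \<longleftrightarrow> (A - mat c) *v v = 0" for v
    by (simp add: matrix_vector_mult_diff_rdistrib mat_mult_vec)
  thus ?thesis by (auto simp: matrix_spectrum_def invertible_ker)
qed

lemma matrix_spectrum_det: "c \<in> matrix_spectrum A \<longleftrightarrow> det (mat c - A) = 0"
proof -
  have "invertible (A - mat c) \<longleftrightarrow> invertible (mat c - A)"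
  proof -
    have "(A - mat c) *v x = - ((mat c - A) *v x)" for x
      by (simp add: matrix_vector_mult_diff_rdistrib)
    thus ?thesis by (simp add: invertible_ker)
  qed
  thus ?thesis by (simp add: matrix_spectrum_iff invertible_det_iff)
qed

lemma det_conjug: "invertible P \<Longrightarrow> det (mat z - conjug P A) = det (mat z - (A :: 'a::field^'n^'n))"
proof -
  assume P: "invertible P"
  have e: "mat z - conjug P A = P ** (mat z - A) ** matrix_inv P"
    using conjug_diff[of P "mat z" A] P by (simp add: conjug_def[of _ "mat z - A"])
  have "det P * det (matrix_inv P) = 1"
    using P by (metis det_I det_mul matrix_inv_mult(1))
  thus ?thesis unfolding e by (simp add: det_mul mult_ac)
qed

lemma spectrum_conjug: "invertible P \<Longrightarrow> matrix_spectrum (conjug P A) = matrix_spectrum A"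
  by (auto simp: matrix_spectrum_det det_conjug)

lemma spectrum_transpose: "matrix_spectrum (transpose A) = matrix_spectrum A"
proof -
  have "mat c - transpose A = transpose (mat c - A)" for c
    by (simp add: vec_eq_iff transpose_def mat_def)
  thus ?thesis by (auto simp: matrix_spectrum_det)
qed

lemma det_diagm: "det (diagm d) = prod d UNIV"
  by (subst det_diagonal) (auto simp: diagm_nth)

lemma det_char_diagm: "det (mat z - diagm d) = (\<Prod>i\<in>UNIV. z - d i)"
  by (simp add: diagm_const[symmetric] diagm_diff det_diagm)

lemma spectrum_diagm: "matrix_spectrum (diagm d) = range d"
  by (auto simp: matrix_spectrum_det det_char_diagm prod_zero_iff)

lemma spectrum_conjug_diagm: "invertible P \<Longrightarrow> matrix_spectrum (conjug P (diagm d)) = range d"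
  by (simp add: spectrum_conjug spectrum_diagm)

section \<open>Determinants of triangular matrices\<close>

lemma permutation_nonincreasing_id:
  assumes "p permutes UNIV" "\<And>i. f (p i) \<le> f i" "inj (f :: 'n \<Rightarrow> nat)"
  shows "p = id"
proof -
  have "p i = i" for i
  proof (induction "f i" arbitrary: i rule: less_induct)
    case less
    show ?case
    proof (rule ccontr)
      assume ne: "p i \<noteq> i"
      \<comment> \<open>\<open>p i\<close> has a smaller number than \<open>i\<close>, so by
        induction it is a fixed point; injectivity of \<open>p\<close> then makes \<open>i\<close>
        one as well.\<close>
      hence "f (p i) < f i" using assms(2)[of i] assms(3) by (metis injD le_neq_implies_less)
      hence "p (p i) = p i" by (rule less)
      thus False using ne permutes_inj[OF assms(1)] by (metis injD)
    qed
  qed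
  thus ?thesis by auto
qed

text \<open>The index type carries no order, so triangularity is measured by an injective numbering
  \<open>f\<close>. A permutation contributes only if it never decreases \<open>f\<close>; its
  inverse then never increases \<open>f\<close>, which forces the identity.\<close>

lemma det_triangular:
  assumes "inj (f :: 'n::finite \<Rightarrow> nat)" "\<And>i j. f j < f i \<Longrightarrow> A $ i $ j = (0 :: 'a::comm_ring_1)"
  shows "det A = (\<Prod>i\<in>UNIV. A $ i $ i)"
proof -
  have "(\<Prod>i\<in>UNIV. A $ i $ p i) = 0" if "p permutes UNIV" "p \<noteq> id" for p
  proof -
    have "\<exists>i. \<not> f i \<le> f (p i)"
    proof (rule ccontr)
      assume "\<not> (\<exists>i. \<not> f i \<le> f (p i))"
      hence a: "\<And>i. f i \<le> f (p i)" by auto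
      have "inv p permutes UNIV" by (rule permutes_inv[OF that(1)])
      moreover have "f (inv p i) \<le> f i" for i
        using a[of "inv p i"] permutes_inverses(1)[OF that(1)] by simp
      ultimately have "inv p = id" using permutation_nonincreasing_id assms(1) by blast
      thus False using that by (metis permutes_inv_inv inv_id)
    qed
    then obtain i where "f (p i) < f i" by (auto simp: not_le)
    hence "A $ i $ p i = 0" by (rule assms)
    thus ?thesis by (intro prod_zero) auto
  qed
  hence "det A = (\<Sum>p\<in>{id}. of_int (sign p) * (\<Prod>i\<in>UNIV. A $ i $ p i))"
    unfolding det_def by (intro sum.mono_neutral_right) (auto simp: permutes_id finite_permutations)
  thus ?thesis by simp
qed

lemma det_char_triangular:
  assumes "inj (f :: 'n::finite \<Rightarrow> nat)" "\<And>i j. f j < f i \<Longrightarrow> A $ i $ j = (0 :: 'a::comm_ring_1)"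
  shows "det (mat z - A) = (\<Prod>i\<in>UNIV. z - A $ i $ i)"
  by (subst det_triangular[OF assms(1)]) (auto simp: mat_def assms(2) dest: less_imp_neq)

section \<open>Unitary triangularization\<close>

definition cinner :: "complex^'n \<Rightarrow> complex^'n \<Rightarrow> complex" where
  "cinner u v = (\<Sum>i\<in>UNIV. cnj (u $ i) * v $ i)"

lemma cinner_add_right: "cinner u (v + w) = cinner u v + cinner u w"
  by (simp add: cinner_def sum.distrib distrib_left)
lemma cinner_diff_right: "cinner u (v - w) = cinner u v - cinner u w"
  by (simp add: cinner_def sum_subtractf right_diff_distrib)
lemma cinner_scale_right: "cinner u (c *s v) = c * cinner u v"
  by (simp add: cinner_def sum_distrib_left mult_ac)
lemma cinner_add_left: "cinner (v + w) u = cinner v u + cinner w u"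
  by (simp add: cinner_def sum.distrib distrib_right)
lemma cinner_diff_left: "cinner (v - w) u = cinner v u - cinner w u"
  by (simp add: cinner_def sum_subtractf left_diff_distrib)
lemma cinner_scale_left: "cinner (c *s v) u = cnj c * cinner v u"
  by (simp add: cinner_def sum_distrib_left mult_ac)
lemma cinner_zero [simp]: "cinner 0 v = 0" "cinner v 0 = 0"
  by (simp_all add: cinner_def)
lemma cinner_sum_right: "cinner u (\<Sum>i\<in>S. f i) = (\<Sum>i\<in>S. cinner u (f i))"
  by (induction S rule: infinite_finite_induct) (auto simp: cinner_add_right)
lemma cinner_cnj: "cnj (cinner u v) = cinner v u"
  by (simp add: cinner_def mult.commute)
lemma cinner_eq_0_sym: "cinner u v = 0 \<longleftrightarrow> cinner v u = 0"
  by (metis cinner_cnj complex_cnj_zero)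

lemmas cinner_simps = cinner_add_right cinner_diff_right cinner_scale_right
  cinner_add_left cinner_diff_left cinner_scale_left

lemma cinner_self: "cinner v v = of_real ((norm v)\<^sup>2)"
proof -
  have "cnj z * z = of_real ((norm z)\<^sup>2)" for z
    by (metis complex_norm_square mult.commute of_real_power)
  thus ?thesis
    by (simp add: cinner_def norm_vec_def L2_set_def sum_nonneg)
qed

lemma cinner_self_eq_0 [simp]: "cinner v v = 0 \<longleftrightarrow> v = 0"
  by (simp add: cinner_self)

lemma cinner_axis: "cinner (axis i 1) v = v $ i" "cinner v (axis i 1) = cnj (v $ i)"
  by (simp_all add: cinner_def axis_def if_distrib[where f="\<lambda>x. _ * x"]
        if_distrib[where f="\<lambda>x. x * _"] if_distrib[where f=cnj] cong: if_cong)

lemma cinner_conj_transpose: "cinner u (A *v v) = cinner (conj_transpose A *v u) v"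
proof -
  have "cinner u (A *v v) = (\<Sum>i\<in>UNIV. \<Sum>j\<in>UNIV. cnj (u $ i) * (A $ i $ j * v $ j))"
    by (simp add: cinner_def matrix_vector_mult_def sum_distrib_left)
  also have "\<dots> = (\<Sum>j\<in>UNIV. \<Sum>i\<in>UNIV. cnj (u $ i) * (A $ i $ j * v $ j))"
    by (rule sum.swap)
  also have "\<dots> = cinner (conj_transpose A *v u) v"
    by (simp add: cinner_def matrix_vector_mult_def sum_distrib_left sum_distrib_right conj_transpose_def mult_ac)
  finally show ?thesis .
qed

lemma conj_transpose_nth: "conj_transpose A $ i $ j = cnj (A $ j $ i)"
  by (simp add: conj_transpose_def)
lemma conj_transpose_mult: "conj_transpose (A ** B) = conj_transpose B ** conj_transpose A"
  by (simp add: vec_eq_iff conj_transpose_def matrix_matrix_mult_def mult.commute)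
lemma conj_transpose_inv [simp]: "conj_transpose (conj_transpose A) = A"
  by (simp add: vec_eq_iff conj_transpose_def)
lemma conj_transpose_mat [simp]: "conj_transpose (mat c) = mat (cnj c)"
  by (simp add: vec_eq_iff conj_transpose_def mat_def)
lemma conj_transpose_diagm: "conj_transpose (diagm d) = diagm (\<lambda>i. cnj (d i))"
  by (simp add: vec_eq_iff conj_transpose_def diagm_def)

lemma invertible_conj_transpose: "invertible P \<Longrightarrow> invertible (conj_transpose P)"
  by (metis conj_transpose_mat conj_transpose_mult complex_cnj_one invertibleI matrix_inv_mult(2))

lemma matrix_inv_conj_transpose:
  "invertible P \<Longrightarrow> matrix_inv (conj_transpose P) = conj_transpose (matrix_inv P)"
  by (rule matrix_inv_eqI) (metis conj_transpose_mat conj_transpose_mult complex_cnj_one matrix_inv_mult(2))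

lemma conj_transpose_conjug:
  "invertible P \<Longrightarrow> conj_transpose (conjug P A) = conjug (matrix_inv (conj_transpose P)) (conj_transpose A)"
  by (simp add: conjug_def conj_transpose_mult matrix_inv_inv invertible_conj_transpose
      matrix_inv_conj_transpose invertible_matrix_inv matrix_mul_assoc)

definition unitary :: "complex^'n^'n \<Rightarrow> bool" where
  "unitary U \<longleftrightarrow> conj_transpose U ** U = mat 1"

lemma unitary_invertible: "unitary U \<Longrightarrow> invertible U"
  using invertible_left_inverse unitary_def by blast

lemma unitary_matrix_inv: "unitary U \<Longrightarrow> matrix_inv U = conj_transpose U"
  by (metis matrix_inv_eqI matrix_left_right_inverse unitary_def)

lemma unitary_mult: "unitary U \<Longrightarrow> unitary V \<Longrightarrow> unitary (U ** V)"
  unfolding unitary_def conj_transpose_mult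
  by (metis matrix_mul_assoc matrix_mul_lid)

lemma unitary_conj_transpose: "unitary U \<Longrightarrow> unitary (conj_transpose U)"
  unfolding unitary_def using matrix_left_right_inverse by auto

lemma unitary_mat1: "unitary (mat 1)"
  by (simp add: unitary_def)

lemma conj_transpose_conjug_unitary:
  "unitary U \<Longrightarrow> conj_transpose (conjug U A) = conjug U (conj_transpose A)"
  by (simp add: conjug_def unitary_matrix_inv conj_transpose_mult matrix_mul_assoc)

lemma conj_transpose_mult_nth: "(conj_transpose U ** V) $ i $ j = cinner (column i U) (column j V)"
  by (simp add: matrix_matrix_mult_def conj_transpose_def cinner_def column_def)

lemma unitary_iff_columns:
  "unitary U \<longleftrightarrow> (\<forall>i j. cinner (column i U) (column j U) = (if i = j then 1 else 0))"
  by (simp add: unitary_def vec_eq_iff conj_transpose_mult_nth mat_nth)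

lemma column_mult: "column j (A ** B) = A *v column j B"
  by (simp add: vec_eq_iff column_def matrix_matrix_mult_def matrix_vector_mult_def)

lemma column_mat1: "column j (mat 1) = axis j 1"
  by (simp add: vec_eq_iff column_def mat_def axis_def)

lemma column_eq: "column j A = A *v axis j (1::'a::comm_ring_1)"
  by (metis column_mat1 column_mult matrix_mul_rid)

lemma conjug_unitary_nth:
  "unitary U \<Longrightarrow> conjug (conj_transpose U) A $ i $ j = cinner (column i U) (A *v column j U)"
  by (simp add: conjug_def unitary_matrix_inv unitary_conj_transpose
      matrix_mul_assoc[symmetric] conj_transpose_mult_nth column_mult)

subsection \<open>Eigenvectors in invariant subspaces\<close>

text \<open>The vector p(A) v by Horner's rule, which uses only products of \<open>A\<close> with
  vectors.\<close>

definition horner_vec :: "complex^'n^'n \<Rightarrow> complex^'n \<Rightarrow> complex poly \<Rightarrow> complex^'n" where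
  "horner_vec A v p = fold_coeffs (\<lambda>a w. a *s v + A *v w) p 0"

lemma horner_vec_0 [simp]: "horner_vec A v 0 = 0"
  by (simp add: horner_vec_def)

lemma horner_vec_pCons [simp]: "horner_vec A v (pCons a p) = a *s v + A *v horner_vec A v p"
  by (cases "p = 0 \<and> a = 0") (auto simp: horner_vec_def)

lemma horner_vec_add: "horner_vec A v (p + q) = horner_vec A v p + horner_vec A v q"
  by (induction p q rule: poly_induct2) (auto simp: vector_sadd_rdistrib matrix_vector_right_distrib)

lemma horner_vec_smult: "horner_vec A v (smult c p) = c *s horner_vec A v p"
  by (induction p) (auto simp: vector_add_ldistrib matrix_vector_smult vector_smult_assoc)

lemma horner_vec_linear_factor:
  "horner_vec A v ([:-r, 1:] * q) = (A - mat r) *v horner_vec A v q"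
proof -
  have "[:-r, 1:] * q = smult (-r) q + pCons 0 q" by simp
  moreover have "(-r) *s w = - (r *s w)" for w :: "complex^'n" by (simp add: vec_eq_iff)
  ultimately show ?thesis
    by (simp only: horner_vec_add horner_vec_smult horner_vec_pCons)
       (simp add: matrix_vector_mult_diff_rdistrib mat_mult_vec)
qed

text \<open>Linear factors of \<open>p\<close> are split off one at a time. The first quotient q for
  which q(A) v is nonzero gives an eigenvector, and it lies in \<open>W\<close> because every q(A) v
  does.\<close>

lemma horner_vec_root:
  assumes "p \<noteq> 0" "horner_vec A v p = 0" "v \<noteq> 0"
    and W: "vec.subspace W" "v \<in> W" "\<And>w. w \<in> W \<Longrightarrow> A *v w \<in> W"
  shows "\<exists>w\<in>W. w \<noteq> 0 \<and> (\<exists>c. A *v w = c *s w)"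
  using assms(1,2)
proof (induction "degree p" arbitrary: p rule: less_induct)
  case less
  have hW: "horner_vec A v q \<in> W" for q
    by (induction q) (auto simp: W vec.subspace_0 vec.subspace_add vec.subspace_scale)
  show ?case
  proof (cases "degree p = 0")
    case True
    then obtain c where "p = [:c:]" by (metis degree_eq_zeroE)
    thus ?thesis using less.prems assms(3) by auto
  next
    case False
    hence "\<not> constant (poly p)" by (simp add: constant_degree)
    then obtain r where "poly p r = 0" using fundamental_theorem_of_algebra by blast
    then obtain q where q: "p = [:-r, 1:] * q" by (metis poly_eq_0_iff_dvd dvdE)
    have q0: "q \<noteq> 0" using less.prems q by auto
    have z: "(A - mat r) *v horner_vec A v q = 0"
      using less.prems(2) unfolding q horner_vec_linear_factor .
    show ?thesis
    proof (cases "horner_vec A v q = 0")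
      case True
      have "degree q < degree p" unfolding q using q0 by (subst degree_mult_eq) auto
      thus ?thesis using less.hyps q0 True by blast
    next
      case False
      have "A *v horner_vec A v q = r *s horner_vec A v q"
        using z by (simp add: matrix_vector_mult_diff_rdistrib mat_mult_vec)
      thus ?thesis using False hW by blast
    qed
  qed
qed

text \<open>The n + 1 vectors v, A v, ..., A^n v are linearly dependent.\<close>

lemma annihilating_poly_exists: "\<exists>p. p \<noteq> 0 \<and> horner_vec (A :: complex^'n^'n) v p = 0"
proof (rule ccontr)
  assume n: "\<nexists>p. p \<noteq> 0 \<and> horner_vec A v p = 0"
  define g where "g k = horner_vec A v (monom 1 k)" for k
  have diff0: "horner_vec A v (p - q) = horner_vec A v p - horner_vec A v q" for p q
    by (metis add_diff_cancel_right' diff_add_cancel horner_vec_add)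
  \<comment> \<open>Dependence is stated for sets, so the vectors have to be distinct; a repetition
    among them would already be an annihilating polynomial.\<close>
  have inj: "inj g"
  proof (rule injI)
    fix a b assume "g a = g b"
    hence "horner_vec A v (monom 1 a - monom 1 b) = 0" by (simp add: diff0 g_def)
    hence "monom (1::complex) a = monom 1 b" using n by (metis eq_iff_diff_eq_0)
    thus "a = b" by (metis degree_monom_eq zero_neq_one)
  qed
  have sumv: "horner_vec A v (\<Sum>i\<in>S. f i) = (\<Sum>i\<in>S. horner_vec A v (f i))" for f and S :: "nat set"
    by (induction S rule: infinite_finite_induct) (auto simp: horner_vec_add)
  have ind: "vec.independent (g ` {..CARD('n)})"
  proof (rule ccontr)
    assume "\<not> vec.independent (g ` {..CARD('n)})"
    then obtain u where u: "(\<Sum>v\<in>g ` {..CARD('n)}. u v *s v) = 0" "\<exists>x\<in>g ` {..CARD('n)}. u x \<noteq> 0"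
      using vec.dependent_finite[of "g ` {..CARD('n)}"] by auto
    define p where "p = (\<Sum>k\<le>CARD('n). monom (u (g k)) k)"
    have mm: "horner_vec A v (monom c k) = c *s g k" for c k
      by (metis g_def horner_vec_smult mult.right_neutral smult_monom)
    have "horner_vec A v p = (\<Sum>k\<le>CARD('n). u (g k) *s g k)"
      by (simp add: p_def sumv mm)
    also have "\<dots> = 0" using u(1) by (subst (asm) sum.reindex) (auto intro: inj_on_subset[OF inj])
    finally have "p = 0" using n by blast
    moreover from u(2) obtain k where "k \<le> CARD('n)" "u (g k) \<noteq> 0" by auto
    moreover from \<open>k \<le> _\<close> have "coeff p k = u (g k)"
      by (simp add: p_def coeff_sum)
    ultimately show False by simp
  qed
  have "card (g ` {..CARD('n)}) = Suc CARD('n)"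
    by (subst card_image) (auto intro: inj_on_subset[OF inj])
  moreover have "card (g ` {..CARD('n)}) \<le> vec.dim (UNIV :: (complex^'n) set)"
    using ind by (intro vec.independent_card_le_dim) auto
  ultimately show False by (simp add: card_cart_basis)
qed

lemma eigenvector_in_invariant_subspace:
  assumes "vec.subspace W" "v \<in> W" "v \<noteq> 0" "\<And>w. w \<in> W \<Longrightarrow> A *v w \<in> W"
  shows "\<exists>w\<in>W. w \<noteq> 0 \<and> (\<exists>c. A *v w = c *s (w :: complex^'n))"
  using annihilating_poly_exists[of A v] horner_vec_root[OF _ _ assms(3,1,2,4)] by blast

text \<open>Eigenvectors are collected as columns of \<open>P\<close>. Since
  \<open>A ** P = P ** diagm d\<close>, the kernel of \<open>P\<close> is invariant under
  \<open>diagm d\<close>; if nonzero, it would contain an eigenvector of \<open>diagm d\<close>,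
  that is, a multiple of a coordinate vector, but \<open>P\<close> sends these to the nonzero
  \<open>v i\<close>.\<close>

lemma distinct_eigenvalues_diagonalizable:
  assumes "inj (d :: 'n::finite \<Rightarrow> complex)" "range d \<subseteq> matrix_spectrum A"
  shows "\<exists>P. invertible P \<and> A = conjug P (diagm d)"
proof -
  have "\<forall>i. \<exists>v. v \<noteq> 0 \<and> A *v v = d i *s v"
    using assms(2) unfolding matrix_spectrum_def by auto
  then obtain v where v: "\<And>i. v i \<noteq> 0" "\<And>i. A *v v i = d i *s v i" by metis
  define P :: "complex^'n^'n" where "P = (\<chi> i j. v j $ i)"
  have Pcol: "column j P = v j" for j by (simp add: P_def column_def vec_eq_iff)
  have AP: "A ** P = P ** diagm d"
  proof -
    have "(A ** P) $ i $ j = (P ** diagm d) $ i $ j" for i j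
    proof -
      have "(A ** P) $ i $ j = (A *v v j) $ i"
        by (metis (no_types, lifting) Pcol column_def column_mult vec_lambda_beta)
      thus ?thesis by (simp add: v mult_diagm_nth P_def mult.commute)
    qed
    thus ?thesis by (simp add: vec_eq_iff)
  qed
  define W where "W = {x. P *v x = 0}"
  have "x = 0" if x: "P *v x = 0" for x
  proof (rule ccontr)
    assume x0: "x \<noteq> 0"
    have "\<exists>w\<in>W. w \<noteq> 0 \<and> (\<exists>c. diagm d *v w = c *s w)"
    proof (rule eigenvector_in_invariant_subspace[OF _ _ x0])
      show "vec.subspace W" unfolding W_def vec.subspace_def
        by (auto simp: matrix_vector_right_distrib matrix_vector_smult)
      show "x \<in> W" using x by (simp add: W_def)
      fix w assume "w \<in> W"
      hence "P *v w = 0" by (simp add: W_def)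
      thus "diagm d *v w \<in> W" by (simp add: W_def matrix_vector_mul_assoc flip: AP)
         (simp flip: matrix_vector_mul_assoc)
    qed
    then obtain w c where w: "P *v w = 0" "w \<noteq> 0" "diagm d *v w = c *s w" by (auto simp: W_def)
    from w(2) obtain i where i: "w $ i \<noteq> 0" by (auto simp: vec_eq_iff)
    have eq: "d j * w $ j = c * w $ j" for j using w(3) by (metis diagm_vec vector_smult_component)
    have "w $ j = 0" if "j \<noteq> i" for j
      using eq[of j] eq[of i] i that assms(1) by (metis injD mult_cancel_right)
    hence "w = w $ i *s axis i 1" by (simp add: vec_eq_iff axis_def)
    hence "P *v w = w $ i *s v i" by (metis Pcol column_eq matrix_vector_smult)
    thus False using w(1) i v(1) by simp
  qed
  hence "invertible P" by (simp add: invertible_ker)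
  thus ?thesis using conjug_eqI AP by blast
qed

subsection \<open>Schur triangularization and the spectral theorem\<close>

lemma orthonormal_complement_nonzero:
  fixes u :: "nat \<Rightarrow> complex^'n"
  assumes "k < CARD('n)" "\<And>i j. i < k \<Longrightarrow> j < k \<Longrightarrow> cinner (u i) (u j) = (if i = j then 1 else 0)"
  shows "\<exists>v. v \<noteq> 0 \<and> (\<forall>i<k. cinner (u i) v = 0)"
proof (rule ccontr)
  assume "\<not> ?thesis"
  hence z: "v = 0" if "\<forall>i<k. cinner (u i) v = 0" for v using that by blast
  have "x \<in> vec.span (u ` {..<k})" for x
  proof -
    define y where "y = x - (\<Sum>i<k. cinner (u i) x *s u i)"
    have "cinner (u j) y = 0" if "j < k" for j
    proof -
      have "(\<Sum>i<k. cinner (u i) x * cinner (u j) (u i)) = (\<Sum>i<k. if i = j then cinner (u i) x else 0)"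
        using that by (intro sum.cong) (auto simp: assms(2))
      thus ?thesis using that
        by (simp add: y_def cinner_diff_right cinner_sum_right cinner_scale_right)
    qed
    hence "x = (\<Sum>i<k. cinner (u i) x *s u i)" using z[of y] by (simp add: y_def)
    thus ?thesis by (metis (no_types, lifting) imageI vec.span_base vec.span_scale vec.span_sum)
  qed
  hence "vec.dim (UNIV :: (complex^'n) set) \<le> card (u ` {..<k})"
    by (intro vec.dim_le_card) auto
  also have "\<dots> \<le> k" by (metis card_image_le card_lessThan finite_lessThan)
  finally show False using assms(1) by (simp add: card_cart_basis)
qed

text \<open>The second clause places \<open>A *v u j\<close> in the span of the vectors up to index
  \<open>j\<close>. Phrasing it through the vectors orthogonal to them makes it testable by inner
  products alone.\<close>

definition schur_family :: "complex^'n^'n \<Rightarrow> nat \<Rightarrow> (nat \<Rightarrow> complex^'n) \<Rightarrow> bool" where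
  "schur_family A k u \<longleftrightarrow>
     (\<forall>i<k. \<forall>j<k. cinner (u i) (u j) = (if i = j then 1 else 0)) \<and>
     (\<forall>j<k. \<forall>w. (\<forall>i\<le>j. cinner (u i) w = 0) \<longrightarrow> cinner w (A *v u j) = 0)"

lemma normalize_cinner:
  assumes "v \<noteq> 0"
  obtains c where "c \<noteq> 0" "cinner (c *s v) (c *s v) = 1"
proof
  show "complex_of_real (1 / norm v) \<noteq> 0" using assms by simp
  show "cinner (complex_of_real (1 / norm v) *s v) (complex_of_real (1 / norm v) *s v) = 1"
    using assms by (simp only: cinner_scale_left cinner_scale_right) (simp add: cinner_self power2_eq_square)
qed

text \<open>\<open>M\<close> is \<open>A\<close> followed by the orthogonal projection onto the
  complement \<open>W\<close> of the vectors found so far. It has an eigenvector in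
  \<open>W\<close>, and along this vector \<open>A\<close> stays within the enlarged span.\<close>

lemma schur_family_step:
  assumes "schur_family A k u" "k < CARD('n)"
  shows "\<exists>v. schur_family A (Suc k) (u(k := v :: complex^'n))"
proof -
  have on: "\<And>i j. i < k \<Longrightarrow> j < k \<Longrightarrow> cinner (u i) (u j) = (if i = j then 1 else 0)"
    using assms(1) unfolding schur_family_def by auto
  define W where "W = {v. \<forall>i<k. cinner (u i) v = 0}"
  define M where "M = (mat 1 - (\<Sum>i<k. (\<chi> a b. u i $ a * cnj (u i $ b)))) ** A"
  have ov: "(\<chi> a b. p $ a * cnj (q $ b)) *v w = cinner q w *s p" for p q w :: "complex^'n"
    by (simp add: vec_eq_iff matrix_vector_mult_def cinner_def sum_distrib_left sum_distrib_right mult_ac)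
  have Mv: "M *v w = A *v w - (\<Sum>i<k. cinner (u i) (A *v w) *s u i)" for w
    unfolding M_def matrix_vector_mul_assoc[symmetric]
    by (simp add: matrix_vector_mult_diff_rdistrib matrix_vector_sum_distrib ov)
  obtain v0 where v0: "v0 \<noteq> 0" "v0 \<in> W"
    using orthonormal_complement_nonzero[OF assms(2) on] by (auto simp: W_def)
  have "\<exists>w\<in>W. w \<noteq> 0 \<and> (\<exists>c. M *v w = c *s w)"
  proof (rule eigenvector_in_invariant_subspace[OF _ v0(2,1)])
    show "vec.subspace W" unfolding W_def vec.subspace_def by (auto simp: cinner_simps)
    fix w assume "w \<in> W"
    have "cinner (u j) (M *v w) = 0" if "j < k" for j
    proof -
      have "(\<Sum>i<k. cinner (u i) (A *v w) * cinner (u j) (u i)) =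
            (\<Sum>i<k. if i = j then cinner (u i) (A *v w) else 0)"
        using that by (intro sum.cong) (auto simp: on)
      thus ?thesis using that
        by (simp add: Mv cinner_diff_right cinner_sum_right cinner_scale_right)
    qed
    thus "M *v w \<in> W" by (simp add: W_def)
  qed
  then obtain w c where w: "w \<in> W" "w \<noteq> 0" "M *v w = c *s w" by blast
  obtain s where s: "s \<noteq> 0" "cinner (s *s w) (s *s w) = 1" using normalize_cinner[OF w(2)] .
  define v where "v = s *s w"
  have v: "\<And>i. i < k \<Longrightarrow> cinner (u i) v = 0" "cinner v v = 1" "M *v v = c *s v"
    using w s by (auto simp: v_def W_def cinner_scale_right matrix_vector_smult vector_smult_assoc mult.commute)
  have v': "\<And>i. i < k \<Longrightarrow> cinner v (u i) = 0" using v(1) cinner_eq_0_sym by blast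
  have "schur_family A (Suc k) (u(k := v))"
    unfolding schur_family_def
  proof (intro conjI allI impI)
    fix i j assume "i < Suc k" "j < Suc k"
    thus "cinner ((u(k := v)) i) ((u(k := v)) j) = (if i = j then 1 else 0)"
      by (auto simp: less_Suc_eq v v' on)
  next
    fix j x assume j: "j < Suc k" and x: "\<forall>i\<le>j. cinner ((u(k := v)) i) x = 0"
    show "cinner x (A *v (u(k := v)) j) = 0"
    proof (cases "j = k")
      case True
      have "A *v v = c *s v + (\<Sum>i<k. cinner (u i) (A *v v) *s u i)"
        using v(3) Mv[of v] by (simp add: algebra_simps)
      hence e: "cinner x (A *v v) = c * cinner x v + (\<Sum>i<k. cinner (u i) (A *v v) * cinner x (u i))"
        by (metis (no_types, lifting) cinner_add_right cinner_scale_right cinner_sum_right sum.cong)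
      have "cinner x v = 0" using x True cinner_eq_0_sym by force
      moreover have "cinner x (u i) = 0" if "i < k" for i
      proof -
        have "cinner ((u(k := v)) i) x = 0" using x[rule_format, of i] that True by simp
        thus ?thesis using that cinner_eq_0_sym[of "u i" x] by simp
      qed
      ultimately have "cinner x (A *v v) = 0" using e by simp
      thus ?thesis using True by simp
    next
      case False
      hence jk: "j < k" using j by simp
      have "\<forall>i\<le>j. cinner (u i) x = 0" using x jk
        by (metis fun_upd_apply le_less_trans less_irrefl)
      thus ?thesis using assms(1) jk unfolding schur_family_def by auto
    qed
  qed
  thus ?thesis by blast
qed

lemma schur_family_extend:
  assumes "schur_family A k (u :: nat \<Rightarrow> complex^'n)" "k \<le> CARD('n)"
  shows "\<exists>u'. schur_family A CARD('n) u' \<and> (\<forall>i<k. u' i = u i)"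
  using assms
proof (induction "CARD('n) - k" arbitrary: k u)
  case 0
  thus ?case by auto
next
  case (Suc m)
  hence "k < CARD('n)" by simp
  then obtain v where v: "schur_family A (Suc k) (u(k := v))" using schur_family_step Suc.prems by blast
  obtain u' where "schur_family A CARD('n) u'" "\<forall>i<Suc k. u' i = (u(k := v)) i"
    using Suc.hyps(1)[OF _ v] Suc.hyps(2) \<open>k < CARD('n)\<close>
    by (metis (no_types, lifting) Suc_diff_Suc Suc_inject Suc_leI)
  thus ?case by (intro exI[of _ u']) auto
qed

lemma finite_enumeration_exists: "\<exists>f :: 'n::finite \<Rightarrow> nat. bij_betw f UNIV {..<CARD('n)}"
  by (metis atLeast0LessThan ex_bij_betw_finite_nat finite_class.finite_UNIV)

lemma unitary_of_family:
  assumes "bij_betw f (UNIV :: 'n::finite set) {..<CARD('n)}" "schur_family A CARD('n) (u :: nat \<Rightarrow> complex^'n)"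
  defines "U \<equiv> (\<chi> a b. u (f b) $ a)"
  shows "unitary U" "\<And>j. column j U = u (f j)"
    and "\<And>i j. f j < f i \<Longrightarrow> conjug (conj_transpose U) A $ i $ j = 0"
proof -
  have f: "f i < CARD('n)" for i using assms(1) unfolding bij_betw_def by auto
  have inj: "f i = f j \<longleftrightarrow> i = j" for i j using assms(1) unfolding bij_betw_def by (metis injD)
  show col: "\<And>j. column j U = u (f j)" by (simp add: U_def column_def vec_eq_iff)
  show "unitary U" using assms(2) f inj by (auto simp: unitary_iff_columns col schur_family_def)
  note U = this
  fix i j assume ij: "f j < f i"
  have "cinner (u (f i)) (A *v u (f j)) = 0"
  proof -
    have "\<forall>k\<le>f j. cinner (u k) (u (f i)) = 0"
      using assms(2) f[of i] ij unfolding schur_family_def by (metis le_less_trans less_trans not_less)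
    thus ?thesis using assms(2) f[of j] unfolding schur_family_def by blast
  qed
  thus "conjug (conj_transpose U) A $ i $ j = 0" by (simp add: conjug_unitary_nth U col)
qed

lemma schur_triangularization:
  assumes "bij_betw f (UNIV :: 'n::finite set) {..<CARD('n)}"
  shows "\<exists>U T. unitary U \<and> (A :: complex^'n^'n) = conjug U T \<and> (\<forall>i j. f j < f i \<longrightarrow> T $ i $ j = 0)"
proof -
  have "schur_family A 0 (\<lambda>_. 0)" by (simp add: schur_family_def)
  then obtain u where u: "schur_family A CARD('n) u" using schur_family_extend by blast
  note U = unitary_of_family[OF assms u]
  let ?U = "\<chi> a b. u (f b) $ a"
  have "A = conjug ?U (conjug (conj_transpose ?U) A)"
    using unitary_invertible[OF U(1)] unitary_matrix_inv[OF U(1)] by (metis conjug_inv_cancel(2))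
  thus ?thesis using U by blast
qed

lemma orthonormal_pair_extends:
  assumes "cinner u u = 1" "cinner v v = 1" "cinner u v = 0" "CARD('n) \<ge> 2"
  shows "\<exists>U i j. unitary U \<and> i \<noteq> j \<and> column i U = u \<and> column j U = (v :: complex^'n)"
proof -
  obtain f :: "'n \<Rightarrow> nat" where f: "bij_betw f UNIV {..<CARD('n)}" using finite_enumeration_exists by blast
  define w where "w i = (if i = 0 then u else v)" for i :: nat
  have vu: "cinner v u = 0" using assms(3) cinner_eq_0_sym by blast
  \<comment> \<open>For the zero matrix the triangularity clause is empty, so a Schur family is just
    an orthonormal family and the extension lemma completes it to a basis.\<close>
  have "schur_family 0 2 w"
    using assms vu by (auto simp: schur_family_def w_def)
  then obtain w' where w': "schur_family 0 CARD('n) w'" "\<forall>i<2. w' i = w i"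
    using schur_family_extend assms(4) by blast
  obtain i j where ij: "f i = 0" "f j = 1"
    using f assms(4) unfolding bij_betw_def by (metis (no_types, lifting) One_nat_def Suc_1 Suc_le_lessD
       image_iff lessThan_iff less_trans zero_less_one)
  note U = unitary_of_family[OF f w'(1)]
  show ?thesis using U(1) U(2)[of i] U(2)[of j] ij w'(2) w_def
    by (metis one_less_numeral_iff semiring_norm(76) zero_less_numeral zero_neq_one)
qed

lemma orthonormal_vector_extends:
  assumes "cinner u u = 1" "CARD('n) \<ge> 2"
  shows "\<exists>U i. unitary U \<and> column i U = (u :: complex^'n)"
proof -
  have "\<exists>v. v \<noteq> 0 \<and> (\<forall>i<1. cinner ((\<lambda>_. u) i) v = 0)"
    using orthonormal_complement_nonzero[of 1 "\<lambda>_. u"] assms by auto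
  then obtain v where v: "v \<noteq> 0" "cinner u v = 0" by auto
  obtain c where c: "cinner (c *s v) (c *s v) = 1" using normalize_cinner[OF v(1)] by blast
  show ?thesis using orthonormal_pair_extends[OF assms(1) c _ assms(2)] v by (auto simp: cinner_scale_right)
qed

text \<open>Two vectors do not span when n >= 3. Gram-Schmidt turns them into an orthonormal family
  of length at most 2, to which \<open>orthonormal_complement_nonzero\<close> applies.\<close>

lemma common_orthogonal_vector:
  assumes "CARD('n) \<ge> 3"
  shows "\<exists>z. cinner z z = 1 \<and> cinner u z = 0 \<and> cinner (v :: complex^'n) z = 0"
proof -
  have "\<exists>z. z \<noteq> 0 \<and> cinner u z = 0 \<and> cinner v z = 0"
  proof (cases "u = 0 \<and> v = 0")
    case True
    thus ?thesis by (intro exI[of _ "axis undefined 1"]) simp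
  next
    case False
    have *: "\<exists>z. z \<noteq> 0 \<and> cinner x z = 0 \<and> cinner y z = 0" if x: "x \<noteq> 0" for x y :: "complex^'n"
    proof -
      obtain s where s: "s \<noteq> 0" "cinner (s *s x) (s *s x) = 1" using normalize_cinner[OF x] .
      define x' where "x' = s *s x"
      define y1 where "y1 = y - cinner x' y *s x'"
      have xy: "cinner x' y1 = 0" "cinner x' x' = 1" using s by (auto simp: y1_def x'_def cinner_simps)
      have zx: "cinner x z = 0" if "cinner x' z = 0" for z using that s by (simp add: x'_def cinner_scale_left)
      have zy: "cinner y z = 0" if "cinner x' z = 0" "cinner y1 z = 0" for z
        using that by (simp add: y1_def cinner_simps)
      show ?thesis
      proof (cases "y1 = 0")
        case True
        have "\<exists>v. v \<noteq> 0 \<and> (\<forall>i<1. cinner ((\<lambda>_. x') i) v = 0)"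
          using orthonormal_complement_nonzero[of 1 "\<lambda>_. x'"] assms xy by auto
        thus ?thesis using zx zy True by auto
      next
        case False
        obtain t where t: "t \<noteq> 0" "cinner (t *s y1) (t *s y1) = 1" using normalize_cinner[OF False] .
        define w where "w i = (if i = 0 then x' else t *s y1)" for i :: nat
        have yx: "cinner y1 x' = 0" using xy cinner_eq_0_sym by blast
        have "\<exists>v. v \<noteq> 0 \<and> (\<forall>i<2. cinner (w i) v = 0)"
          by (rule orthonormal_complement_nonzero)
             (use assms xy yx t in \<open>auto simp: w_def cinner_scale_left cinner_scale_right\<close>)
        then obtain z where z: "z \<noteq> 0" "\<forall>i<2. cinner (w i) z = 0" by blast
        have "cinner x' z = 0" "cinner (t *s y1) z = 0"
          using z(2)[rule_format, of 0] z(2)[rule_format, of 1] by (auto simp: w_def)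
        thus ?thesis using zx zy z(1) t by (auto simp: cinner_scale_left)
      qed
    qed
    show ?thesis using False *[of u v] *[of v u] by auto
  qed
  then obtain z where z: "z \<noteq> 0" "cinner u z = 0" "cinner v z = 0" by blast
  obtain c where "cinner (c *s z) (c *s z) = 1" using normalize_cinner[OF z(1)] by blast
  thus ?thesis using z by (intro exI[of _ "c *s z"]) (auto simp: cinner_scale_right)
qed

lemma normal_conjug_unitary:
  assumes "unitary U"
  shows "normal_matrix (conjug U A) \<longleftrightarrow> normal_matrix A"
  unfolding normal_matrix_def conj_transpose_conjug_unitary[OF assms]
  by (simp add: conjug_mult[symmetric] unitary_invertible assms conjug_eq_iff)

lemma normal_diagm: "normal_matrix (diagm d)"
  by (simp add: normal_matrix_def conj_transpose_diagm diagm_commute)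

text \<open>Normality equates the norms of row i and column i. In the order of \<open>f\<close>,
  column i already vanishes off the diagonal when row i is reached, so the row has to vanish there
  too.\<close>

lemma normal_triangular_diagonal:
  assumes "inj (f :: 'n::finite \<Rightarrow> nat)" "\<And>i j. f j < f i \<Longrightarrow> T $ i $ j = 0" "normal_matrix (T :: complex^'n^'n)"
  shows "T = diagm (\<lambda>i. T $ i $ i)"
proof -
  have "\<forall>j. j \<noteq> i \<longrightarrow> T $ i $ j = 0" for i
  proof (induction "f i" arbitrary: i rule: less_induct)
    case less
    have c: "T $ j $ i = 0" if "j \<noteq> i" for j
    proof (cases "f j < f i")
      case True thus ?thesis using less that by auto
    next
      case False thus ?thesis using assms(1,2) that by (metis injD linorder_neqE_nat)
    qed
    have mm: "z * cnj z = of_real ((norm z)\<^sup>2)" for z by (metis complex_norm_square of_real_power)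
    have "(T ** conj_transpose T) $ i $ i = (conj_transpose T ** T) $ i $ i"
      using assms(3) by (simp add: normal_matrix_def)
    hence "(\<Sum>j\<in>UNIV. T $ i $ j * cnj (T $ i $ j)) = (\<Sum>j\<in>UNIV. T $ j $ i * cnj (T $ j $ i))"
      by (simp add: matrix_matrix_mult_def conj_transpose_nth mult.commute)
    hence "of_real (\<Sum>j\<in>UNIV. (norm (T $ i $ j))\<^sup>2) = (of_real (\<Sum>j\<in>UNIV. (norm (T $ j $ i))\<^sup>2) :: complex)"
      unfolding mm of_real_sum .
    hence "(\<Sum>j\<in>UNIV. (norm (T $ i $ j))\<^sup>2) = (\<Sum>j\<in>UNIV. (norm (T $ j $ i))\<^sup>2)"
      using of_real_eq_iff by blast
    also have "\<dots> = (norm (T $ i $ i))\<^sup>2"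
      using c by (subst sum.remove[of _ i]) auto
    finally have "(\<Sum>j\<in>UNIV - {i}. (norm (T $ i $ j))\<^sup>2) = 0"
      by (subst (asm) sum.remove[of _ i]) auto
    hence "\<forall>j\<in>UNIV - {i}. (norm (T $ i $ j))\<^sup>2 = 0"
      by (subst (asm) sum_nonneg_eq_0_iff) auto
    thus ?case by auto
  qed
  thus ?thesis by (auto simp: vec_eq_iff diagm_nth)
qed

lemma normal_matrix_iff:
  "normal_matrix (A :: complex^'n^'n) \<longleftrightarrow> (\<exists>U d. unitary U \<and> A = conjug U (diagm d))"
proof
  assume A: "normal_matrix A"
  obtain f :: "'n \<Rightarrow> nat" where f: "bij_betw f UNIV {..<CARD('n)}" using finite_enumeration_exists by blast
  then obtain U T where U: "unitary U" "A = conjug U T" "\<forall>i j. f j < f i \<longrightarrow> T $ i $ j = 0"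
    using schur_triangularization by blast
  have "T = diagm (\<lambda>i. T $ i $ i)"
    using normal_triangular_diagonal[of f T] f U A by (auto simp: bij_betw_def normal_conjug_unitary)
  thus "\<exists>U d. unitary U \<and> A = conjug U (diagm d)" using U by metis
qed (auto simp: normal_conjug_unitary normal_diagm)

lemma matrix_spectrum_nonempty: "matrix_spectrum (A :: complex^'n^'n) \<noteq> {}"
proof -
  obtain f :: "'n \<Rightarrow> nat" where f: "bij_betw f UNIV {..<CARD('n)}" using finite_enumeration_exists by blast
  then obtain U T where U: "unitary U" "A = conjug U T" "\<forall>i j. f j < f i \<longrightarrow> T $ i $ j = 0"
    using schur_triangularization by blast
  have "det (mat (T $ undefined $ undefined) - T) = 0"
    using f U(3) by (subst det_char_triangular[of f]) (auto simp: bij_betw_def prod_zero_iff)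
  thus ?thesis using U spectrum_conjug[OF unitary_invertible[OF U(1)], of T] by (auto simp: matrix_spectrum_det)
qed

section \<open>Maps on rays that preserve orthonormal frames\<close>

lemma tendsto_matrix_mult [tendsto_intros]:
  fixes f g :: "'b \<Rightarrow> complex^'n^'n"
  assumes "(f \<longlongrightarrow> A) F" "(g \<longlongrightarrow> B) F"
  shows "((\<lambda>x. f x ** g x) \<longlongrightarrow> A ** B) F"
  unfolding matrix_matrix_mult_def by (intro tendsto_intros assms)

lemma tendsto_matrix_vector_mult [tendsto_intros]:
  fixes f :: "'b \<Rightarrow> complex^'n^'n"
  assumes "(f \<longlongrightarrow> A) F" "(g \<longlongrightarrow> v) F"
  shows "((\<lambda>x. f x *v g x) \<longlongrightarrow> A *v v) F"
  unfolding matrix_vector_mult_def by (intro tendsto_intros assms)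

lemma tendsto_smult [tendsto_intros]:
  fixes g :: "'b \<Rightarrow> complex^'n"
  assumes "(f \<longlongrightarrow> c) F" "(g \<longlongrightarrow> v) F"
  shows "((\<lambda>x. f x *s g x) \<longlongrightarrow> c *s v) F"
  unfolding vector_scalar_mult_def by (intro tendsto_intros assms)

lemma tendsto_conjug [tendsto_intros]:
  fixes f :: "'b \<Rightarrow> complex^'n^'n"
  shows "(f \<longlongrightarrow> A) F \<Longrightarrow> ((\<lambda>x. conjug P (f x)) \<longlongrightarrow> conjug P A) F"
  unfolding conjug_def by (intro tendsto_intros)

lemma tendsto_transpose [tendsto_intros]:
  "(f \<longlongrightarrow> A) F \<Longrightarrow> ((\<lambda>x. transpose (f x :: complex^'n^'n)) \<longlongrightarrow> transpose A) F"
  unfolding transpose_def by (intro tendsto_intros)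

lemma tendsto_conj_transpose [tendsto_intros]:
  "(f \<longlongrightarrow> A) F \<Longrightarrow> ((\<lambda>x. conj_transpose (f x)) \<longlongrightarrow> conj_transpose A) F"
  unfolding conj_transpose_def by (intro tendsto_intros)

lemma tendsto_mat [tendsto_intros]:
  fixes f :: "'b \<Rightarrow> complex"
  assumes "(f \<longlongrightarrow> c) F" shows "((\<lambda>x. mat (f x) :: complex^'n^'n) \<longlongrightarrow> mat c) F"
proof -
  have "((\<lambda>x. if i = j then f x else 0) \<longlongrightarrow> (if i = j then c else 0)) F" for i j :: 'n
    using assms by auto
  thus ?thesis unfolding mat_def by (intro tendsto_vec_lambda)
qed

lemma tendsto_diagm [tendsto_intros]:
  fixes f :: "'b \<Rightarrow> 'n::finite \<Rightarrow> complex"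
  assumes "\<And>i. ((\<lambda>x. f x i) \<longlongrightarrow> d i) F" shows "((\<lambda>x. diagm (f x) :: complex^'n^'n) \<longlongrightarrow> diagm d) F"
proof -
  have "((\<lambda>x. if i = j then f x i else 0) \<longlongrightarrow> (if i = j then d i else 0)) F" for i j :: 'n
    using assms by auto
  thus ?thesis unfolding diagm_def by (intro tendsto_vec_lambda)
qed

lemma continuous_on_conjug: "continuous_on S (conjug (P :: complex^'n^'n))"
  unfolding continuous_on_def by (intro ballI tendsto_conjug tendsto_ident_at)

lemma continuous_on_transpose: "continuous_on S (transpose :: complex^'n^'n \<Rightarrow> _)"
  unfolding continuous_on_def by (intro ballI tendsto_transpose tendsto_ident_at)

lemma transpose_conjug:
  assumes "invertible (P :: complex^'n^'n)"
  shows "transpose (conjug P A) = conjug (matrix_inv (transpose P)) (transpose A)"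
    and "matrix_inv (transpose P) = transpose (matrix_inv P)"
    and "invertible (transpose P)"
proof -
  have "transpose P ** transpose (matrix_inv P) = mat 1"
    using assms by (metis matrix_inv_mult(2) matrix_transpose_mul transpose_mat)
  thus i: "matrix_inv (transpose P) = transpose (matrix_inv P)" "invertible (transpose P)"
    using matrix_inv_eqI invertibleI by blast+
  show "transpose (conjug P A) = conjug (matrix_inv (transpose P)) (transpose A)"
    unfolding conjug_def using i(2)
    by (simp add: matrix_inv_inv matrix_transpose_mul i(1)[symmetric] matrix_mul_assoc)
qed

section \<open>Rank-one matrices and coordinate idempotents\<close>

definition bil :: "complex^'n \<Rightarrow> complex^'n \<Rightarrow> complex^'n^'n" where
  "bil p q = (\<chi> i j. p $ i * q $ j)"

definition bdot :: "complex^'n \<Rightarrow> complex^'n \<Rightarrow> complex" where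
  "bdot p q = (\<Sum>i\<in>UNIV. p $ i * q $ i)"

lemma bil_nth: "bil p q $ i $ j = p $ i * q $ j"
  by (simp add: bil_def)

lemma bil_vec: "bil p q *v x = bdot q x *s p"
  by (simp add: bil_def bdot_def vec_eq_iff matrix_vector_mult_def sum_distrib_left sum_distrib_right mult_ac)

lemma mult_bil: "A ** bil p q = bil (A *v p) q"
  by (simp add: bil_def vec_eq_iff matrix_vector_mult_def matrix_matrix_mult_def
      sum_distrib_left sum_distrib_right mult_ac)

lemma bil_zero [simp]: "bil 0 q = 0" "bil p 0 = 0"
  by (simp_all add: bil_def vec_eq_iff)

definition unit_diag :: "'n::finite \<Rightarrow> complex^'n^'n" where
  "unit_diag i = diagm (\<lambda>j. if j = i then 1 else 0)"

lemma unit_diag_nth: "unit_diag i $ a $ b = (if a = i \<and> b = i then 1 else 0)"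
  by (simp add: unit_diag_def diagm_nth)

lemma unit_diag_mult: "unit_diag i ** unit_diag j = (if i = j then unit_diag i else 0)"
  by (auto simp: unit_diag_def diagm_mult vec_eq_iff diagm_nth)

lemma unit_diag_mult_nth: "(unit_diag i ** A) $ a $ b = (if a = i then A $ i $ b else 0)"
  by (simp add: unit_diag_def diagm_mult_nth)

lemma mult_unit_diag_nth: "(A ** unit_diag i) $ a $ b = (if b = i then A $ a $ i else 0)"
  by (simp add: unit_diag_def mult_diagm_nth)

lemma sum_unit_diag: "(\<Sum>i\<in>UNIV. unit_diag i) = mat 1"
  by (auto simp: vec_eq_iff unit_diag_nth mat_nth intro!: sum.neutral)

lemma conjug_unit_diag: "conjug P (unit_diag i) = bil (column i P) (row i (matrix_inv P))"
proof -
  have "(P ** unit_diag i ** matrix_inv P) $ a $ b = bil (column i P) (row i (matrix_inv P)) $ a $ b" for a b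
    by (simp add: matrix_matrix_mult_def[of "P ** unit_diag i"] mult_unit_diag_nth bil_nth column_def row_def
          if_distrib[where f="\<lambda>x. x * _"] cong: if_cong)
  thus ?thesis by (simp add: conjug_def vec_eq_iff)
qed

section \<open>Frame maps: from rays to rank-one idempotents\<close>

definition ray_proj :: "complex^'n \<Rightarrow> complex^'n^'n" where
  "ray_proj v = (\<chi> i j. v $ i * cnj (v $ j) / cinner v v)"

text \<open>A single \<open>P\<close> serves a whole frame: this encodes at once that the images are
  rank-one idempotents, mutually orthogonal, with sum the identity.\<close>

locale frame_map =
  fixes Q :: "complex^'n \<Rightarrow> complex^'n^'n"
  assumes card3: "CARD('n) \<ge> 3"
    and cont: "continuous_on {v. v \<noteq> 0} Q"
    and scale: "\<And>c v. c \<noteq> 0 \<Longrightarrow> v \<noteq> 0 \<Longrightarrow> Q (c *s v) = Q v"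
    and frame: "\<And>U. unitary U \<Longrightarrow> \<exists>P. invertible P \<and> (\<forall>i. Q (column i U) = conjug P (unit_diag i))"
begin

text \<open>Transposition exchanges the two factors of \<open>Q v = bil p q\<close>, so each
  statement about ranges and columns gives its counterpart about kernels and rows.\<close>

lemma frame_map_transpose: "frame_map (\<lambda>v. transpose (Q v))"
proof
  show "CARD('n) \<ge> 3" by (rule card3)
  show "continuous_on {v. v \<noteq> 0} (\<lambda>v. transpose (Q v))"
    using cont unfolding continuous_on_def by (auto intro: tendsto_transpose)
  show "transpose (Q (c *s v)) = transpose (Q v)" if "c \<noteq> 0" "v \<noteq> 0" for c v
    using that by (simp add: scale)
  fix U :: "complex^'n^'n" assume "unitary U"
  then obtain P where P: "invertible P" "\<And>i. Q (column i U) = conjug P (unit_diag i)" using frame by blast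
  have "transpose (Q (column i U)) = conjug (matrix_inv (transpose P)) (unit_diag i)" for i
    using P transpose_conjug(1)[OF P(1)] by (simp add: unit_diag_def)
  thus "\<exists>P. invertible P \<and> (\<forall>i. transpose (Q (column i U)) = conjug P (unit_diag i))"
    using transpose_conjug(3)[OF P(1)] invertible_matrix_inv by blast
qed

lemma scaled_eq: "v \<noteq> 0 \<Longrightarrow> v = c *s w \<Longrightarrow> Q v = Q w"
  using scale[of c w] by auto

lemma card2: "CARD('n) \<ge> 2" using card3 by simp

lemma orthogonal_pair_frame:
  fixes u v :: "complex^'n"
  assumes "u \<noteq> 0" "v \<noteq> 0" "cinner u v = 0"
  obtains U i j c d where "unitary U" "i \<noteq> j" "c \<noteq> 0" "d \<noteq> 0" "column i U = c *s u" "column j U = d *s v"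
proof -
  obtain c where c: "c \<noteq> 0" "cinner (c *s u) (c *s u) = 1" using normalize_cinner[OF assms(1)] .
  obtain d where d: "d \<noteq> 0" "cinner (d *s v) (d *s v) = 1" using normalize_cinner[OF assms(2)] .
  have "cinner (c *s u) (d *s v) = 0" using assms(3) by (simp add: cinner_simps)
  thus ?thesis using orthonormal_pair_extends[OF c(2) d(2) _ card2] c(1) d(1) that by metis
qed

lemma vector_frame:
  fixes u :: "complex^'n"
  assumes "u \<noteq> 0"
  obtains U i c where "unitary U" "c \<noteq> 0" "column i U = c *s u"
proof -
  obtain c where c: "c \<noteq> 0" "cinner (c *s u) (c *s u) = 1" using normalize_cinner[OF assms(1)] .
  thus ?thesis using orthonormal_vector_extends[OF c(2) card2] that by metis
qed

lemma rank_one: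
  assumes "v \<noteq> 0"
  obtains p q where "Q v = bil p q" "bdot q p = 1"
proof -
  obtain U i c where U: "unitary U" "c \<noteq> 0" "column i U = c *s v" using vector_frame[OF assms] .
  obtain P where P: "invertible P" "\<And>i. Q (column i U) = conjug P (unit_diag i)" using frame U(1) by blast
  have "Q v = bil (column i P) (row i (matrix_inv P))"
    using P(2)[of i] U scale assms by (simp add: conjug_unit_diag)
  moreover have "bdot (row i (matrix_inv P)) (column i P) = (matrix_inv P ** P) $ i $ i"
    by (simp add: bdot_def row_def column_def matrix_matrix_mult_def)
  ultimately show ?thesis using that P(1) by (simp add: matrix_inv_mult mat_nth)
qed

lemma fixed_vector:
  assumes "v \<noteq> 0" obtains r where "r \<noteq> 0" "Q v *v r = r"
proof -
  obtain p q where pq: "Q v = bil p q" "bdot q p = 1" using rank_one[OF assms] .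
  hence "p \<noteq> 0" by (auto simp: bdot_def)
  thus ?thesis using that[of p] pq by (simp add: bil_vec)
qed

lemma nonzero: "v \<noteq> 0 \<Longrightarrow> Q v \<noteq> 0"
  by (metis fixed_vector matrix_vector_mult_0)

lemma orthogonal: "u \<noteq> 0 \<Longrightarrow> v \<noteq> 0 \<Longrightarrow> cinner u v = 0 \<Longrightarrow> Q u ** Q v = 0"
proof -
  assume a: "u \<noteq> 0" "v \<noteq> 0" "cinner u v = 0"
  obtain U i j c d where U: "unitary U" "i \<noteq> j" "c \<noteq> 0" "d \<noteq> 0" "column i U = c *s u" "column j U = d *s v"
    using orthogonal_pair_frame[OF a] .
  obtain P where P: "invertible P" "\<And>i. Q (column i U) = conjug P (unit_diag i)" using frame U(1) by blast
  have "Q (column i U) ** Q (column j U) = 0"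
    using U(2) P by (simp add: conjug_mult[symmetric] unit_diag_mult)
  thus ?thesis using U a scale by simp
qed

text \<open>Complete \<open>a\<close>, \<open>b\<close> to an orthogonal frame. Its other members
  are orthogonal to \<open>z\<close>, so their images annihilate \<open>Q z\<close> on both sides,
  and of the resolution of the identity only \<open>Q a + Q b\<close> acts on
  \<open>Q z\<close>.\<close>

lemma plane_resolution:
  assumes "a \<noteq> 0" "b \<noteq> 0" "cinner a b = 0" "z = \<alpha> *s a + \<beta> *s b" "z \<noteq> 0"
  shows "Q z ** (Q a + Q b) = Q z" "(Q a + Q b) ** Q z = Q z"
proof -
  obtain U i j c d where U: "unitary U" "i \<noteq> j" "c \<noteq> 0" "d \<noteq> 0" "column i U = c *s a" "column j U = d *s b"
    using orthogonal_pair_frame[OF assms(1-3)] .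
  obtain P where P: "invertible P" "\<And>i. Q (column i U) = conjug P (unit_diag i)" using frame U(1) by blast
  have S: "(\<Sum>k\<in>UNIV. Q (column k U)) = mat 1"
    using P by (simp add: conjug_sum[symmetric] sum_unit_diag)
  have col: "column k U \<noteq> 0" for k
    using U(1) unfolding unitary_iff_columns by (metis cinner_zero(1) zero_neq_one)
  have o: "cinner z (column k U) = 0" if "k \<noteq> i" "k \<noteq> j" for k
  proof -
    have "cinner (c *s a) (column k U) = 0" "cinner (d *s b) (column k U) = 0"
      using U(1) that unfolding unitary_iff_columns by (metis U(5,6))+
    thus ?thesis using U(3,4) by (simp add: assms(4) cinner_simps)
  qed
  have oo: "Q z ** Q (column k U) = 0" "Q (column k U) ** Q z = 0" if "k \<noteq> i" "k \<noteq> j" for k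
    using orthogonal[OF assms(5) col o[OF that]] orthogonal[OF col assms(5)] o[OF that] cinner_eq_0_sym
    by blast+
  have "Q z = (\<Sum>k\<in>UNIV. Q z ** Q (column k U))"
    by (simp add: matrix_sum_ldistrib[symmetric] S)
  also have "\<dots> = (\<Sum>k\<in>{i, j}. Q z ** Q (column k U))"
    by (rule sum.mono_neutral_right) (use oo in auto)
  also have "\<dots> = Q z ** (Q a + Q b)"
    using U assms(1,2) scale by (simp add: matrix_distribs)
  finally show "Q z ** (Q a + Q b) = Q z" by simp
  have "Q z = (\<Sum>k\<in>UNIV. Q (column k U) ** Q z)"
    by (simp add: matrix_sum_rdistrib[symmetric] S)
  also have "\<dots> = (\<Sum>k\<in>{i, j}. Q (column k U) ** Q z)"
    by (rule sum.mono_neutral_right) (use oo in auto)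
  also have "\<dots> = (Q a + Q b) ** Q z"
    using U assms(1,2) scale by (simp add: matrix_distribs)
  finally show "(Q a + Q b) ** Q z = Q z" by simp
qed

text \<open>The kernels of \<open>Q u\<close>, as points of the dual projective space, depend on \<open>u\<close> by a
  collineation: if the dual line through two of them lies in the hyperplane \<open>r\<^sup>\<bottom>\<close>,
  so does the image of the whole line through \<open>u\<close> and \<open>w\<close>.\<close>

lemma same_kernel:
  assumes "u \<noteq> 0" "w \<noteq> 0" "z \<noteq> 0" "z = \<alpha> *s u + \<beta> *s w"
    and r: "Q u *v r = 0" "Q w *v r = 0" "Q z *v r \<noteq> 0"
  shows "Q u *v x = 0 \<longleftrightarrow> Q w *v x = 0"
proof (cases "\<exists>c. w = c *s u")
  case True
  thus ?thesis using scaled_eq assms(2) by metis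
next
  case False
  define \<gamma> where "\<gamma> = cinner u w / cinner u u"
  define b where "b = w - \<gamma> *s u"
  have b0: "b \<noteq> 0" using False by (auto simp: b_def)
  have ub: "cinner u b = 0" using assms(1) by (simp add: b_def \<gamma>_def cinner_simps)
  have w: "w = \<gamma> *s u + 1 *s b" by (simp add: b_def)
  have z: "z = (\<alpha> + \<beta> * \<gamma>) *s u + \<beta> *s b"
    unfolding assms(4) b_def by (simp add: vec_eq_iff algebra_simps)
  have Qw: "Q w ** (Q u + Q b) = Q w" by (rule plane_resolution(1)[OF assms(1) b0 ub w assms(2)])
  have Qz: "Q z ** (Q u + Q b) = Q z" by (rule plane_resolution(1)[OF assms(1) b0 ub z assms(3)])
  have "Q w *v (Q b *v r) = 0"
    using arg_cong[OF Qw, of "\<lambda>A. A *v r"] r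
    by (simp add: matrix_vector_mul_assoc[symmetric] matrix_vector_mult_add_rdistrib)
  moreover have Qbr: "Q b *v r \<noteq> 0"
    using arg_cong[OF Qz, of "\<lambda>A. A *v r"] r
    by (auto simp: matrix_vector_mul_assoc[symmetric] matrix_vector_mult_add_rdistrib)
  moreover obtain p q where pq: "Q b = bil p q" using rank_one[OF b0] by metis
  \<comment> \<open>\<open>Q b *v r\<close> is a nonzero multiple of \<open>p\<close>, which
    generates the range of \<open>Q b\<close>. So \<open>Q w\<close> kills that range, the plane
    resolution shrinks to \<open>Q w ** Q u = Q w\<close>, and two rank-one matrices related in this
    way have the same kernel.\<close>
  ultimately have "Q w *v p = 0" by (auto simp: bil_vec matrix_vector_smult)
  hence "Q w ** Q b = 0" by (simp add: pq mult_bil)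
  hence QwQu: "Q w ** Q u = Q w" using Qw by (simp add: matrix_distribs)
  obtain p1 q1 where 1: "Q u = bil p1 q1" "bdot q1 p1 = 1" using rank_one[OF assms(1)] .
  have Qw': "Q w = bil (Q w *v p1) q1" using QwQu 1(1) by (metis mult_bil)
  have "Q w *v p1 \<noteq> 0" using Qw' nonzero[OF assms(2)] by auto
  moreover have "p1 \<noteq> 0" using 1(2) by (auto simp: bdot_def)
  ultimately show ?thesis using 1(1) Qw' by (metis bil_vec vector_mul_eq_0)
qed

text \<open>If independent \<open>e\<close> and \<open>v\<close> had images with a common range, a
  vector \<open>r\<close> of this range would be killed by \<open>Q\<close> at every ray orthogonal
  to \<open>e\<close> or to \<open>v\<close>. By \<open>same_kernel\<close> the kernel of
  \<open>Q (u t)\<close> is then locally constant along a segment orthogonal to \<open>e\<close>,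
  hence constant; but the endpoints of the segment are orthogonal to each other, and orthogonal rays
  have different kernels.\<close>

lemma range_injective:
  assumes e: "e \<noteq> 0" and v: "v \<noteq> 0" and eq: "Q e ** Q v = Q v"
  shows "\<exists>c. v = c *s e"
proof (rule ccontr)
  assume nex: "\<nexists>c. v = c *s e"
  have ev: "cinner e v \<noteq> 0"
    using orthogonal[OF e v] eq nonzero[OF v] by auto
  hence ve: "cinner v e \<noteq> 0" using cinner_eq_0_sym by blast
  define c where "c = cinner e v / cinner e e"
  define f where "f = v - c *s e"
  have f0: "f \<noteq> 0" using nex by (auto simp: f_def)
  have ef: "cinner e f = 0" using e by (simp add: f_def c_def cinner_simps)
  obtain z1 where z1: "cinner z1 z1 = 1" "cinner e z1 = 0" "cinner f z1 = 0"
    using common_orthogonal_vector[OF card3] by blast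
  \<comment> \<open>Giving \<open>z\<close> the norm of \<open>f\<close> makes f + z and f - z
    orthogonal, so that \<open>u\<close> joins two orthogonal vectors between t = -1 and t =
    1.\<close>
  define z where "z = complex_of_real (norm f) *s z1"
  have z: "cinner e z = 0" "cinner f z = 0" "cinner z z = cinner f f"
    using z1 by (simp_all add: z_def cinner_simps cinner_self[of f] power2_eq_square)
  have zf: "cinner z f = 0" "cinner z e = 0" "cinner f e = 0" using z ef cinner_eq_0_sym by blast+
  define u where "u t = f + complex_of_real t *s z" for t :: real
  have v_eq: "v = c *s e + f" by (simp add: f_def)
  have eu: "cinner e (u t) = 0" for t by (simp add: u_def cinner_simps z ef)
  have fu: "cinner f (u t) = cinner f f" for t by (simp add: u_def cinner_simps z)
  have vu: "cinner v (u t) = cinner f f" for t unfolding v_eq by (simp add: cinner_simps eu fu)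
  have ff: "cinner f f \<noteq> 0" using f0 by simp
  have u0: "u t \<noteq> 0" for t using fu[of t] ff by (metis cinner_zero(2))
  \<comment> \<open>Chosen so that \<open>w t\<close>, the shift of \<open>u t\<close> along
    \<open>e\<close>, is orthogonal to \<open>v\<close>.\<close>
  define \<kappa> where "\<kappa> = cinner f f / cinner v e"
  have \<kappa>: "\<kappa> \<noteq> 0" using ff ve by (simp add: \<kappa>_def)
  define w where "w t = u t - \<kappa> *s e" for t
  have vw: "cinner v (w t) = 0" for t using ve by (simp add: w_def cinner_simps vu \<kappa>_def)
  have "cinner f (w t) = cinner f f" for t by (simp add: w_def cinner_simps fu zf)
  hence w0: "w t \<noteq> 0" for t using ff by (metis cinner_zero(2))
  obtain r where r: "r \<noteq> 0" "Q v *v r = r" using fixed_vector[OF v] .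
  have er: "Q e *v r = r" using eq r(2) by (metis matrix_vector_mul_assoc)
  have ur: "Q (u t) *v r = 0" for t
    using orthogonal[OF u0 e] eu er by (metis cinner_eq_0_sym matrix_vector_mul_assoc matrix_vector_mult_0)
  have wr: "Q (w t) *v r = 0" for t
    using orthogonal[OF w0 v] vw r(2) by (metis cinner_eq_0_sym matrix_vector_mul_assoc matrix_vector_mult_0)
  \<comment> \<open>\<open>g (t - s)\<close> is the difference of \<open>u t\<close> and
    \<open>w s\<close>. At 0 it is a multiple of \<open>e\<close>, where \<open>Q\<close> fixes
    \<open>r\<close>; by continuity \<open>r\<close> is not killed nearby, which is the last
    condition of \<open>same_kernel\<close>.\<close>
  define g where "g s = complex_of_real s *s z + \<kappa> *s e" for s :: real
  have "cinner e (g s) = \<kappa> * cinner e e" for s by (simp add: g_def cinner_simps z)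
  hence g0: "g s \<noteq> 0" for s using \<kappa> e by (metis cinner_self_eq_0 cinner_zero(2) mult_eq_0_iff)
  have "((\<lambda>s. Q (g s)) \<longlongrightarrow> Q (g 0)) (at 0)"
  proof (rule continuous_on_tendsto_compose[OF cont])
    show "(g \<longlongrightarrow> g 0) (at 0)" unfolding g_def by (intro tendsto_intros)
  qed (auto simp: g0)
  hence "((\<lambda>s. Q (g s) *v r) \<longlongrightarrow> Q (g 0) *v r) (at 0)" by (intro tendsto_intros)
  moreover have "Q (g 0) *v r = r" using er \<kappa> e by (simp add: g_def scale)
  ultimately have "\<forall>\<^sub>F s in at 0. Q (g s) *v r \<noteq> 0" using r(1) tendsto_imp_eventually_ne by metis
  then obtain \<delta> where \<delta>: "\<delta> > 0" "\<And>s. s \<noteq> 0 \<Longrightarrow> \<bar>s\<bar> < \<delta> \<Longrightarrow> Q (g s) *v r \<noteq> 0"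
    unfolding eventually_at by (auto simp: dist_real_def)
  have gr: "Q (g s) *v r \<noteq> 0" if "\<bar>s\<bar> < \<delta>" for s
    using \<delta>(2)[of s] that r \<open>Q (g 0) *v r = r\<close> by (cases "s = 0") auto
  have k: "Q (u t) *v x = 0 \<longleftrightarrow> Q (u s) *v x = 0" if "\<bar>t - s\<bar> < \<delta>" for t s x
  proof -
    have "g (t - s) = 1 *s u t + (-1) *s w s" "g (s - s) = 1 *s u s + (-1) *s w s"
      by (simp_all add: g_def u_def w_def vec_eq_iff algebra_simps)
    hence "Q (u t) *v x = 0 \<longleftrightarrow> Q (w s) *v x = 0" "Q (u s) *v x = 0 \<longleftrightarrow> Q (w s) *v x = 0"
      using same_kernel[OF u0 w0 g0 _ ur wr gr] that \<delta>(1) by (metis, metis abs_zero diff_self)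
    thus ?thesis by simp
  qed
  \<comment> \<open>Steps of length 2 / N below \<delta> carry the kernel from t = -1 to t =
    1.\<close>
  obtain N :: nat where N0: "real N > 2 / \<delta>" using reals_Archimedean2 by blast
  have "2 / \<delta> > 0" using \<delta>(1) by simp
  hence "N > 0" using N0 by (metis less_trans of_nat_0_less_iff)
  moreover have "2 / real N < \<delta>"
    using N0 \<delta>(1) \<open>N > 0\<close> by (simp add: field_simps)
  ultimately have N: "N > 0" "2 / real N < \<delta>" by auto
  have chain: "Q (u (-1 + real m * (2 / N))) *v x = 0 \<longleftrightarrow> Q (u (-1)) *v x = 0" for m x
  proof (induction m)
    case (Suc m)
    have "\<bar>(-1 + real (Suc m) * (2 / N)) - (-1 + real m * (2 / N))\<bar> < \<delta>"
      using N by (simp add: field_simps)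
    from k[OF this] Suc show ?case by simp
  qed simp
  have same: "Q (u 1) *v x = 0 \<longleftrightarrow> Q (u (-1)) *v x = 0" for x
    using chain[of N x] N(1) by simp
  obtain p where p: "p \<noteq> 0" "Q (u 1) *v p = p" using fixed_vector[OF u0] .
  have "cinner (u (-1)) (u 1) = 0" by (simp add: u_def cinner_simps z zf)
  hence "Q (u (-1)) ** Q (u 1) = 0" by (intro orthogonal u0)
  hence "Q (u (-1)) *v p = 0" using p(2) by (metis matrix_vector_mul_assoc matrix_vector_mult_0)
  thus False using same[of p] p by simp
qed

end

text \<open>The ring laws fix the rationals, continuity fixes the reals, and the image of the
  imaginary unit is a square root of -1.\<close>

lemma additive_multiplicative_continuous:
  fixes h :: "complex \<Rightarrow> complex"
  assumes add: "\<And>x y. h (x + y) = h x + h y" and mul: "\<And>x y. h (x * y) = h x * h y"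
    and one: "h 1 = 1" and cont: "continuous_on UNIV h"
  shows "(\<forall>z. h z = z) \<or> (\<forall>z. h z = cnj z)"
proof -
  have h0: "h 0 = 0" using add[of 0 0] by simp
  have hm: "h (- x) = - h x" for x using add[of x "-x"] h0 by (simp add: add_eq_0_iff)
  have hn: "h (of_nat n) = of_nat n" for n by (induction n) (auto simp: h0 add one)
  have hi: "h (of_int k) = of_int k" for k
    by (cases k) (auto simp: hn hm simp del: of_nat_Suc)
  have hq: "h (of_real r) = of_real r" if rat: "r \<in> \<rat>" for r
  proof -
    obtain a b where ab: "r = of_int a / of_int b" "b \<noteq> 0" using Rats_cases'[OF rat] by (metis less_irrefl)
    have "h (of_real r) * h (of_int b) = h (of_int a)"
      using ab by (simp add: mul[symmetric])
    hence "h (of_real r) = of_int a / of_int b" using ab(2) by (simp add: hi eq_divide_eq)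
    thus ?thesis using ab(1) by simp
  qed
  have hr: "h (of_real r) = of_real r" for r
  proof -
    have "closed {r. h (of_real r) = of_real r}"
      by (intro closed_Collect_eq continuous_intros continuous_on_compose2[OF cont]) auto
    moreover have "\<rat> \<subseteq> {r. h (of_real r) = of_real r}" using hq by auto
    ultimately have "closure \<rat> \<subseteq> {r. h (of_real r) = of_real r}" by (rule closure_minimal[rotated])
    thus ?thesis using Rats_closure_real by auto
  qed
  have "h \<i> * h \<i> = -1" by (metis mul i_squared hm one)
  hence "(h \<i> - \<i>) * (h \<i> + \<i>) = 0" by (simp add: algebra_simps)
  hence "h \<i> = \<i> \<or> h \<i> = - \<i>" by (simp add: add_eq_0_iff2)
  moreover have "h z = of_real (Re z) + h \<i> * of_real (Im z)" for z
    by (metis add mul hr complex_eq)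
  moreover have "z = of_real (Re z) + \<i> * of_real (Im z)" "cnj z = of_real (Re z) + (- \<i>) * of_real (Im z)" for z
    by (simp_all add: complex_eq_iff)
  ultimately show ?thesis by metis
qed

section \<open>Frame maps that send each axis to its coordinate idempotent\<close>

locale normalized_frame_map = frame_map Q for Q :: "complex^'n \<Rightarrow> complex^'n^'n" +
  assumes norm_axis: "\<And>i. Q (axis i 1) = unit_diag i"
begin

lemma normalized_transpose: "normalized_frame_map (\<lambda>v. transpose (Q v))"
proof -
  interpret T: frame_map "\<lambda>v. transpose (Q v)" by (rule frame_map_transpose)
  show ?thesis by unfold_locales (simp add: norm_axis unit_diag_def)
qed

lemma axis_nonzero: "axis i (1::complex) \<noteq> (0 :: complex^'n)"
  by (simp add: axis_eq_0_iff)

lemma zero_row: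
  assumes "v \<noteq> 0" "v $ i = 0"
  shows "Q v $ i $ k = 0"
proof -
  have "Q (axis i 1) ** Q v = 0"
    by (rule orthogonal[OF axis_nonzero assms(1)]) (simp add: cinner_axis assms)
  hence "(unit_diag i ** Q v) $ i $ k = 0" by (simp add: norm_axis)
  thus ?thesis by (simp add: unit_diag_mult_nth)
qed

text \<open>If \<open>p $ i\<close> vanished, \<open>Q v\<close> would have the range of
  \<open>Q r\<close>, where \<open>r\<close> is \<open>v\<close> stripped of its i-th coordinate,
  against \<open>range_injective\<close>. Nonvanishing is what permits division by entries of
  \<open>Q v\<close> afterwards.\<close>

lemma nonzero_component:
  assumes "v $ i \<noteq> 0" "Q v = bil p q"
  shows "p $ i \<noteq> 0"
proof
  assume p: "p $ i = 0"
  have v0: "v \<noteq> 0" using assms(1) by auto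
  define r where "r = v - v $ i *s axis i 1"
  have v: "v = v $ i *s axis i 1 + 1 *s r" by (simp add: r_def)
  have ri: "r $ i = 0" by (simp add: r_def)
  show False
  proof (cases "r = 0")
    case True
    hence "Q v = unit_diag i" using v scaled_eq[OF v0, of "v $ i" "axis i 1"] by (simp add: norm_axis)
    hence "unit_diag i $ i $ i = p $ i * q $ i" using assms(2) by (metis bil_nth)
    thus False using p by (simp add: unit_diag_nth)
  next
    case False
    have "(Q (axis i 1) + Q r) ** Q v = Q v"
      by (rule plane_resolution(2)[OF axis_nonzero False _ v v0]) (simp add: cinner_axis ri)
    moreover have "Q (axis i 1) ** Q v = 0"
      using p by (simp add: norm_axis assms(2) vec_eq_iff unit_diag_mult_nth bil_nth)
    ultimately have "Q r ** Q v = Q v" by (simp add: matrix_distribs)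
    then obtain c where "v = c *s r" using range_injective[OF False v0] by blast
    hence "v $ i = c * r $ i" by simp
    thus False using ri assms(1) by simp
  qed
qed

end

text \<open>The action of \<open>Q\<close> on an affine coordinate, in the chart where coordinate
  \<open>o'\<close> equals 1: the quotient of two entries of one column is the quotient of two
  coordinates of a vector spanning the range.\<close>

definition coordinate_ratio :: "(complex^'n \<Rightarrow> complex^'n^'n) \<Rightarrow> 'n::finite \<Rightarrow> 'n \<Rightarrow> complex \<Rightarrow> complex" where
  "coordinate_ratio Q o' j a = (if j = o' then 1 else
     Q (axis o' 1 + a *s axis j 1) $ j $ o' / Q (axis o' 1 + a *s axis j 1) $ o' $ o')"

context normalized_frame_map
begin

lemma components:
  assumes "v \<noteq> 0"
  obtains p q where "Q v = bil p q" "bdot q p = 1" "\<And>i. v $ i \<noteq> 0 \<Longrightarrow> p $ i \<noteq> 0" "\<And>i. v $ i \<noteq> 0 \<Longrightarrow> q $ i \<noteq> 0"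
proof -
  interpret T: normalized_frame_map "\<lambda>v. transpose (Q v)" by (rule normalized_transpose)
  obtain p q where pq: "Q v = bil p q" "bdot q p = 1" using rank_one[OF assms] .
  have "transpose (Q v) = bil q p" by (simp add: pq vec_eq_iff transpose_def bil_nth mult.commute)
  thus ?thesis using that pq nonzero_component[of v] T.nonzero_component[of v] by metis
qed

lemma zero_column: "v \<noteq> 0 \<Longrightarrow> v $ i = 0 \<Longrightarrow> Q v $ k $ i = 0"
proof -
  interpret T: normalized_frame_map "\<lambda>v. transpose (Q v)" by (rule normalized_transpose)
  show "v \<noteq> 0 \<Longrightarrow> v $ i = 0 \<Longrightarrow> Q v $ k $ i = 0" using T.zero_row[of v i k] by (simp add: transpose_def)
qed

text \<open>\<open>Q\<close> acts coordinatewise. The remainder \<open>r\<close> of \<open>v\<close>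
  has no coordinates z and j and is orthogonal to \<open>u\<close>; rows z and j of
  \<open>Q r\<close> vanish, so in \<open>(Q u + Q r) ** Q v = Q v\<close> these two rows come from
  \<open>Q u\<close> alone.\<close>

lemma ratio:
  assumes "v $ z \<noteq> 0"
  shows "Q v $ j $ z = Q v $ z $ z * coordinate_ratio Q z j (v $ j / v $ z)"
proof (cases "j = z")
  case True thus ?thesis by (simp add: coordinate_ratio_def)
next
  case False
  have v0: "v \<noteq> 0" using assms by auto
  define a where "a = v $ j / v $ z"
  define u where "u = axis z 1 + a *s axis j (1::complex)"
  have uz: "u $ z = 1" "u $ j = a" using False by (simp_all add: u_def axis_def)
  have u0: "u \<noteq> 0" using uz by auto
  define r where "r = v - v $ z *s u"
  have rz: "r $ z = 0" "r $ j = 0" using assms by (simp_all add: r_def uz a_def)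
  have v: "v = v $ z *s u + 1 *s r" by (simp add: r_def)
  have ur: "cinner u r = 0"
    by (simp add: u_def cinner_simps cinner_axis rz)
  have cr: "coordinate_ratio Q z j a = Q u $ j $ z / Q u $ z $ z"
    using False by (simp add: coordinate_ratio_def u_def)
  obtain p q where pq: "Q u = bil p q" "\<And>i. u $ i \<noteq> 0 \<Longrightarrow> p $ i \<noteq> 0" "\<And>i. u $ i \<noteq> 0 \<Longrightarrow> q $ i \<noteq> 0"
    using components[OF u0] by metis
  have nz: "p $ z \<noteq> 0" "q $ z \<noteq> 0" using pq uz by auto
  show ?thesis
  proof (cases "r = 0")
    case True
    hence "Q v = Q u" using v scaled_eq[OF v0, of "v $ z" u] by simp
    thus ?thesis using nz pq(1) cr unfolding a_def by (simp add: bil_nth)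
  next
    case r0: False
    have res: "(Q u + Q r) ** Q v = Q v" by (rule plane_resolution(2)[OF u0 r0 ur v v0])
    define s where "s = (\<Sum>l\<in>UNIV. q $ l * Q v $ l $ z)"
    have "Q v $ k $ z = p $ k * s" if "r $ k = 0" for k
    proof -
      have "(Q r ** Q v) $ k $ z = 0"
        using zero_row[OF r0 that] by (simp add: matrix_matrix_mult_def)
      hence "Q v $ k $ z = (Q u ** Q v) $ k $ z"
        using arg_cong[OF res, of "\<lambda>A. A $ k $ z"] by (simp add: matrix_distribs)
      thus ?thesis by (simp add: matrix_matrix_mult_def pq bil_nth s_def sum_distrib_left mult_ac)
    qed
    hence "Q v $ z $ z = p $ z * s" "Q v $ j $ z = p $ j * s" using rz by auto
    thus ?thesis using cr nz unfolding a_def by (simp add: pq bil_nth)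
  qed
qed

text \<open>Orthogonality of vectors supported on three coordinates becomes a functional equation
  for \<sigma> and \<tau>. Holding one coordinate fixed gives multiplicativity, varying two gives
  additivity, so a single ring endomorphism \<open>h\<close> governs all coordinates up to the
  constants \<open>d\<close>.\<close>

lemma standard_form:
  "\<exists>D. invertible D \<and> ((\<forall>v. v \<noteq> 0 \<longrightarrow> Q v = conjug D (ray_proj v)) \<or>
       (\<forall>v. v \<noteq> 0 \<longrightarrow> Q v = conjug D (transpose (ray_proj v))))"
proof -
  interpret T: normalized_frame_map "\<lambda>v. transpose (Q v)" by (rule normalized_transpose)
  fix z :: 'n
  define \<sigma> where "\<sigma> = coordinate_ratio Q z"
  define \<tau> where "\<tau> = coordinate_ratio (\<lambda>v. transpose (Q v)) z"
  have row: "Q v $ j $ z = Q v $ z $ z * \<sigma> j (v $ j / v $ z)" if "v $ z \<noteq> 0" for v j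
    using ratio[OF that, of j] unfolding \<sigma>_def .
  have col: "Q v $ z $ j = Q v $ z $ z * \<tau> j (v $ j / v $ z)" if "v $ z \<noteq> 0" for v j
    using T.ratio[OF that, of j] unfolding \<tau>_def[symmetric] by (simp add: transpose_def)
  have Qzz: "Q v $ z $ z \<noteq> 0" if "v $ z \<noteq> 0" for v
  proof -
    have "v \<noteq> 0" using that by auto
    thus ?thesis using components[of v] that by (metis bil_nth mult_eq_0_iff)
  qed
  \<comment> \<open>The 2 by 2 minors of a rank-one matrix vanish, so column z and row z determine
    every entry.\<close>
  have entry: "Q v $ j $ k = Q v $ z $ z * \<sigma> j (v $ j / v $ z) * \<tau> k (v $ k / v $ z)" if "v $ z \<noteq> 0" for v j k
  proof -
    have "v \<noteq> 0" using that by auto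
    then obtain p q where "Q v = bil p q" using components by metis
    hence "Q v $ j $ k * Q v $ z $ z = Q v $ j $ z * Q v $ z $ k" by (simp add: bil_nth)
    thus ?thesis unfolding row[OF that, of j] col[OF that, of k] using Qzz[OF that] by (simp add: mult_ac)
  qed
  have trace: "Q v $ z $ z * (\<Sum>j\<in>UNIV. \<sigma> j (v $ j / v $ z) * \<tau> j (v $ j / v $ z)) = 1" if "v $ z \<noteq> 0" for v
  proof -
    have "v \<noteq> 0" using that by auto
    then obtain p q where "Q v = bil p q" "bdot q p = 1" using components by metis
    hence "(\<Sum>j\<in>UNIV. Q v $ j $ j) = 1" by (simp add: bil_nth bdot_def mult.commute)
    moreover have "(\<Sum>j\<in>UNIV. Q v $ j $ j) =
        (\<Sum>j\<in>UNIV. Q v $ z $ z * \<sigma> j (v $ j / v $ z) * \<tau> j (v $ j / v $ z))"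
      by (intro sum.cong refl entry[OF that])
    ultimately show ?thesis by (simp add: sum_distrib_left mult.assoc)
  qed
  have orth: "(\<Sum>l\<in>UNIV. \<tau> l (w $ l / w $ z) * \<sigma> l (v $ l / v $ z)) = 0"
    if "v $ z \<noteq> 0" "w $ z \<noteq> 0" "cinner w v = 0" for v w
  proof -
    have "v \<noteq> 0" "w \<noteq> 0" using that by auto
    hence "(Q w ** Q v) $ z $ z = 0" using orthogonal that(3) by simp
    hence "(\<Sum>l\<in>UNIV. Q w $ z $ l * Q v $ l $ z) = 0" by (simp add: matrix_matrix_mult_def)
    moreover have "(\<Sum>l\<in>UNIV. Q w $ z $ l * Q v $ l $ z) =
        (\<Sum>l\<in>UNIV. (Q w $ z $ z * \<tau> l (w $ l / w $ z)) * (Q v $ z $ z * \<sigma> l (v $ l / v $ z)))"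
      by (intro sum.cong refl arg_cong2[where f="(*)"] row[OF that(1)] col[OF that(2)])
    ultimately have "Q w $ z $ z * Q v $ z $ z * (\<Sum>l\<in>UNIV. \<tau> l (w $ l / w $ z) * \<sigma> l (v $ l / v $ z)) = 0"
      by (simp add: sum_distrib_left mult_ac)
    thus ?thesis using Qzz that by simp
  qed
  have \<sigma>z: "\<sigma> z a = 1" "\<tau> z a = 1" for a by (simp_all add: \<sigma>_def \<tau>_def coordinate_ratio_def)
  define e where "e j a = axis z 1 + a *s axis j (1::complex)" for j a
  have e: "e j a $ z = 1" "e j a $ j = a" if "j \<noteq> z" for j a using that by (simp_all add: e_def axis_def)
  have \<sigma>0: "\<sigma> j 0 = 0" "\<tau> j 0 = 0" if "j \<noteq> z" for j
  proof -
    have "e j 0 \<noteq> 0" using e(1)[OF that, of 0] by auto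
    thus "\<sigma> j 0 = 0" "\<tau> j 0 = 0"
      using that row[of "e j 0" j] col[of "e j 0" j] Qzz[of "e j 0"] e[OF that]
        zero_row[of "e j 0" j z] zero_column[of "e j 0" j z] by auto
  qed
  have \<sigma>nz: "\<sigma> j a \<noteq> 0" "\<tau> j a \<noteq> 0" if "a \<noteq> 0" for j a
  proof -
    have "\<sigma> j a \<noteq> 0 \<and> \<tau> j a \<noteq> 0"
    proof (cases "j = z")
      case False
      have "e j a \<noteq> 0" using e(1)[OF False, of a] by auto
      then obtain p q where pq: "Q (e j a) = bil p q" "\<And>i. e j a $ i \<noteq> 0 \<Longrightarrow> p $ i \<noteq> 0"
          "\<And>i. e j a $ i \<noteq> 0 \<Longrightarrow> q $ i \<noteq> 0"
        using components by metis
      have "p $ z \<noteq> 0" "p $ j \<noteq> 0" "q $ z \<noteq> 0" "q $ j \<noteq> 0"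
        using pq(2,3)[of z] pq(2,3)[of j] e[OF False, of a] that by simp_all
      thus ?thesis using row[of "e j a" j] col[of "e j a" j] e[OF False, of a] by (auto simp: bil_nth pq(1))
    qed (simp add: \<sigma>z)
    thus "\<sigma> j a \<noteq> 0" "\<tau> j a \<noteq> 0" by auto
  qed
  \<comment> \<open>Outside z, j, k both test vectors are zero, and so are \<sigma> and \<tau>
    there; only three terms of the orthogonality sum survive.\<close>
  have R1: "1 + \<tau> j c * \<sigma> j a + \<tau> k d * \<sigma> k b = 0"
    if jk: "j \<noteq> z" "k \<noteq> z" "j \<noteq> k" and s: "1 + cnj c * a + cnj d * b = 0" for j k a b c d
  proof -
    define v where "v = axis z 1 + a *s axis j 1 + b *s axis k (1::complex)"
    define w where "w = axis z 1 + c *s axis j 1 + d *s axis k (1::complex)"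
    have v: "v $ z = 1" "v $ j = a" "v $ k = b" "\<And>l. l \<noteq> z \<Longrightarrow> l \<noteq> j \<Longrightarrow> l \<noteq> k \<Longrightarrow> v $ l = 0"
      using jk by (auto simp: v_def axis_def)
    have w: "w $ z = 1" "w $ j = c" "w $ k = d" "\<And>l. l \<noteq> z \<Longrightarrow> l \<noteq> j \<Longrightarrow> l \<noteq> k \<Longrightarrow> w $ l = 0"
      using jk by (auto simp: w_def axis_def)
    have "cinner w v = 1 + cnj c * a + cnj d * b"
      unfolding w_def by (simp add: cinner_simps cinner_axis v)
    hence "(\<Sum>l\<in>UNIV. \<tau> l (w $ l) * \<sigma> l (v $ l)) = 0" using orth[of v w] v(1) w(1) s by simp
    also have "(\<Sum>l\<in>UNIV. \<tau> l (w $ l) * \<sigma> l (v $ l)) = (\<Sum>l\<in>{z, j, k}. \<tau> l (w $ l) * \<sigma> l (v $ l))"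
      by (rule sum.mono_neutral_right) (auto simp: v w \<sigma>0)
    also have "\<dots> = 1 + \<tau> j c * \<sigma> j a + \<tau> k d * \<sigma> k b" using jk by (simp add: v w \<sigma>z)
    finally show ?thesis .
  qed
  have two: "\<exists>k. k \<noteq> z \<and> k \<noteq> j" for j
  proof (rule ccontr)
    assume "\<not> ?thesis"
    hence "UNIV \<subseteq> {z, j}" by auto
    hence "CARD('n) \<le> card {z, j}" by (intro card_mono) auto
    also have "\<dots> \<le> 2" by (simp add: card_insert_if)
    finally show False using card3 by simp
  qed
  obtain j0 where j0: "j0 \<noteq> z" using two by blast
  define h where "h a = \<sigma> j0 a / \<sigma> j0 1" for a
  have hj: "\<sigma> k a = \<sigma> k 1 * h a" if k: "k \<noteq> z" for k a
  proof (cases "k = j0 \<or> a = 0")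
    case True thus ?thesis using \<sigma>nz[of 1] \<sigma>0 k j0 by (auto simp: h_def)
  next
    case False
    hence kj: "k \<noteq> j0" "a \<noteq> 0" by auto
    have "\<sigma> k a = coordinate_ratio Q j0 k 1 * \<sigma> j0 a" if a: "a \<noteq> 0" for a
    proof -
      \<comment> \<open>Coordinates j0 and k of \<open>v\<close> agree, so the ratio based at j0 is
        evaluated at 1 and is independent of \<open>a\<close>; this makes \<sigma> at k proportional
        to \<sigma> at j0.\<close>
      define v where "v = axis z 1 + a *s axis j0 1 + a *s axis k (1::complex)"
      have v: "v $ z = 1" "v $ j0 = a" "v $ k = a" using j0 k kj by (auto simp: v_def axis_def)
      have v0: "v \<noteq> 0" using v by auto
      obtain p q where Qv: "Q v = bil p q" and p: "\<And>i. v $ i \<noteq> 0 \<Longrightarrow> p $ i \<noteq> 0"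
          and q: "\<And>i. v $ i \<noteq> 0 \<Longrightarrow> q $ i \<noteq> 0"
        using components[OF v0] by metis
      have pq: "Q v = bil p q" "p $ j0 \<noteq> 0" "q $ j0 \<noteq> 0" "p $ z \<noteq> 0" "q $ z \<noteq> 0"
        using Qv p[of z] p[of j0] q[of z] q[of j0] v a by simp_all
      have "p $ k = p $ j0 * coordinate_ratio Q j0 k 1"
        using ratio[of v j0 k] v a pq by (simp add: bil_nth)
      moreover have "p $ k = p $ z * \<sigma> k a" "p $ j0 = p $ z * \<sigma> j0 a"
        using row[of v k] row[of v j0] v pq by (auto simp: bil_nth)
      ultimately show ?thesis using pq by simp
    qed
    from this[OF kj(2)] this[of 1] show ?thesis using \<sigma>nz[of 1] by (simp add: h_def)
  qed
  have h1: "h 1 = 1" using \<sigma>nz[of 1] by (simp add: h_def)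
  have h0: "h 0 = 0" using \<sigma>0[OF j0] by (simp add: h_def)
  \<comment> \<open>\<open>d\<close> restores orthogonality for the given \<open>c\<close> and
    \<open>a\<close>. The term at k is common to both instances of \<open>R1\<close>, so the term at
    j depends on \<open>cnj c * a\<close> only.\<close>
  have R2: "\<tau> j c * \<sigma> j a = \<tau> j 1 * \<sigma> j (cnj c * a)" if j: "j \<noteq> z" for j a c
  proof -
    obtain k where k: "k \<noteq> z" "k \<noteq> j" using two by blast
    define d where "d = cnj (- 1 - cnj c * a)"
    have "1 + \<tau> j c * \<sigma> j a + \<tau> k d * \<sigma> k 1 = 0"
      by (rule R1[OF j k(1) k(2)[symmetric]]) (simp add: d_def)
    moreover have "1 + \<tau> j 1 * \<sigma> j (cnj c * a) + \<tau> k d * \<sigma> k 1 = 0"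
      by (rule R1[OF j k(1) k(2)[symmetric]]) (simp add: d_def)
    ultimately show ?thesis by (metis add_left_cancel add_right_cancel)
  qed
  have \<tau>h: "\<tau> j c = \<tau> j 1 * h (cnj c)" if j: "j \<noteq> z" for j c
    using R2[OF j, of c 1] hj[OF j, of "cnj c"] \<sigma>nz[of 1 j] by simp
  have mul: "h (x * y) = h x * h y" for x y
    using R2[OF j0, of "cnj x" y] \<tau>h[OF j0, of "cnj x"] hj[OF j0, of y] hj[OF j0, of "x * y"] \<sigma>nz[of 1 j0]
    by simp
  define K where "K j = \<tau> j 1 * \<sigma> j 1" for j
  have R3: "1 + K j * h s + K k * h t = 0" if "j \<noteq> z" "k \<noteq> z" "j \<noteq> k" "s + t = -1" for j k s t
    using R1[OF that(1-3), of 1 s 1 t] that(4) hj[OF that(1), of s] hj[OF that(2), of t]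
    by (simp add: K_def add.assoc mult_ac add_eq_0_iff)
  have K: "K j * h (-1) = -1" if j: "j \<noteq> z" for j
  proof -
    obtain k where k: "k \<noteq> z" "k \<noteq> j" using two by blast
    have "1 + K j * h (-1) = 0" using R3[OF j k(1) k(2)[symmetric], of "-1" 0] h0 by simp
    thus ?thesis by (metis add.inverse_unique)
  qed
  have hm0: "h (-1) \<noteq> 0" using K[OF j0] by auto
  have addm1: "h (-1) = h s + h t" if "s + t = -1" for s t
  proof -
    obtain k where k: "k \<noteq> z" "k \<noteq> j0" using two by blast
    have "K k = K j0" using K[OF j0] K[OF k(1)] hm0 by (metis mult_right_cancel)
    hence "1 + K j0 * (h s + h t) = 0"
      using R3[OF j0 k(1) k(2)[symmetric] that] by (simp add: algebra_simps)
    hence "K j0 * (h s + h t) = K j0 * h (-1)" using K[OF j0] by (simp add: add_eq_0_iff)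
    moreover have "K j0 \<noteq> 0" using K[OF j0] by auto
    ultimately show ?thesis by simp
  qed
  \<comment> \<open>The known case of sum -1, rescaled by -(x + y) through multiplicativity.\<close>
  have add1: "h (x + y) = h x + h y" if "x + y \<noteq> 0" for x y
  proof -
    have "h (-1) = h (- x / (x + y)) + h (- y / (x + y))"
    proof (rule addm1)
      have "- x / (x + y) + - y / (x + y) = - ((x + y) / (x + y))"
        by (simp only: add_divide_distrib minus_divide_left[symmetric] minus_add_distrib)
      thus "- x / (x + y) + - y / (x + y) = -1" using that by simp
    qed
    hence "h (- (x + y) * (-1)) = h (- (x + y) * (- x / (x + y))) + h (- (x + y) * (- y / (x + y)))"
      by (simp only: mul distrib_left)
    moreover have "- (x + y) * (-1) = x + y" by simp
    moreover have "- (x + y) * (- x / (x + y)) = x" "- (x + y) * (- y / (x + y)) = y"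
      using that by (simp_all add: nonzero_divide_eq_eq nonzero_eq_divide_eq del: minus_add_distrib)
    ultimately show ?thesis by (simp add: add.commute)
  qed
  \<comment> \<open>Multiplicativity alone leaves the sign of h(-1) open; additivity for nonzero
    sums, applied to 1 + 1 and 2 + (-1), decides it.\<close>
  have hm1: "h (-1) = -1"
  proof -
    have "h 2 = 2" using add1[of 1 1] h1 by simp
    moreover have "h 1 = h 2 + h (-1)" using add1[of 2 "-1"] by simp
    ultimately show ?thesis using h1 by (simp add: eq_neg_iff_add_eq_0 add.commute)
  qed
  have add: "h (x + y) = h x + h y" for x y
  proof (cases "x + y = 0")
    case True
    hence "y = (-1) * x" by (simp add: add_eq_0_iff2)
    hence "h y = - h x" using mul[of "-1" x] hm1 by simp
    thus ?thesis using True h0 by simp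
  qed (rule add1)
  have \<tau>1: "\<tau> j 1 * \<sigma> j 1 = 1" if "j \<noteq> z" for j
    using K[OF that] hm1 by (simp add: K_def)
  have hcont: "continuous_on UNIV h"
  proof -
    have e0: "e j0 a \<noteq> 0" for a using e(1)[OF j0, of a] by auto
    have "continuous_on UNIV (\<lambda>a. e j0 a)"
      unfolding e_def continuous_on_def by (intro ballI tendsto_intros)
    hence "continuous_on UNIV (\<lambda>a. Q (e j0 a))"
      by (rule continuous_on_compose2[OF cont]) (use e0 in auto)
    hence "continuous_on UNIV (\<lambda>a. Q (e j0 a) $ j0 $ z / Q (e j0 a) $ z $ z)"
      by (intro continuous_intros) (use Qzz e(1)[OF j0] in auto)
    moreover have "\<sigma> j0 a = Q (e j0 a) $ j0 $ z / Q (e j0 a) $ z $ z" for a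
      using j0 by (simp add: \<sigma>_def coordinate_ratio_def e_def)
    ultimately have "continuous_on UNIV (\<lambda>a. \<sigma> j0 a)" by simp
    thus ?thesis unfolding h_def using \<sigma>nz[of 1 j0] by (intro continuous_intros) auto
  qed
  define d where "d j = (if j = z then 1 else \<sigma> j 1)" for j
  have d0: "d j \<noteq> 0" for j using \<sigma>nz[of 1 j] by (simp add: d_def)
  have \<sigma>d: "\<sigma> j (v $ j / v $ z) = d j * h (v $ j / v $ z)" if "v $ z \<noteq> 0" for v :: "complex^'n" and j
    using that hj[of j "v $ j / v $ z"] by (cases "j = z") (simp_all add: d_def \<sigma>z h1)
  have \<tau>d: "\<tau> j (v $ j / v $ z) = inverse (d j) * h (cnj (v $ j / v $ z))" if "v $ z \<noteq> 0" for v :: "complex^'n" and j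
  proof (cases "j = z")
    case False
    have "\<tau> j 1 = inverse (d j)" using \<tau>1[OF False] False by (metis d_def inverse_unique mult.commute)
    thus ?thesis using \<tau>h[OF False, of "v $ j / v $ z"] by simp
  qed (use that in \<open>simp add: d_def \<sigma>z h1\<close>)
  have closed_form: "Q v $ j $ k = d j * inverse (d k) * h (v $ j * cnj (v $ k) / cinner v v)"
    if vz: "v $ z \<noteq> 0" for v j k
  proof -
    define S where "S = v $ z * cnj (v $ z)"
    have S: "S \<noteq> 0" using vz by (simp add: S_def)
    have v0: "v \<noteq> 0" using vz by auto
    have hsum: "h (sum f A) = (\<Sum>a\<in>A. h (f a))" for f and A :: "'n set"
      by (induction A rule: infinite_finite_induct) (auto simp: h0 add)
    \<comment> \<open>The constants \<open>d\<close> cancel in the trace, so trace 1 determines the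
      normalizing factor \<open>Q v $ z $ z\<close>.\<close>
    have "(\<Sum>j\<in>UNIV. \<sigma> j (v $ j / v $ z) * \<tau> j (v $ j / v $ z)) =
          (\<Sum>j\<in>UNIV. h (cnj (v $ j) * v $ j / S))"
      by (intro sum.cong refl) (use d0 vz in \<open>simp add: \<sigma>d \<tau>d mul[symmetric] S_def mult_ac\<close>)
    also have "\<dots> = h (cinner v v / S)"
      by (simp add: hsum[symmetric] cinner_def sum_divide_distrib)
    finally have "Q v $ z $ z * h (cinner v v / S) = 1" using trace[OF vz] by simp
    hence "Q v $ z $ z * h (cinner v v / S) * h (S / cinner v v) = h (S / cinner v v)" by simp
    hence zz: "Q v $ z $ z = h (S / cinner v v)" using S v0 h1 by (simp add: mult.assoc mul[symmetric])
    have "Q v $ j $ k = d j * inverse (d k) * h (S / cinner v v * (v $ j / v $ z) * cnj (v $ k / v $ z))"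
      using entry[OF vz, of j k] unfolding zz \<sigma>d[OF vz] \<tau>d[OF vz] mul by (simp only: mult_ac)
    also have "S / cinner v v * (v $ j / v $ z) * cnj (v $ k / v $ z) = v $ j * cnj (v $ k) / cinner v v"
      using vz by (simp add: S_def)
    finally show ?thesis .
  qed
  have extend: "Q v $ j $ k = d j * inverse (d k) * h (v $ j * cnj (v $ k) / cinner v v)" if v0: "v \<noteq> 0" for v j k
  proof (cases "v $ z = 0")
    case True
    \<comment> \<open>Rays with vanishing z-coordinate lie outside the chart; they are limits of
      rays inside it.\<close>
    define w where "w t = v + t *s axis z (1::complex)" for t
    have wz: "w t $ z = t" for t by (simp add: w_def True)
    have wlim: "(w \<longlongrightarrow> w 0) (at 0)" unfolding w_def by (intro tendsto_intros)
    have w0: "w 0 = v" by (simp add: w_def)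
    have wn: "\<forall>\<^sub>F t in at 0. w t \<noteq> 0"
      using tendsto_imp_eventually_ne[OF wlim] v0 w0 by auto
    have "((\<lambda>t. Q (w t)) \<longlongrightarrow> Q (w 0)) (at 0)"
      by (rule continuous_on_tendsto_compose[OF cont wlim]) (use wn v0 w0 in auto)
    hence 1: "((\<lambda>t. Q (w t) $ j $ k) \<longlongrightarrow> Q v $ j $ k) (at 0)" unfolding w0 by (intro tendsto_intros)
    have hc: "isCont h a" for a using hcont by (simp add: continuous_on_eq_continuous_at)
    have 2: "((\<lambda>t. d j * inverse (d k) * h (w t $ j * cnj (w t $ k) / cinner (w t) (w t))) \<longlongrightarrow>
        d j * inverse (d k) * h (w 0 $ j * cnj (w 0 $ k) / cinner (w 0) (w 0))) (at 0)"
      by (intro tendsto_mult tendsto_const isCont_tendsto_compose[OF hc], unfold cinner_def)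
         (intro tendsto_intros wlim, use v0 w0 cinner_self_eq_0[of v] in \<open>simp add: cinner_def\<close>)
    have ev: "\<forall>\<^sub>F t in at 0. Q (w t) $ j $ k = d j * inverse (d k) * h (w t $ j * cnj (w t $ k) / cinner (w t) (w t))"
      unfolding eventually_at by (rule exI[of _ 1]) (auto intro: closed_form simp: wz)
    show ?thesis using tendsto_unique[OF at_neq_bot 1 2[folded tendsto_cong[OF ev]]] w0 by simp
  qed (rule closed_form)
  have "invertible (diagm d)" using d0 by (rule invertible_diagm)
  moreover have cd: "conjug (diagm d) A $ j $ k = d j * inverse (d k) * A $ j $ k" for A j k
    using d0 by (simp add: conjug_def matrix_inv_diagm mult_diagm_nth diagm_mult_nth)
  have "(\<forall>x. h x = x) \<or> (\<forall>x. h x = cnj x)"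
    by (rule additive_multiplicative_continuous[OF add mul h1 hcont])
  hence "(\<forall>v. v \<noteq> 0 \<longrightarrow> Q v = conjug (diagm d) (ray_proj v)) \<or>
       (\<forall>v. v \<noteq> 0 \<longrightarrow> Q v = conjug (diagm d) (transpose (ray_proj v)))"
  proof
    assume "\<forall>x. h x = x"
    thus ?thesis by (simp add: vec_eq_iff[of "Q _"] vec_eq_iff[of "Q _ $ _"] extend cd ray_proj_def)
  next
    assume "\<forall>x. h x = cnj x"
    hence "Q v = conjug (diagm d) (transpose (ray_proj v))" if "v \<noteq> 0" for v
      by (simp add: vec_eq_iff[of "Q _"] vec_eq_iff[of "Q _ $ _"] extend[OF that] cd ray_proj_def
          transpose_def cinner_cnj mult.commute)
    thus ?thesis by blast
  qed
  ultimately show ?thesis by blast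
qed

end

lemma (in frame_map) frame_map_conjug:
  assumes "invertible R"
  shows "frame_map (\<lambda>v. conjug R (Q v))"
proof
  show "CARD('n) \<ge> 3" by (rule card3)
  show "continuous_on {v. v \<noteq> 0} (\<lambda>v. conjug R (Q v))"
    using cont unfolding continuous_on_def by (auto intro: tendsto_conjug)
  show "conjug R (Q (c *s v)) = conjug R (Q v)" if "c \<noteq> 0" "v \<noteq> 0" for c v
    using that by (simp add: scale)
  fix U :: "complex^'n^'n" assume "unitary U"
  then obtain P where P: "invertible P" "\<And>i. Q (column i U) = conjug P (unit_diag i)" using frame by blast
  thus "\<exists>P. invertible P \<and> (\<forall>i. conjug R (Q (column i U)) = conjug P (unit_diag i))"
    by (intro exI[of _ "R ** P"]) (simp add: assms conjug_conjug invertible_mult)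
qed

theorem (in frame_map) frame_map_classification:
  "\<exists>T. invertible T \<and> ((\<forall>v. v \<noteq> 0 \<longrightarrow> Q v = conjug T (ray_proj v)) \<or>
       (\<forall>v. v \<noteq> 0 \<longrightarrow> Q v = conjug T (transpose (ray_proj v))))"
proof -
  obtain P where P: "invertible P" "\<And>i. Q (axis i 1) = conjug P (unit_diag i)"
    using frame[OF unitary_mat1] by (auto simp: column_mat1)
  interpret N: frame_map "\<lambda>v. conjug (matrix_inv P) (Q v)"
    by (rule frame_map_conjug[OF invertible_matrix_inv[OF P(1)]])
  interpret N: normalized_frame_map "\<lambda>v. conjug (matrix_inv P) (Q v)"
    by unfold_locales (simp add: P)
  obtain D where D: "invertible D" "(\<forall>v. v \<noteq> 0 \<longrightarrow> conjug (matrix_inv P) (Q v) = conjug D (ray_proj v)) \<or>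
       (\<forall>v. v \<noteq> 0 \<longrightarrow> conjug (matrix_inv P) (Q v) = conjug D (transpose (ray_proj v)))"
    using N.standard_form by blast
  have "Q v = conjug (P ** D) A" if "conjug (matrix_inv P) (Q v) = conjug D A" for v A
    using that P(1) D(1) by (metis conjug_conjug conjug_inv_cancel(2))
  thus ?thesis using D P(1) by (metis invertible_mult)
qed

section \<open>Preservers on normal matrices\<close>

subsection \<open>Conjugations\<close>

lemma invertible_mat1: "invertible (mat 1 :: 'a::field^'n^'n)"
  by (rule invertibleI[of _ "mat 1"]) simp

lemma transpose_mat_mult: "transpose (mat c ** A) = mat c ** transpose (A :: complex^'n^'n)"
  by (simp add: vec_eq_iff mat_mult_nth transpose_def)

lemma transpose_sum: "transpose (\<Sum>i\<in>S. f i) = (\<Sum>i\<in>S. transpose (f i :: complex^'n^'n))"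
  by (simp add: vec_eq_iff transpose_def)

definition conj_maps :: "(complex^'n^'n \<Rightarrow> complex^'n^'n) set" where
  "conj_maps = matrix_conjugations \<union> transpose_conjugations"

lemma conj_maps_iff:
  "\<alpha> \<in> conj_maps \<longleftrightarrow> (\<exists>T. invertible T \<and> (\<alpha> = conjug T \<or> \<alpha> = (\<lambda>A. conjug T (transpose A))))"
  unfolding conj_maps_def matrix_conjugations_def transpose_conjugations_def conjug_def by blast

lemma conj_maps_inverse:
  assumes "\<alpha> \<in> conj_maps"
  obtains \<beta> where "\<beta> \<in> conj_maps" "\<And>A. \<beta> (\<alpha> A) = A" "\<And>A. \<alpha> (\<beta> A) = A"
proof -
  obtain T where T: "invertible T" "\<alpha> = conjug T \<or> \<alpha> = (\<lambda>A. conjug T (transpose A))"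
    using assms conj_maps_iff by auto
  from T(2) show ?thesis
  proof
    assume "\<alpha> = conjug T"
    thus ?thesis using that[of "conjug (matrix_inv T)"] T(1) invertible_matrix_inv conj_maps_iff by fastforce
  next
    assume a: "\<alpha> = (\<lambda>A. conjug T (transpose A))"
    \<comment> \<open>Solving B = T A^t T^-1 for A gives A = (T^-1 B T)^t, which is T^t B^t
      conjugated back by the inverse of T^t: again a transpose conjugation.\<close>
    define \<beta> where "\<beta> A = conjug (transpose T) (transpose A)" for A
    note Tt = transpose_conjug(3)[OF T(1)]
    have "\<beta> (\<alpha> A) = A" "\<alpha> (\<beta> A) = A" for A
      unfolding a \<beta>_def transpose_conjug(1)[OF T(1)] transpose_conjug(1)[OF Tt] transpose_transpose
      by (simp_all only: conjug_inv_cancel T(1) Tt)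
    moreover have "\<beta> \<in> conj_maps"
      unfolding conj_maps_iff \<beta>_def using transpose_conjug(3)[OF T(1)] by blast
    ultimately show ?thesis using that by blast
  qed
qed

lemma conj_maps_properties:
  assumes "\<alpha> \<in> conj_maps"
  shows "continuous_on S \<alpha>" "matrix_spectrum (\<alpha> A) = matrix_spectrum A"
    "A ** B = B ** A \<Longrightarrow> \<alpha> A ** \<alpha> B = \<alpha> B ** \<alpha> A"
proof -
  obtain T where T: "invertible T" "\<alpha> = conjug T \<or> \<alpha> = (\<lambda>A. conjug T (transpose A))"
    using assms conj_maps_iff by auto
  show "continuous_on S \<alpha>"
    using T(2) continuous_on_conjug[of S T]
      continuous_on_compose2[OF continuous_on_conjug[of UNIV T] continuous_on_transpose[of S]] by auto
  show "matrix_spectrum (\<alpha> A) = matrix_spectrum A"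
    using T by (auto simp: spectrum_conjug spectrum_transpose)
  assume "A ** B = B ** A"
  thus "\<alpha> A ** \<alpha> B = \<alpha> B ** \<alpha> A"
    using T by (metis conjug_mult matrix_transpose_mul)
qed

lemma conj_maps_CS_preserver: "\<alpha> \<in> conj_maps \<Longrightarrow> continuous_CS_preserver S \<alpha>"
  unfolding continuous_CS_preserver_def CS_preserver_def
  using conj_maps_properties by blast

lemma compose_CS_preserver:
  assumes "\<alpha> \<in> conj_maps" "continuous_CS_preserver S \<phi>"
  shows "continuous_CS_preserver S (\<lambda>A. \<alpha> (\<phi> A))"
  using assms conj_maps_properties[OF assms(1)] continuous_on_compose2[of UNIV \<alpha> S \<phi>]
  unfolding continuous_CS_preserver_def CS_preserver_def by simp

subsection \<open>Approximation by distinct eigenvalues\<close>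

text \<open>The points are chosen one at a time: every ball around a point of a perfect set contains
  infinitely many points of \<open>X\<close>, so a value different from all earlier ones is always
  available.\<close>

lemma perfect_set_approx_inj_on:
  assumes "perfect_set X" "finite S" "d ` S \<subseteq> X" "\<epsilon> > 0"
  shows "\<exists>d'. inj_on d' S \<and> d' ` S \<subseteq> X \<and> (\<forall>i\<in>S. dist (d' i) (d i) < (\<epsilon>::real))"
  using assms(2,3)
proof (induction S rule: finite_induct)
  case (insert a S)
  then obtain d' where d': "inj_on d' S" "d' ` S \<subseteq> X" "\<forall>i\<in>S. dist (d' i) (d i) < \<epsilon>" by auto
  have "d a islimpt X"
    using insert.prems assms(1) unfolding perfect_set_def islimpt_in_closure by auto
  hence "infinite (X \<inter> ball (d a) \<epsilon>)" using assms(4) islimpt_eq_infinite_ball by blast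
  hence "infinite (X \<inter> ball (d a) \<epsilon> - d' ` S)" using insert.hyps(1) by simp
  then obtain y where "y \<in> X \<inter> ball (d a) \<epsilon> - d' ` S" by (metis ex_in_conv finite.emptyI)
  hence y: "y \<in> X" "dist (d a) y < \<epsilon>" "y \<notin> d' ` S" by auto
  show ?case
    using insert.hyps d' y
    by (intro exI[of _ "d'(a := y)"]) (auto simp: dist_commute inj_on_def image_iff)
qed auto

lemma perfect_set_approx_seq:
  fixes d :: "'n::finite \<Rightarrow> complex"
  assumes "perfect_set X" "range d \<subseteq> X"
  obtains s where "\<forall>m. inj (s m)" "\<forall>m. range (s m) \<subseteq> X" "\<forall>i. (\<lambda>m. s m i) \<longlonglongrightarrow> d i"
proof -
  have "\<forall>m. \<exists>d'. inj d' \<and> range d' \<subseteq> X \<and> (\<forall>i. dist (d' i) (d i) < inverse (real (Suc m)))"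
    using perfect_set_approx_inj_on[OF assms(1) finite_class.finite_UNIV assms(2)] by auto
  then obtain s where s: "\<And>m. inj (s m)" "\<And>m. range (s m) \<subseteq> X"
    "\<And>m i. dist (s m i) (d i) < inverse (real (Suc m))" by metis
  have "(\<lambda>m. s m i) \<longlonglongrightarrow> d i" for i
    by (subst tendsto_dist_iff, rule tendsto_sandwich[OF _ _ tendsto_const LIMSEQ_inverse_real_of_nat])
       (auto simp: less_imp_le[OF s(3)] simp del: of_nat_Suc)
  thus ?thesis using that s(1,2) by blast
qed

subsection \<open>Unitary orbits of diagonal matrices\<close>

lemma spec_normal_iff: "A \<in> spec_normal X \<longleftrightarrow> (\<exists>U d. unitary U \<and> range d \<subseteq> X \<and> A = conjug U (diagm d))"
  unfolding spec_normal_def mem_Collect_eq normal_matrix_iff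
  using spectrum_conjug_diagm unitary_invertible by metis

lemma spec_semisimple_iff: "A \<in> spec_semisimple X \<longleftrightarrow> (\<exists>P d. invertible P \<and> range d \<subseteq> X \<and> A = conjug P (diagm d))"
  unfolding spec_semisimple_def mem_Collect_eq semisimple_matrix_iff
  using spectrum_conjug_diagm by metis

lemma spec_normal_subset: "spec_normal X \<subseteq> spec_semisimple X"
  using spec_normal_iff spec_semisimple_iff unitary_invertible by blast

lemma config_space_inj:
  assumes "bij_betw f (UNIV :: 'n::finite set) {..<CARD('n)}" "x \<in> config_space CARD('n) X"
  shows "inj (\<lambda>i. x (f i))" "range (\<lambda>i. x (f i)) \<subseteq> X"
proof -
  have f: "f i \<in> {..<CARD('n)}" "f i = f j \<longleftrightarrow> i = j" for i j
    using assms(1) unfolding bij_betw_def by (auto dest: injD)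
  show "inj (\<lambda>i. x (f i))"
    using assms(2) f unfolding config_space_def by (auto intro!: injI dest: inj_onD)
  show "range (\<lambda>i. x (f i)) \<subseteq> X"
    using assms(2) f unfolding config_space_def by auto
qed

lemma config_space_of_inj:
  assumes f: "bij_betw f (UNIV :: 'n::finite set) {..<CARD('n)}" and d: "inj d" "range d \<subseteq> X"
  shows "\<exists>x\<in>config_space CARD('n) X. \<forall>i. x (f i) = d i"
proof -
  have inv: "inv_into UNIV f (f i) = i" for i using f by (simp add: bij_betw_def)
  have fl: "f i < CARD('n)" for i using f unfolding bij_betw_def by auto
  let ?x = "\<lambda>k\<in>{..<CARD('n)}. d (inv_into UNIV f k)"
  have xf: "\<forall>i. ?x (f i) = d i" using fl inv by simp
  have "inj_on ?x {..<CARD('n)}"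
  proof (rule inj_onI)
    fix k l assume kl: "k \<in> {..<CARD('n)}" "l \<in> {..<CARD('n)}" "?x k = ?x l"
    hence "inv_into UNIV f k = inv_into UNIV f l" using d(1) by (auto dest: injD)
    thus "k = l" using kl f by (metis bij_betw_def f_inv_into_f)
  qed
  hence "?x \<in> config_space CARD('n) X"
    using d(2) unfolding config_space_def by auto
  with xf show ?thesis by (rule bexI)
qed

text \<open>All images commute with one image that has distinct eigenvalues, hence are diagonal in
  its eigenbasis \<open>P\<close>. The i-th diagonal entry is always one of the coordinates of
  \<open>x\<close>; which one is a locally constant choice, so connectedness preserves the matching
  found at \<open>x0\<close>.\<close>

lemma preserver_on_unitary_frame_inj:
  assumes con: "connected (config_space CARD('n) X)"
    and \<phi>: "continuous_CS_preserver (spec_normal X) (\<phi> :: complex^'n^'n \<Rightarrow> complex^'n^'n)"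
    and U: "unitary U"
  shows "\<exists>P. invertible P \<and> (\<forall>d. inj d \<and> range d \<subseteq> X \<longrightarrow> \<phi> (conjug U (diagm d)) = conjug P (diagm d))"
proof -
  obtain f :: "'n \<Rightarrow> nat" where f: "bij_betw f UNIV {..<CARD('n)}" using finite_enumeration_exists by blast
  let ?C = "config_space CARD('n) X"
  show ?thesis
  proof (cases "?C = {}")
    case True
    hence "\<not> (inj d \<and> range d \<subseteq> X)" for d :: "'n \<Rightarrow> complex"
      using config_space_of_inj[OF f, of d X] by auto
    thus ?thesis using invertible_mat1 by blast
  next
    case False
    then obtain x0 where x0: "x0 \<in> ?C" by blast
    define N where "N x = conjug U (diagm (\<lambda>i. x (f i)))" for x
    have N: "N x \<in> spec_normal X" if "x \<in> ?C" for x
      using config_space_inj(2)[OF f that] U unfolding N_def spec_normal_iff by blast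
    have spec: "matrix_spectrum (\<phi> (N x)) = range (\<lambda>i. x (f i))" if "x \<in> ?C" for x
      using \<phi> N[OF that] U unfolding continuous_CS_preserver_def CS_preserver_def
      by (simp add: N_def spectrum_conjug_diagm unitary_invertible)
    have comm: "\<phi> (N x) ** \<phi> (N y) = \<phi> (N y) ** \<phi> (N x)" if "x \<in> ?C" "y \<in> ?C" for x y
    proof -
      have "N x ** N y = N y ** N x"
        unfolding N_def using U by (metis conjug_mult diagm_commute unitary_invertible)
      thus ?thesis using \<phi> N that unfolding continuous_CS_preserver_def CS_preserver_def by blast
    qed
    obtain P where P: "invertible P" "\<phi> (N x0) = conjug P (diagm (\<lambda>i. x0 (f i)))"
      using distinct_eigenvalues_diagonalizable[OF config_space_inj(1)[OF f x0]] spec[OF x0] by blast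
    define M where "M x = conjug (matrix_inv P) (\<phi> (N x))" for x
    define \<nu> where "\<nu> x i = M x $ i $ i" for x i
    have M: "M x = diagm (\<nu> x)" if "x \<in> ?C" for x
    proof -
      have "M x ** M x0 = M x0 ** M x"
        unfolding M_def using comm[OF that x0] P(1) by (metis conjug_mult invertible_matrix_inv)
      moreover have "M x0 = diagm (\<lambda>i. x0 (f i))" by (simp add: M_def P)
      ultimately show ?thesis unfolding \<nu>_def using commute_diagm_inj config_space_inj(1)[OF f x0] by metis
    qed
    have \<phi>N: "\<phi> (N x) = conjug P (diagm (\<nu> x))" if "x \<in> ?C" for x
      using M[OF that] P(1) by (metis M_def conjug_inv_cancel(2))
    have \<nu>: "range (\<nu> x) = range (\<lambda>i. x (f i))" if "x \<in> ?C" for x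
      using spec[OF that] \<phi>N[OF that] P(1) spectrum_conjug_diagm by metis
    have contN: "continuous_on ?C (\<lambda>x. \<phi> (N x))"
    proof (rule continuous_on_compose2[of "spec_normal X" \<phi>])
      show "continuous_on (spec_normal X) \<phi>" using \<phi> unfolding continuous_CS_preserver_def by blast
      have "continuous_on ?C (\<lambda>x. x k)" for k
        by (rule continuous_on_subset[OF continuous_on_product_coordinates]) auto
      thus "continuous_on ?C N" unfolding N_def continuous_on_def
        by (intro ballI tendsto_conjug tendsto_diagm) blast
    qed (use N in auto)
    hence contv: "continuous_on ?C (\<lambda>x. \<nu> x i)" for i
      unfolding \<nu>_def M_def continuous_on_def by (auto intro!: tendsto_vec_nth tendsto_conjug)
    \<comment> \<open>For fixed i these sets are closed, cover the configuration space, and are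
      pairwise disjoint because configurations are injective. There are finitely many of them, so
      each is also open.\<close>
    define A where "A i j = {x \<in> ?C. \<nu> x i - x (f j) = 0}" for i j
    have clA: "closedin (top_of_set ?C) (A i j)" for i j
      unfolding A_def
      by (intro continuous_closedin_preimage_constant continuous_intros contv
          continuous_on_subset[OF continuous_on_product_coordinates]) auto
    have "A i i = ?C" for i
    proof -
      have "?C - A i i = (\<Union>j\<in>UNIV - {i}. A i j)"
      proof (intro set_eqI iffI)
        fix x assume x: "x \<in> ?C - A i i"
        hence "\<nu> x i \<in> range (\<lambda>i. x (f i))" using \<nu>[of x] by blast
        thus "x \<in> (\<Union>j\<in>UNIV - {i}. A i j)" using x by (auto simp: A_def)
      next
        fix x assume "x \<in> (\<Union>j\<in>UNIV - {i}. A i j)"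
        then obtain j where "x \<in> ?C" "j \<noteq> i" "\<nu> x i = x (f j)" by (auto simp: A_def)
        thus "x \<in> ?C - A i i"
          using config_space_inj(1)[OF f, of x X] unfolding inj_def A_def by auto
      qed
      moreover have "closedin (top_of_set ?C) (\<Union>j\<in>UNIV - {i}. A i j)"
        by (intro closedin_Union) (auto simp: clA)
      ultimately have "openin (top_of_set ?C) (A i i)"
        unfolding openin_closedin_eq by (auto simp: A_def)
      moreover have "x0 \<in> A i i"
      proof -
        have "diagm (\<nu> x0) = diagm (\<lambda>i. x0 (f i))" using M[OF x0] by (simp add: M_def P)
        hence "\<nu> x0 = (\<lambda>i. x0 (f i))" by (rule diagm_inj)
        thus ?thesis using x0 by (simp add: A_def)
      qed
      ultimately show ?thesis using con clA[of i i] unfolding connected_clopen by blast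
    qed
    hence "\<nu> x = (\<lambda>i. x (f i))" if "x \<in> ?C" for x using that by (force simp: A_def)
    hence fin: "\<phi> (N x) = conjug P (diagm (\<lambda>i. x (f i)))" if "x \<in> ?C" for x using \<phi>N that by metis
    have "\<phi> (conjug U (diagm d)) = conjug P (diagm d)" if d: "inj d" "range d \<subseteq> X" for d
    proof -
      obtain x where x: "x \<in> ?C" "\<forall>i. x (f i) = d i" using config_space_of_inj[OF f d] by blast
      thus ?thesis using fin[OF x(1)] by (simp add: N_def)
    qed
    thus ?thesis using P(1) by blast
  qed
qed

text \<open>Repeated eigenvalues are approximated by distinct ones inside the perfect set, with
  \<open>U\<close> and hence \<open>P\<close> fixed along the sequence.\<close>

lemma preserver_on_unitary_frame:
  assumes "perfect_set X" "connected (config_space CARD('n) X)"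
    and \<phi>: "continuous_CS_preserver (spec_normal X) (\<phi> :: complex^'n^'n \<Rightarrow> complex^'n^'n)"
    and U: "unitary U"
  shows "\<exists>P. invertible P \<and> (\<forall>d. range d \<subseteq> X \<longrightarrow> \<phi> (conjug U (diagm d)) = conjug P (diagm d))"
proof -
  obtain P where P: "invertible P"
    "\<And>d. inj d \<Longrightarrow> range d \<subseteq> X \<Longrightarrow> \<phi> (conjug U (diagm d)) = conjug P (diagm d)"
    using preserver_on_unitary_frame_inj[OF assms(2-4)] by blast
  have "\<phi> (conjug U (diagm d)) = conjug P (diagm d)" if d: "range d \<subseteq> X" for d
  proof -
    obtain s where s': "\<forall>m. inj (s m)" "\<forall>m. range (s m) \<subseteq> X" "\<forall>i. (\<lambda>m. s m i) \<longlonglongrightarrow> d i"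
      using perfect_set_approx_seq[OF assms(1) d] .
    note s = s'[rule_format]
    have "(\<lambda>m. \<phi> (conjug U (diagm (s m)))) \<longlonglongrightarrow> \<phi> (conjug U (diagm d))"
    proof (rule continuous_on_tendsto_compose[of "spec_normal X" \<phi>])
      show "continuous_on (spec_normal X) \<phi>" using \<phi> unfolding continuous_CS_preserver_def by blast
      show "(\<lambda>m. conjug U (diagm (s m))) \<longlonglongrightarrow> conjug U (diagm d)" by (intro tendsto_intros s)
      show "conjug U (diagm d) \<in> spec_normal X" using U d spec_normal_iff by blast
      show "\<forall>\<^sub>F m in sequentially. conjug U (diagm (s m)) \<in> spec_normal X"
        using U s(2) spec_normal_iff by (intro always_eventually) blast
    qed
    moreover have "(\<lambda>m. \<phi> (conjug U (diagm (s m)))) \<longlonglongrightarrow> conjug P (diagm d)"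
      unfolding P(2)[OF s(1,2)] by (intro tendsto_intros s)
    ultimately show ?thesis by (rule LIMSEQ_unique)
  qed
  thus ?thesis using P(1) by blast
qed

lemma ray_proj_scale: "c \<noteq> 0 \<Longrightarrow> ray_proj (c *s v) = ray_proj v"
  by (simp add: ray_proj_def vec_eq_iff cinner_simps)

lemma ray_proj_column:
  assumes "unitary U" shows "ray_proj (column i U) = conjug U (unit_diag i)"
proof -
  have "cinner (column i U) (column i U) = 1" using assms by (simp add: unitary_iff_columns)
  thus ?thesis using assms
    by (simp add: conjug_unit_diag unitary_matrix_inv vec_eq_iff ray_proj_def bil_nth column_def row_def conj_transpose_nth)
qed

lemma mat_plus_unit_diag: "mat \<mu> + mat (l - \<mu>) ** unit_diag i = diagm (\<lambda>j. if j = i then l else \<mu>)"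
  by (auto simp: vec_eq_iff mat_mult_nth unit_diag_nth diagm_nth mat_nth)

lemma continuous_on_ray_proj: "continuous_on {v. v \<noteq> 0} ray_proj"
proof -
  have "(\<Sum>i\<in>UNIV. cnj (x $ i) * x $ i) \<noteq> 0" if "x \<noteq> 0" for x :: "complex^'n"
    using that cinner_self_eq_0[of x] by (simp add: cinner_def)
  thus ?thesis unfolding continuous_on_def ray_proj_def cinner_def
    by (auto intro!: tendsto_intros)
qed

lemma perfect_set_two_points:
  assumes "perfect_set X" "x \<in> X" obtains y where "y \<in> X" "y \<noteq> x"
proof -
  have "x \<in> closure (X - {x})" using assms unfolding perfect_set_def by blast
  hence "X - {x} \<noteq> {}" by (metis closure_empty empty_iff)
  thus ?thesis using that by auto
qed

theorem preserver_on_normal: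
  assumes card: "CARD('n) \<ge> 3" and X: "perfect_set X" "connected (config_space CARD('n) X)"
    and \<phi>: "continuous_CS_preserver (spec_normal X) (\<phi> :: complex^'n^'n \<Rightarrow> complex^'n^'n)"
  shows "\<exists>\<alpha>\<in>conj_maps. \<forall>A\<in>spec_normal X. \<phi> A = \<alpha> A"
proof (cases "X = {}")
  case True
  hence "spec_normal X = ({} :: (complex^'n^'n) set)"
    using matrix_spectrum_nonempty by (auto simp: spec_normal_def)
  moreover have "conjug (mat 1) \<in> conj_maps" using conj_maps_iff invertible_mat1 by blast
  ultimately show ?thesis by auto
next
  case False
  then obtain l where l: "l \<in> X" by blast
  then obtain \<mu> where \<mu>: "\<mu> \<in> X" "\<mu> \<noteq> l" using perfect_set_two_points X(1) by blast
  \<comment> \<open>\<open>R v\<close> has eigenvalue \<open>l\<close> on the line of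
    \<open>v\<close> and \<mu> on its orthogonal complement; \<open>Q v\<close> is the idempotent
    recovered from its image.\<close>
  define R where "R v = mat \<mu> + mat (l - \<mu>) ** ray_proj v" for v :: "complex^'n"
  define Q where "Q v = mat (1 / (l - \<mu>)) ** (\<phi> (R v) - mat \<mu>)" for v
  have Rcol: "R (column i U) = conjug U (diagm (\<lambda>j. if j = i then l else \<mu>))" if "unitary U" for U i
    using that by (simp add: R_def ray_proj_column mat_plus_unit_diag[symmetric] conjug_add conjug_smult unitary_invertible)
  have rng: "range (\<lambda>j. if j = i then l else \<mu>) \<subseteq> X" for i :: 'n using l \<mu> by auto
  have Qcol: "Q (column i U) = conjug P (unit_diag i)"
    if U: "unitary U" and P: "invertible P" "\<And>d. range d \<subseteq> X \<Longrightarrow> \<phi> (conjug U (diagm d)) = conjug P (diagm d)"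
    for U P i
  proof -
    have "\<phi> (R (column i U)) - mat \<mu> = mat (l - \<mu>) ** conjug P (unit_diag i)"
      unfolding Rcol[OF U] P(2)[OF rng] by (simp add: mat_plus_unit_diag[symmetric] conjug_add conjug_smult P(1))
    thus ?thesis using \<mu>(2) by (simp add: Q_def matrix_mul_assoc mat_mat)
  qed
  have RX: "R v \<in> spec_normal X" if v: "v \<noteq> 0" for v
  proof -
    obtain c where c: "c \<noteq> 0" "cinner (c *s v) (c *s v) = 1" using normalize_cinner[OF v] .
    then obtain U i where U: "unitary U" "column i U = c *s v" using orthonormal_vector_extends card by fastforce
    have "R v = R (column i U)" using c U by (simp add: R_def ray_proj_scale)
    thus ?thesis using Rcol[OF U(1)] rng U(1) spec_normal_iff by metis
  qed
  interpret frame_map Q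
  proof
    show "CARD('n) \<ge> 3" by (rule card)
    have "continuous_on {v. v \<noteq> 0} (\<lambda>v. \<phi> (R v))"
    proof (rule continuous_on_compose2[of "spec_normal X" \<phi>])
      show "continuous_on (spec_normal X) \<phi>" using \<phi> unfolding continuous_CS_preserver_def by blast
      show "continuous_on {v. v \<noteq> 0} R"
        using continuous_on_ray_proj unfolding R_def continuous_on_def by (auto intro!: tendsto_intros)
    qed (use RX in auto)
    thus "continuous_on {v. v \<noteq> 0} Q"
      unfolding Q_def continuous_on_def by (auto intro!: tendsto_intros)
    show "Q (c *s v) = Q v" if "c \<noteq> 0" "v \<noteq> 0" for c v using that by (simp add: Q_def R_def ray_proj_scale)
    show "\<exists>P. invertible P \<and> (\<forall>i. Q (column i U) = conjug P (unit_diag i))" if "unitary U" for U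
      using preserver_on_unitary_frame[OF X \<phi> that] Qcol[OF that] by blast
  qed
  obtain T where T: "invertible T" "(\<forall>v. v \<noteq> 0 \<longrightarrow> Q v = conjug T (ray_proj v)) \<or>
       (\<forall>v. v \<noteq> 0 \<longrightarrow> Q v = conjug T (transpose (ray_proj v)))"
    using frame_map_classification by blast
  define \<alpha> where "\<alpha> = (if \<forall>v. v \<noteq> 0 \<longrightarrow> Q v = conjug T (ray_proj v) then conjug T else (\<lambda>A. conjug T (transpose A)))"
  have \<alpha>: "\<alpha> \<in> conj_maps" unfolding conj_maps_iff \<alpha>_def using T(1) by auto
  have \<alpha>Q: "Q v = \<alpha> (ray_proj v)" if "v \<noteq> 0" for v using T(2) that by (auto simp: \<alpha>_def)
  have \<alpha>sum: "\<alpha> (\<Sum>i\<in>UNIV. mat (d i) ** B i) = (\<Sum>i\<in>UNIV. mat (d i) ** \<alpha> (B i))" for d and B :: "'n \<Rightarrow> _"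
    using T(1) by (simp add: \<alpha>_def conjug_sum transpose_sum transpose_mat_mult conjug_smult)
  have "\<phi> A = \<alpha> A" if A: "A \<in> spec_normal X" for A
  proof -
    obtain U d where U: "unitary U" "range d \<subseteq> X" "A = conjug U (diagm d)" using A spec_normal_iff by blast
    obtain P where P: "invertible P" "\<And>d. range d \<subseteq> X \<Longrightarrow> \<phi> (conjug U (diagm d)) = conjug P (diagm d)"
      using preserver_on_unitary_frame[OF X \<phi> U(1)] by blast
    have col0: "column i U \<noteq> 0" for i
      using U(1) unfolding unitary_iff_columns by (metis cinner_zero(1) zero_neq_one)
    have sum: "conjug S (diagm d) = (\<Sum>i\<in>UNIV. mat (d i) ** conjug S (unit_diag i))" if "invertible S" for S
      using that by (subst diagm_sum) (simp add: conjug_sum conjug_smult unit_diag_def)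
    \<comment> \<open>The eigenbasis \<open>P\<close> attached to \<open>U\<close> is compared with
      \<alpha> only through its coordinate idempotents; the spectral decomposition then transfers
      the equality to all eigenvalues.\<close>
    have "conjug P (unit_diag i) = \<alpha> (ray_proj (column i U))" for i
      using Qcol[OF U(1) P] \<alpha>Q[OF col0] by metis
    hence "\<phi> A = (\<Sum>i\<in>UNIV. mat (d i) ** \<alpha> (ray_proj (column i U)))"
      unfolding U(3) P(2)[OF U(2)] sum[OF P(1)] by simp
    also have "\<dots> = \<alpha> A"
      unfolding \<alpha>sum[symmetric] U(3) sum[OF unitary_invertible[OF U(1)]] ray_proj_column[OF U(1)] ..
    finally show ?thesis .
  qed
  thus ?thesis using \<alpha> by blast
qed

section \<open>The map \<open>\<Phi>\<close>\<close>

text \<open>The intertwiner \<open>M\<close> has a nonzero entry only where the eigenvalues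
  \<open>d j\<close> and \<open>d' i\<close> agree, so it also intertwines any function of the
  eigenvalues.\<close>

lemma functional_calculus_well_defined:
  assumes "invertible P" "invertible P'" "conjug P (diagm d) = conjug P' (diagm d')"
  shows "conjug P (diagm (\<lambda>i. g (d i))) = conjug P' (diagm (\<lambda>i. g (d' i :: 'a::field)))"
proof -
  define M where "M = matrix_inv P' ** P"
  have M: "invertible M" using assms(1,2) by (simp add: M_def invertible_matrix_inv invertible_mult)
  have P: "conjug P A = conjug P' (conjug M A)" for A
  proof -
    have "P' ** M = P" using assms(2) by (simp add: M_def matrix_mul_assoc matrix_inv_mult)
    thus ?thesis using M assms(2) by (simp add: conjug_conjug)
  qed
  have "conjug M (diagm d) = diagm d'" using assms(2,3) P conjug_eq_iff by metis
  hence c: "M ** diagm d = diagm d' ** M" using conjug_eqD[OF M, of "diagm d'" "diagm d"] by simp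
  have "(M ** diagm (\<lambda>i. g (d i))) $ i $ j = (diagm (\<lambda>i. g (d' i)) ** M) $ i $ j" for i j
  proof -
    have "M $ i $ j * d j = d' i * M $ i $ j" using c by (metis diagm_mult_nth mult_diagm_nth)
    hence "M $ i $ j = 0 \<or> d j = d' i" by auto
    thus ?thesis by (auto simp: diagm_mult_nth mult_diagm_nth)
  qed
  hence "diagm (\<lambda>i. g (d' i)) ** M = M ** diagm (\<lambda>i. g (d i))" by (simp add: vec_eq_iff)
  hence "diagm (\<lambda>i. g (d' i)) = conjug M (diagm (\<lambda>i. g (d i)))" by (rule conjug_eqI[OF M])
  thus ?thesis using P by simp
qed

lemma diagm_commute_functional_calculus:
  assumes "A ** diagm d = diagm d ** (A :: 'a::field^'n^'n)"
  shows "A ** diagm (\<lambda>i. g (d i)) = diagm (\<lambda>i. g (d i)) ** A"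
proof -
  have "(A ** diagm (\<lambda>i. g (d i))) $ i $ j = (diagm (\<lambda>i. g (d i)) ** A) $ i $ j" for i j
  proof -
    have "A $ i $ j * d j = d i * A $ i $ j" using assms by (metis diagm_mult_nth mult_diagm_nth)
    hence "A $ i $ j = 0 \<or> d j = d i" by auto
    thus ?thesis by (auto simp: diagm_mult_nth mult_diagm_nth)
  qed
  thus ?thesis by (simp add: vec_eq_iff)
qed

section \<open>Polar decomposition and an explicit formula for \<Phi>\<close>

lemma positive_conjug_unitary:
  assumes "unitary V" "\<And>i. r i > (0::real)"
  shows "positive_matrix (conjug V (diagm (\<lambda>i. complex_of_real (r i))))"
    and "invertible (conjug V (diagm (\<lambda>i. complex_of_real (r i))))"
proof -
  let ?D = "diagm (\<lambda>i. complex_of_real (r i)) :: complex^'a^'a"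
  have pos: "cinner v (conjug V ?D *v v) \<in> \<real>\<^sub>\<ge>\<^sub>0" for v
  proof -
    define w where "w = conj_transpose V *v v"
    have "cinner v (conjug V ?D *v v) = cinner w (?D *v w)"
      using assms(1) by (simp add: conjug_def unitary_matrix_inv matrix_vector_mul_assoc[symmetric]
          cinner_conj_transpose[of v V] w_def)
    also have "\<dots> = of_real (\<Sum>i\<in>UNIV. r i * (norm (w $ i))\<^sup>2)"
      unfolding cinner_def diagm_vec of_real_sum of_real_mult complex_norm_square
      by (intro sum.cong refl) (simp only: mult_ac)
    finally show ?thesis using assms(2)
      by (simp only: nonneg_Reals_of_real_iff) (auto intro!: sum_nonneg simp: less_imp_le)
  qed
  show "positive_matrix (conjug V ?D)"
    unfolding positive_matrix_def using pos assms(1)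
    by (simp add: conj_transpose_conjug_unitary conj_transpose_diagm cinner_def)
  have "r i \<noteq> 0" for i using assms(2)[of i] by simp
  hence "invertible ?D" by (intro invertible_diagm) simp
  thus "invertible (conjug V ?D)"
    using assms(1) unfolding conjug_def by (simp add: invertible_mult unitary_invertible invertible_matrix_inv)
qed

text \<open>The eigenvalues of \<open>P ** conj_transpose P\<close> are squared norms of nonzero
  vectors, and the positive factor is its square root. The eigenbasis \<open>V\<close> and the
  eigenvalues \<open>r\<close> are exposed because the positive factor is later varied with
  \<open>V\<close> held fixed.\<close>

lemma polar_decomposition:
  assumes "invertible (P :: complex^'n^'n)"
  obtains V r U where "unitary V" "\<And>i. r i > (0::real)" "unitary U"
    "P = conjug V (diagm (\<lambda>i. complex_of_real (r i))) ** U"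
proof -
  define H where "H = P ** conj_transpose P"
  have "conj_transpose H = H" by (simp add: H_def conj_transpose_mult)
  hence "normal_matrix H" by (simp add: normal_matrix_def)
  then obtain V e where V: "unitary V" "H = conjug V (diagm e)" using normal_matrix_iff by blast
  have e: "e i = of_real ((norm (conj_transpose P *v column i V))\<^sup>2)" for i
  proof -
    have "diagm e = conjug (conj_transpose V) H"
      using V by (metis conjug_inv_cancel(1) unitary_invertible unitary_matrix_inv)
    hence "e i = cinner (column i V) (H *v column i V)"
      using conjug_unitary_nth[OF V(1), of H i i] by (metis diagm_nth)
    also have "\<dots> = cinner (conj_transpose P *v column i V) (conj_transpose P *v column i V)"
      by (simp add: H_def matrix_vector_mul_assoc[symmetric] cinner_conj_transpose[of _ P])
    finally show ?thesis by (simp add: cinner_self)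
  qed
  define r where "r i = norm (conj_transpose P *v column i V)" for i
  have r: "r i > 0" for i
  proof -
    have "column i V \<noteq> 0" using V(1) unfolding unitary_iff_columns by (metis cinner_zero(1) zero_neq_one)
    thus ?thesis using invertible_conj_transpose[OF assms] by (auto simp: r_def invertible_ker)
  qed
  define S where "S = conjug V (diagm (\<lambda>i. complex_of_real (r i)))"
  have S: "positive_matrix S" "invertible S"
    unfolding S_def by (rule positive_conjug_unitary[OF V(1) r])+
  have SS: "S ** S = H"
    unfolding S_def V(2) conjug_mult[OF unitary_invertible[OF V(1)], symmetric] diagm_mult
    by (rule arg_cong[of _ _ "\<lambda>d. conjug V (diagm d)"]) (simp add: fun_eq_iff e r_def power2_eq_square)
  have Sstar: "conj_transpose S = S" using S(1) by (simp add: positive_matrix_def)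
  define U where "U = matrix_inv S ** P"
  have "U ** conj_transpose U = matrix_inv S ** H ** matrix_inv (conj_transpose S)"
    using S(2) by (simp add: U_def conj_transpose_mult H_def matrix_inv_conj_transpose matrix_mul_assoc)
  also have "\<dots> = (matrix_inv S ** S) ** (S ** matrix_inv S)"
    by (simp add: SS[symmetric] Sstar matrix_mul_assoc)
  also have "\<dots> = mat 1" using S(2) by (simp add: matrix_inv_mult)
  finally have "unitary U" by (metis matrix_left_right_inverse unitary_def)
  moreover have "P = S ** U" using S(2) by (simp add: U_def matrix_mul_assoc matrix_inv_mult)
  ultimately show ?thesis using that[of V r U, OF V(1) r] unfolding S_def by blast
qed

text \<open>For Hermitian \<open>S\<close>, the matrix S^-1 N S is the adjoint of S M S^-1 with M
  the adjoint of \<open>N\<close>, and for normal \<open>N\<close> taking the adjoint conjugates the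
  eigenvalues in the same eigenbasis. The outcome does not involve the factorization, which is why
  the definite description denotes.\<close>

lemma Phi_conjug_diagm:
  assumes "invertible (P :: complex^'n^'n)"
  shows "Phi (conjug P (diagm d)) = conj_transpose (conjug P (diagm (\<lambda>i. cnj (d i))))"
proof -
  have key: "conjug (matrix_inv S) N = conj_transpose (conjug P (diagm (\<lambda>i. cnj (d i))))"
    if S: "positive_matrix S" "invertible S" and N: "normal_matrix N" and A: "conjug P (diagm d) = conjug S N" for S N
  proof -
    obtain U e where U: "unitary U" "N = conjug U (diagm e)" using N normal_matrix_iff by blast
    note Ui = unitary_invertible[OF U(1)]
    have "conjug P (diagm d) = conjug (S ** U) (diagm e)"
      using A U S(2) Ui by (simp add: conjug_conjug)
    hence "conjug P (diagm (\<lambda>i. cnj (d i))) = conjug (S ** U) (diagm (\<lambda>i. cnj (e i)))"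
      using functional_calculus_well_defined assms S(2) Ui invertible_mult by blast
    also have "\<dots> = conjug S (conjug U (diagm (\<lambda>i. cnj (e i))))"
      using S(2) Ui by (simp add: conjug_conjug)
    also have "conj_transpose \<dots> = conjug (matrix_inv S) N"
      using S U by (simp add: conj_transpose_conjug conj_transpose_conjug_unitary conj_transpose_diagm positive_matrix_def)
    finally show ?thesis by simp
  qed
  obtain V r U where V: "unitary V" "\<And>i. r i > (0::real)" "unitary U"
    "P = conjug V (diagm (\<lambda>i. complex_of_real (r i))) ** U"
    using polar_decomposition[OF assms] by metis
  define S where "S = conjug V (diagm (\<lambda>i. complex_of_real (r i)))"
  have S: "positive_matrix S" "invertible S"
    unfolding S_def by (rule positive_conjug_unitary[OF V(1,2)])+
  have N: "normal_matrix (conjug U (diagm d))" using V(3) normal_matrix_iff by blast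
  have A: "conjug P (diagm d) = conjug S (conjug U (diagm d))"
    using V(3,4) S(2) by (simp add: S_def conjug_conjug unitary_invertible)
  have inv: "matrix_inv S ** N ** S = conjug (matrix_inv S) N" if "invertible S" for S N :: "complex^'n^'n"
    using that by (simp add: conjug_def matrix_inv_inv)
  show ?thesis unfolding Phi_def
  proof (rule the_equality)
    show "\<exists>S N. positive_matrix S \<and> invertible S \<and> normal_matrix N \<and> conjug P (diagm d) = S ** N ** matrix_inv S \<and>
        conj_transpose (conjug P (diagm (\<lambda>i. cnj (d i)))) = matrix_inv S ** N ** S"
      using S N A key[OF S N A] inv[OF S(2)] by (metis conjug_def)
    fix B assume "\<exists>S N. positive_matrix S \<and> invertible S \<and> normal_matrix N \<and>
        conjug P (diagm d) = S ** N ** matrix_inv S \<and> B = matrix_inv S ** N ** S"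
    thus "B = conj_transpose (conjug P (diagm (\<lambda>i. cnj (d i))))"
      using key inv by (metis conjug_def)
  qed
qed

lemma Phi_conjug_positive:
  assumes "positive_matrix S" "invertible S" "unitary U"
  shows "Phi (conjug S (conjug U (diagm d))) = conjug (matrix_inv S) (conjug U (diagm d))"
proof -
  note Ui = unitary_invertible[OF assms(3)]
  have "Phi (conjug (S ** U) (diagm d)) = conj_transpose (conjug (S ** U) (diagm (\<lambda>i. cnj (d i))))"
    using assms(2) Ui by (intro Phi_conjug_diagm invertible_mult)
  also have "\<dots> = conj_transpose (conjug S (conjug U (diagm (\<lambda>i. cnj (d i)))))"
    using assms(2) Ui by (simp add: conjug_conjug)
  also have "\<dots> = conjug (matrix_inv S) (conjug U (diagm d))"
    using assms by (simp add: conj_transpose_conjug conj_transpose_conjug_unitary conj_transpose_diagm positive_matrix_def)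
  finally show ?thesis using assms(2) Ui by (simp add: conjug_conjug)
qed

text \<open>The adjoint of \<open>Phi A\<close> is a function of \<open>A\<close>, so it commutes
  with everything that commutes with \<open>A\<close>. Used once for each of two matrices, this
  shows that \<Phi> preserves commutation.\<close>

lemma Phi_star_commute:
  assumes "semisimple_matrix A" "A ** B = B ** A"
  shows "conj_transpose (Phi A) ** B = B ** conj_transpose (Phi A)"
proof -
  obtain P d where P: "invertible P" "A = conjug P (diagm d)" using assms(1) semisimple_matrix_iff by blast
  define C where "C = conjug (matrix_inv P) B"
  have B: "B = conjug P C" using P(1) by (simp add: C_def)
  have "conjug P (C ** diagm d) = conjug P (diagm d ** C)"
    using assms(2) P by (simp add: conjug_mult B)
  hence "C ** diagm d = diagm d ** C" using P(1) conjug_eq_iff by blast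
  hence "C ** diagm (\<lambda>i. cnj (d i)) = diagm (\<lambda>i. cnj (d i)) ** C" by (rule diagm_commute_functional_calculus)
  thus ?thesis using P by (simp add: Phi_conjug_diagm B conjug_mult[symmetric])
qed

lemma Phi_spectrum: "semisimple_matrix A \<Longrightarrow> det (mat z - Phi A) = det (mat z - A)"
  using semisimple_matrix_iff[of A]
  by (auto simp: Phi_conjug_diagm conj_transpose_conjug conj_transpose_diagm det_conjug
        invertible_matrix_inv invertible_conj_transpose)

lemma conj_transpose_eq_iff: "conj_transpose A = conj_transpose B \<longleftrightarrow> A = B"
  by (metis conj_transpose_inv)

lemma Phi_CS_preserver: "CS_preserver (spec_semisimple X) Phi"
proof -
  have "Phi A ** Phi B = Phi B ** Phi A"
    if "semisimple_matrix A" "semisimple_matrix B" "A ** B = B ** A" for A B :: "complex^'a^'a"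
  proof -
    have "conj_transpose (Phi A) ** B = B ** conj_transpose (Phi A)" using that Phi_star_commute by blast
    hence "conj_transpose (Phi B) ** conj_transpose (Phi A) = conj_transpose (Phi A) ** conj_transpose (Phi B)"
      using that Phi_star_commute[of B "conj_transpose (Phi A)"] by simp
    thus ?thesis using conj_transpose_eq_iff by (metis conj_transpose_mult)
  qed
  thus ?thesis unfolding CS_preserver_def spec_semisimple_def by (auto simp: matrix_spectrum_det Phi_spectrum)
qed

section \<open>Preservers on semisimple matrices\<close>

definition rank_op :: "complex^'n \<Rightarrow> complex^'n \<Rightarrow> complex^'n^'n" where
  "rank_op x y = (\<chi> i j. x $ i * cnj (y $ j))"

lemma rank_op_nth: "rank_op x y $ i $ j = x $ i * cnj (y $ j)"
  by (simp add: rank_op_def)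

lemma rank_op_mult: "rank_op x y ** rank_op z w = mat (cinner y z) ** rank_op x w"
  unfolding vec_eq_iff mat_mult_nth
  by (simp add: matrix_matrix_mult_def rank_op_nth cinner_def sum_distrib_left sum_distrib_right mult_ac)

lemma mult_rank_op: "A ** rank_op x y = rank_op (A *v x) y"
  by (simp add: vec_eq_iff matrix_matrix_mult_def matrix_vector_mult_def rank_op_nth
      sum_distrib_left sum_distrib_right mult_ac)

lemma rank_op_mult_right: "rank_op x y ** A = rank_op x (conj_transpose A *v y)"
  by (simp add: vec_eq_iff matrix_matrix_mult_def matrix_vector_mult_def rank_op_nth conj_transpose_nth
      sum_distrib_left sum_distrib_right mult_ac)

lemma rank_op_eq_0_iff: "rank_op x y = 0 \<longleftrightarrow> x = 0 \<or> y = 0"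
  by (auto simp: vec_eq_iff rank_op_nth)

lemma ray_proj_rank_op: "ray_proj v = mat (1 / cinner v v) ** rank_op v v"
  by (simp add: vec_eq_iff mat_mult_nth rank_op_nth ray_proj_def)

lemma mat_mult_swap: "A ** (mat c ** B) = mat c ** ((A :: 'a::comm_ring_1^'n^'n) ** B)"
  by (simp only: matrix_mul_assoc mat_commute[of A c])

lemma scalar_mult_mult: "(mat a ** A) ** (mat b ** B) = mat b ** (mat a ** ((A :: 'a::comm_ring_1^'n^'n) ** B))"
  by (subst mat_mult_swap) (simp only: matrix_mul_assoc[symmetric])

lemma mat_mult_eq_0_iff: "mat c ** A = 0 \<longleftrightarrow> c = 0 \<or> A = (0 :: 'a::idom^'n^'n)"
  by (auto simp: vec_eq_iff mat_mult_nth)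

lemma mat_mult_cancel: "c \<noteq> 0 \<Longrightarrow> mat c ** A = mat c ** B \<longleftrightarrow> A = (B :: 'a::idom^'n^'n)"
  by (auto simp: vec_eq_iff mat_mult_nth)

text \<open>Replaces the eigenvalues 1 and 0 of an idempotent by \<open>l\<close> and
  \<open>\<mu>\<close>, which can be taken in \<open>X\<close>; conjugations and transpose
  conjugations commute with this replacement.\<close>

definition two_valued :: "complex \<Rightarrow> complex \<Rightarrow> complex^'n^'n \<Rightarrow> complex^'n^'n" where
  "two_valued l \<mu> R = mat \<mu> + mat (l - \<mu>) ** R"

lemma two_valued_inj: "l \<noteq> \<mu> \<Longrightarrow> two_valued l \<mu> R = two_valued l \<mu> R' \<Longrightarrow> R = R'"
  by (simp add: two_valued_def mat_mult_cancel)

lemma conjug_two_valued: "invertible P \<Longrightarrow> conjug P (two_valued l \<mu> R) = two_valued l \<mu> (conjug P R)"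
  by (simp add: two_valued_def conjug_add conjug_smult)

lemma transpose_two_valued: "transpose (two_valued l \<mu> R) = two_valued l \<mu> (transpose R)"
  by (simp add: two_valued_def vec_eq_iff transpose_def mat_mult_nth mat_nth)

lemma conj_maps_two_valued: "\<alpha> \<in> conj_maps \<Longrightarrow> \<alpha> (two_valued l \<mu> R) = two_valued l \<mu> (\<alpha> R)"
  unfolding conj_maps_iff by (auto simp: conjug_two_valued transpose_two_valued)

lemma transpose_zero [simp]: "transpose 0 = (0 :: 'a::zero^'n^'m)"
  by (simp add: vec_eq_iff transpose_def)

lemma conj_maps_orthogonal:
  assumes "\<alpha> \<in> conj_maps" "A ** B = 0" "B ** A = 0"
  shows "\<alpha> A ** \<alpha> B = 0"
proof -
  obtain T where T: "invertible T" "\<alpha> = conjug T \<or> \<alpha> = (\<lambda>A. conjug T (transpose A))"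
    using assms(1) conj_maps_iff by auto
  thus ?thesis using assms(2,3)
    by (auto simp: conjug_mult[symmetric] matrix_transpose_mul[symmetric])
qed

lemma two_valued_unit_diag: "two_valued l \<mu> (unit_diag i) = diagm (\<lambda>j. if j = i then l else \<mu>)"
  by (simp add: two_valued_def mat_plus_unit_diag)

lemma two_valued_ray_proj_normal:
  assumes "CARD('n) \<ge> 2" "l \<in> X" "\<mu> \<in> X" "v \<noteq> (0 :: complex^'n)"
  shows "two_valued l \<mu> (ray_proj v) \<in> spec_normal X"
proof -
  obtain c where c: "c \<noteq> 0" "cinner (c *s v) (c *s v) = 1" using normalize_cinner[OF assms(4)] .
  then obtain U i where U: "unitary U" "column i U = c *s v" using orthonormal_vector_extends assms(1) by blast
  have "ray_proj v = conjug U (unit_diag i)"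
    using c U by (metis ray_proj_column ray_proj_scale)
  hence "two_valued l \<mu> (ray_proj v) = conjug U (diagm (\<lambda>j. if j = i then l else \<mu>))"
    using U(1) by (simp add: conjug_two_valued[symmetric] unitary_invertible two_valued_unit_diag)
  moreover have "range (\<lambda>j. if j = i then l else \<mu>) \<subseteq> X" using assms(2,3) by auto
  ultimately show ?thesis using U(1) spec_normal_iff by blast
qed

section \<open>Preservers that fix all normal matrices\<close>

locale identity_on_normal =
  fixes X :: "complex set" and \<phi> :: "complex^'n^'n \<Rightarrow> complex^'n^'n" and \<kappa> \<mu> :: complex
  assumes card3: "CARD('n) \<ge> 3"
    and perfect: "perfect_set X" and conn: "connected (config_space CARD('n) X)"
    and preserver: "continuous_CS_preserver (spec_semisimple X) \<phi>"
    and normal: "\<And>A. A \<in> spec_normal X \<Longrightarrow> \<phi> A = A"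
    and two: "\<kappa> \<in> X" "\<mu> \<in> X" "\<kappa> \<noteq> \<mu>"
begin

abbreviation tv :: "complex^'n^'n \<Rightarrow> complex^'n^'n" where "tv \<equiv> two_valued \<kappa> \<mu>"

lemma card2: "CARD('n) \<ge> 2" using card3 by simp

lemma tv_normal: "v \<noteq> 0 \<Longrightarrow> tv (ray_proj v) \<in> spec_normal X"
  by (rule two_valued_ray_proj_normal[OF card2 two(1,2)])

text \<open>Reduces positive matrices with an arbitrary unitary eigenbasis to diagonal ones.\<close>

lemma conjugate_unitary:
  assumes "unitary V"
  shows "identity_on_normal X (\<lambda>A. conjug (conj_transpose V) (\<phi> (conjug V A))) \<kappa> \<mu>"
proof
  note Vi = unitary_invertible[OF assms]
  have inv: "conj_transpose V = matrix_inv V" by (simp add: unitary_matrix_inv assms)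
  have ss: "conjug V A \<in> spec_semisimple X" if "A \<in> spec_semisimple X" for A
    using that Vi unfolding spec_semisimple_iff by (metis conjug_conjug invertible_mult)
  have cm: "conjug (conj_transpose V) \<in> conj_maps"
    using Vi invertible_matrix_inv conj_maps_iff inv by auto
  have "continuous_CS_preserver (spec_semisimple X) (\<lambda>A. \<phi> (conjug V A))"
    unfolding continuous_CS_preserver_def CS_preserver_def
  proof (intro conjI ballI impI)
    show "continuous_on (spec_semisimple X) (\<lambda>A. \<phi> (conjug V A))"
      by (rule continuous_on_compose2[of "spec_semisimple X" \<phi>])
         (use preserver ss continuous_on_conjug in \<open>auto simp: continuous_CS_preserver_def\<close>)
    fix A :: "complex^'n^'n" assume A: "A \<in> spec_semisimple X"
    show "matrix_spectrum (\<phi> (conjug V A)) = matrix_spectrum A"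
      using preserver ss[OF A] Vi unfolding continuous_CS_preserver_def CS_preserver_def
      by (simp add: spectrum_conjug)
    fix B :: "complex^'n^'n" assume B: "B \<in> spec_semisimple X" and AB: "A ** B = B ** A"
    have "conjug V A ** conjug V B = conjug V B ** conjug V A" using AB Vi by (metis conjug_mult)
    thus "\<phi> (conjug V A) ** \<phi> (conjug V B) = \<phi> (conjug V B) ** \<phi> (conjug V A)"
      using preserver ss[OF A] ss[OF B] unfolding continuous_CS_preserver_def CS_preserver_def by blast
  qed
  thus "continuous_CS_preserver (spec_semisimple X) (\<lambda>A. conjug (conj_transpose V) (\<phi> (conjug V A)))"
    by (rule compose_CS_preserver[OF cm])
  show "conjug (conj_transpose V) (\<phi> (conjug V A)) = A" if A: "A \<in> spec_normal X" for A
  proof -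
    have "conjug V A \<in> spec_normal X"
      using A assms unfolding spec_normal_iff by (metis conjug_conjug unitary_mult unitary_invertible)
    thus ?thesis using normal Vi by (simp add: inv)
  qed
qed (use card3 perfect conn two in auto)

text \<open>Conjugation by \<open>P\<close> respects spectra and commutation, so the classification
  on normal matrices applies to each orbit. The maps obtained for different \<open>P\<close> are a
  priori unrelated.\<close>

lemma twisted:
  assumes P: "invertible P"
  shows "\<exists>\<alpha>\<in>conj_maps. \<forall>N\<in>spec_normal X. \<phi> (conjug P N) = \<alpha> N"
proof -
  have ss: "conjug P A \<in> spec_semisimple X" if "A \<in> spec_normal X" for A
    using that P unfolding spec_semisimple_iff spec_normal_iff
    by (metis conjug_conjug invertible_mult unitary_invertible)
  have "continuous_CS_preserver (spec_normal X) (\<lambda>N. \<phi> (conjug P N))"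
    unfolding continuous_CS_preserver_def CS_preserver_def
  proof (intro conjI ballI impI)
    show "continuous_on (spec_normal X) (\<lambda>A. \<phi> (conjug P A))"
      by (rule continuous_on_compose2[of "spec_semisimple X" \<phi>])
         (use preserver ss continuous_on_conjug in \<open>auto simp: continuous_CS_preserver_def\<close>)
    fix A :: "complex^'n^'n" assume A: "A \<in> spec_normal X"
    show "matrix_spectrum (\<phi> (conjug P A)) = matrix_spectrum A"
      using preserver ss[OF A] P unfolding continuous_CS_preserver_def CS_preserver_def
      by (simp add: spectrum_conjug)
    fix B :: "complex^'n^'n" assume B: "B \<in> spec_normal X" and AB: "A ** B = B ** A"
    have "conjug P A ** conjug P B = conjug P B ** conjug P A" using AB P by (metis conjug_mult)
    thus "\<phi> (conjug P A) ** \<phi> (conjug P B) = \<phi> (conjug P B) ** \<phi> (conjug P A)"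
      using preserver ss[OF A] ss[OF B] unfolding continuous_CS_preserver_def CS_preserver_def by blast
  qed
  thus ?thesis by (rule preserver_on_normal[OF card3 perfect conn])
qed

text \<open>The idempotent \<open>R = x y\<^sup>*\<close> and a projection orthogonal to both \<open>x\<close> and \<open>y\<close> become
  commuting orthogonal projections after one conjugation, namely by \<open>1 + R - Y\<close> with \<open>Y\<close> the
  projection onto \<open>y\<close>. Hence the image of \<open>R\<close> lives on the span of \<open>x\<close> and \<open>y\<close>.\<close>

lemma corner:
  assumes P: "invertible P" and \<alpha>: "\<And>N. N \<in> spec_normal X \<Longrightarrow> \<phi> (conjug P N) = \<alpha> N" "\<alpha> \<in> conj_maps"
    and w: "w \<noteq> 0" and u: "u \<noteq> 0" "cinner u (P *v w) = 0" "cinner u (matrix_inv (conj_transpose P) *v w) = 0"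
  shows "ray_proj u ** \<alpha> (ray_proj w) = 0"
proof -
  define x where "x = P *v w"
  define y where "y = matrix_inv (conj_transpose P) *v w"
  define R where "R = conjug P (ray_proj w)"
  define Y where "Y = ray_proj y"
  define W where "W = ray_proj u"
  note Pt = invertible_conj_transpose[OF P]
  define c where "c = cinner w w"
  have c: "c \<noteq> 0" using w by (simp add: c_def)
  have yw: "conj_transpose P *v y = w" using Pt by (simp add: y_def matrix_vector_mul_assoc matrix_inv_mult)
  hence y0: "y \<noteq> 0" using w by auto
  define N where "N = cinner y y"
  have N: "N \<noteq> 0" using y0 by (simp add: N_def)
  have yx: "cinner y x = c" by (simp add: x_def cinner_conj_transpose yw c_def)
  have ux: "cinner u x = 0" "cinner u y = 0" using u by (simp_all add: x_def y_def)
  have xu: "cinner y u = 0" using ux cinner_eq_0_sym by blast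
  have R: "R = mat (1 / c) ** rank_op x y"
    using P by (simp add: R_def ray_proj_rank_op conjug_smult c_def[symmetric])
      (simp add: conjug_def mult_rank_op rank_op_mult_right x_def y_def matrix_inv_conj_transpose)
  have Y: "Y = mat (1 / N) ** rank_op y y" by (simp add: Y_def ray_proj_rank_op N_def)
  have W: "W = mat (1 / cinner u u) ** rank_op u u" by (simp add: W_def ray_proj_rank_op)
  have pr: "(mat a ** rank_op p q) ** (mat b ** rank_op p' q') = mat (a * b * cinner q p') ** rank_op p q'" for a b p q p' q'
    by (simp add: vec_eq_iff mat_mult_nth matrix_matrix_mult_def[of "mat a ** rank_op p q"] rank_op_nth cinner_def
        sum_distrib_left sum_distrib_right mult_ac)
  have prods: "R ** R = R" "R ** Y = R" "Y ** R = Y" "Y ** Y = Y"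
    using c N by (simp_all add: R Y pr yx N_def[symmetric])
  have zeros: "W ** R = 0" "W ** Y = 0" "R ** W = 0" "Y ** W = 0"
    unfolding R Y W pr by (simp_all add: ux xu)
  \<comment> \<open>\<open>R\<close> and \<open>Y\<close> have the same kernel, so the products
    above make the square of \<open>R - Y\<close> zero: \<open>mat 1 - (R - Y)\<close> is the
    inverse. \<open>P2\<close> carries \<open>Y\<close> to \<open>R\<close> and commutes with
    \<open>W\<close>.\<close>
  define P2 where "P2 = mat 1 + (R - Y)"
  have "P2 ** (mat 1 - (R - Y)) = mat 1"
    by (simp add: P2_def matrix_distribs prods)
  hence P2: "invertible P2" by (rule invertibleI)
  have RY: "R = conjug P2 Y"
    by (rule conjug_eqI[OF P2]) (simp add: P2_def matrix_distribs prods)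
  have WW: "W = conjug P2 W"
    by (rule conjug_eqI[OF P2]) (simp add: P2_def matrix_distribs zeros)
  obtain \<alpha>2 where \<alpha>2: "\<alpha>2 \<in> conj_maps" "\<And>N. N \<in> spec_normal X \<Longrightarrow> \<phi> (conjug P2 N) = \<alpha>2 N"
    using twisted[OF P2] by blast
  \<comment> \<open>\<open>tv R\<close> lies on the orbits of both \<open>P\<close> and
    \<open>P2\<close>. Comparing the two descriptions ties \<alpha> to \<alpha>2, and \<alpha>2 is
    known at \<open>W\<close>, which is its own conjugate under \<open>P2\<close> and is fixed by
    \<phi>.\<close>
  have "tv (\<alpha> (ray_proj w)) = \<phi> (tv R)"
    using \<alpha>(1)[OF tv_normal[OF w]] P by (simp add: conjug_two_valued R_def conj_maps_two_valued \<alpha>(2))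
  also have "\<dots> = tv (\<alpha>2 Y)"
    using \<alpha>2(2)[OF tv_normal[OF y0]] P2 by (simp add: conjug_two_valued RY Y_def conj_maps_two_valued \<alpha>2(1))
  finally have 1: "\<alpha> (ray_proj w) = \<alpha>2 Y" using two_valued_inj two(3) by blast
  have "tv (\<alpha>2 W) = \<phi> (tv (conjug P2 W))"
    using \<alpha>2(2)[OF tv_normal[OF u(1)]] P2 by (simp add: conjug_two_valued W_def conj_maps_two_valued \<alpha>2(1))
  also have "\<dots> = tv W" using normal[OF tv_normal[OF u(1)]] WW by (simp add: W_def)
  finally have 2: "\<alpha>2 W = W" using two_valued_inj two(3) by blast
  have "\<alpha>2 W ** \<alpha>2 Y = 0" by (rule conj_maps_orthogonal[OF \<alpha>2(1)]) (simp_all add: zeros)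
  hence "W ** \<alpha>2 Y = 0" using 2 by simp
  thus ?thesis using 1 by (simp add: W_def)
qed

text \<open>Conjugation by a positive diagonal matrix, recorded through the squared inverses \<open>b\<close> of
  its entries, so that the range of \<open>ray_proj w\<close> and its kernel are related by \<open>diagm b\<close>.\<close>

definition scaling :: "('n \<Rightarrow> real) \<Rightarrow> complex^'n^'n" where
  "scaling b = diagm (\<lambda>i. complex_of_real (1 / sqrt (b i)))"

lemma scaling_facts:
  assumes "\<And>i. b i > 0"
  shows "invertible (scaling b)" "matrix_inv (scaling b) = diagm (\<lambda>i. complex_of_real (sqrt (b i)))"
    "conj_transpose (scaling b) = scaling b"
proof -
  have nz: "complex_of_real (1 / sqrt (b i)) \<noteq> 0" for i using assms[of i] by simp
  show "invertible (scaling b)" unfolding scaling_def by (rule invertible_diagm[OF nz])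
  show "matrix_inv (scaling b) = diagm (\<lambda>i. complex_of_real (sqrt (b i)))"
    unfolding scaling_def matrix_inv_diagm[OF nz] by (simp add: inverse_eq_divide)
  show "conj_transpose (scaling b) = scaling b" by (simp add: scaling_def conj_transpose_diagm)
qed

lemma two_more_indices:
  obtains k :: 'n where "k \<noteq> i" "k \<noteq> j"
proof -
  have "\<exists>k. k \<noteq> i \<and> k \<noteq> j"
  proof (rule ccontr)
    assume "\<not> ?thesis"
    hence "UNIV \<subseteq> {i, j}" by auto
    hence "CARD('n) \<le> card {i, j}" by (intro card_mono) auto
    also have "\<dots> \<le> 2" by (simp add: card_insert_if)
    finally show False using card3 by simp
  qed
  thus ?thesis using that by blast
qed

lemma diag_normal: "range d \<subseteq> X \<Longrightarrow> diagm d \<in> spec_normal X"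
  using spec_normal_iff unitary_mat1 by (metis conjug_mat1)

text \<open>Diagonal matrices are fixed by the scaling and by \<phi>, so \<open>T\<close> commutes
  with all coordinate idempotents and is diagonal. Its entries are recorded relative to those of the
  scaling: constant \<open>l\<close> corresponds to the identity, \<open>l\<close> proportional to
  \<open>b\<close> to \<Phi>.\<close>

lemma scaling_image:
  assumes b: "\<And>i. b i > 0"
  obtains l where "\<And>i. l i \<noteq> 0"
    "(\<forall>N\<in>spec_normal X. \<phi> (conjug (scaling b) N) = conjug (diagm (\<lambda>i. l i / complex_of_real (sqrt (b i)))) N) \<or>
     (\<forall>N\<in>spec_normal X. \<phi> (conjug (scaling b) N) = conjug (diagm (\<lambda>i. l i / complex_of_real (sqrt (b i)))) (transpose N))"
proof -
  have sb: "complex_of_real (sqrt (b i)) \<noteq> 0" for i using b[of i] by simp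
  obtain \<alpha> where \<alpha>: "\<alpha> \<in> conj_maps" "\<And>N. N \<in> spec_normal X \<Longrightarrow> \<phi> (conjug (scaling b) N) = \<alpha> N"
    using twisted[OF scaling_facts(1)[of b, OF b]] by blast
  obtain T where T: "invertible T" "\<alpha> = conjug T \<or> \<alpha> = (\<lambda>A. conjug T (transpose A))"
    using \<alpha>(1) conj_maps_iff by auto
  have "T ** unit_diag i = unit_diag i ** T" for i
  proof -
    have sx: "diagm (\<lambda>j. if j = i then \<kappa> else \<mu>) \<in> spec_normal X"
      by (rule diag_normal) (use two in auto)
    have "conjug (scaling b) (unit_diag i) = unit_diag i"
    proof (rule conjug_eqI[OF scaling_facts(1)[of b, OF b], symmetric])
      show "unit_diag i ** scaling b = scaling b ** unit_diag i"
        unfolding unit_diag_def scaling_def by (rule diagm_commute)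
    qed
    hence "tv (unit_diag i) = \<alpha> (tv (unit_diag i))"
      using \<alpha>(2)[OF sx] normal[OF sx] scaling_facts(1)[of b, OF b]
      by (simp add: two_valued_unit_diag[symmetric] conjug_two_valued)
    hence "unit_diag i = \<alpha> (unit_diag i)"
      using two_valued_inj two(3) conj_maps_two_valued[OF \<alpha>(1)] by metis
    hence "unit_diag i = conjug T (unit_diag i)" using T(2) by (auto simp: unit_diag_def)
    thus ?thesis using conjug_eqD[OF T(1)] by metis
  qed
  hence c: "(T ** unit_diag i) $ j $ k = (unit_diag i ** T) $ j $ k" for i j k by simp
  have "T $ j $ k = 0" if "j \<noteq> k" for j k
    using c[of k j k] that by (simp add: mult_unit_diag_nth unit_diag_mult_nth)
  hence Td: "T = diagm (\<lambda>i. T $ i $ i)" by (auto simp: vec_eq_iff diagm_nth)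
  have "T $ i $ i \<noteq> 0" for i
  proof
    assume "T $ i $ i = 0"
    hence "T *v axis i 1 = 0" by (subst Td) (auto simp: vec_eq_iff diagm_vec axis_def)
    hence "axis i (1::complex) = (0 :: complex^'n)" using T(1) invertible_ker by blast
    thus False by (simp add: axis_eq_0_iff)
  qed
  moreover define l where "l i = T $ i $ i * complex_of_real (sqrt (b i))" for i
  ultimately have l0: "l i \<noteq> 0" for i using sb by simp
  have "T = diagm (\<lambda>i. l i / complex_of_real (sqrt (b i)))"
    using Td sb by (simp add: l_def)
  thus ?thesis using that[of l] l0 \<alpha>(2) T(2) by auto
qed

lemma cinner_three:
  fixes v :: "complex^'n"
  assumes "i \<noteq> j" "i \<noteq> k" "j \<noteq> k"
  shows "cinner (a *s axis i 1 + b *s axis j 1 + c *s axis k 1) v = cnj a * v $ i + cnj b * v $ j + cnj c * v $ k"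
  by (simp add: cinner_simps cinner_axis)

lemma ray_proj_diag_orthogonal:
  assumes t: "\<And>i. t i \<noteq> 0" and w: "w \<noteq> 0" "u \<noteq> 0" and z: "ray_proj u ** conjug (diagm t) (ray_proj w) = 0"
  shows "cinner u (diagm t *v w) = 0"
proof -
  have T: "invertible (diagm t)" by (rule invertible_diagm[OF t])
  have "ray_proj u ** (diagm t ** ray_proj w) = 0"
  proof -
    have "ray_proj u ** (diagm t ** ray_proj w) = ray_proj u ** conjug (diagm t) (ray_proj w) ** diagm t"
      using T by (simp add: conjug_def matrix_mul_assoc[symmetric] matrix_inv_mult)
    thus ?thesis using z by simp
  qed
  moreover have "diagm t ** ray_proj w = mat (1 / cinner w w) ** rank_op (diagm t *v w) w"
    by (simp only: ray_proj_rank_op mat_mult_swap[of "diagm t"] mult_rank_op[of "diagm t"])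
  moreover have "ray_proj u ** (mat b ** rank_op y w) =
      mat b ** (mat (1 / cinner u u) ** (mat (cinner u y) ** rank_op u w))" for b y
    by (simp only: ray_proj_rank_op[of u] scalar_mult_mult rank_op_mult)
  ultimately show ?thesis using w by (simp add: mat_mult_eq_0_iff rank_op_eq_0_iff)
qed

lemma transpose_ray_proj: "transpose (ray_proj w) = ray_proj (\<chi> i. cnj (w $ i))"
proof -
  have "cinner (\<chi> i. cnj (w $ i)) (\<chi> i. cnj (w $ i)) = cinner w w"
    by (simp add: cinner_def mult.commute)
  thus ?thesis by (simp add: vec_eq_iff transpose_def ray_proj_def mult.commute)
qed

text \<open>An instance of \<open>corner\<close>: the scaling and its inverse send \<open>w\<close>
  to the vectors with entries 1 and \<open>b\<close>, up to a phase at k, and \<open>u\<close> is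
  orthogonal to both. In the direct case the conclusion says that on i, j, k the weights
  \<open>l\<close> are affine in \<open>b\<close>. The free phase \<omega> cancels there but
  survives squared in the transposed case, which makes that case refutable.\<close>

lemma scaling_relation:
  assumes b: "\<And>i. b i > 0" and ijk: "i \<noteq> j" "i \<noteq> k" "j \<noteq> k" and bij: "b i \<noteq> b j"
    and l: "\<And>i. l i \<noteq> 0"
    and \<alpha>: "\<And>N. N \<in> spec_normal X \<Longrightarrow> \<phi> (conjug (scaling b) N) = \<alpha> N"
    and \<omega>: "cnj \<omega> * \<omega> = 1"
  shows "\<alpha> = conjug (diagm (\<lambda>i. l i / complex_of_real (sqrt (b i)))) \<Longrightarrow>
      of_real (b j - b k) * l i + of_real (b k - b i) * l j + of_real (b i - b j) * l k = 0"
    and "\<alpha> = (\<lambda>N. conjug (diagm (\<lambda>i. l i / complex_of_real (sqrt (b i)))) (transpose N)) \<Longrightarrow>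
      of_real (b j - b k) * l i + of_real (b k - b i) * l j + of_real (b i - b j) * (cnj \<omega> * cnj \<omega>) * l k = 0"
proof -
  have sq: "complex_of_real (sqrt (b m)) * complex_of_real (sqrt (b m)) = of_real (b m)" for m
    using b[of m] by (simp add: less_imp_le flip: of_real_mult)
  have sb: "complex_of_real (sqrt (b m)) \<noteq> 0" for m using b[of m] by simp
  \<comment> \<open>Up to sign and phase, the cross product of (1, 1, 1) with the values of
    \<open>b\<close> at i, j, k.\<close>
  define u :: "complex^'n" where "u = of_real (b j - b k) *s axis i 1 + of_real (b k - b i) *s axis j 1 +
     (\<omega> * of_real (b i - b j)) *s axis k 1"
  define \<eta> where "\<eta> m = (if m = k then \<omega> else 1)" for m
  define w :: "complex^'n" where "w = (\<chi> m. \<eta> m * of_real (sqrt (b m)))"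
  have \<omega>0: "\<omega> \<noteq> 0" using \<omega> by auto
  have \<omega>\<omega>: "\<omega> * (cnj \<omega> * x) = x" "cnj \<omega> * (\<omega> * x) = x" for x
    using \<omega> by (simp_all add: mult.assoc[symmetric] mult.commute[of \<omega>])
  have w0: "w \<noteq> 0" using sb \<omega>0 by (auto simp: w_def vec_eq_iff \<eta>_def)
  have "u $ k \<noteq> 0" using ijk bij \<omega>0 by (simp add: u_def axis_def)
  hence u0: "u \<noteq> 0" by auto
  have cu: "cinner u v = of_real (b j - b k) * v $ i + of_real (b k - b i) * v $ j +
     (cnj \<omega> * of_real (b i - b j)) * v $ k" for v
    unfolding u_def cinner_three[OF ijk] by simp
  have x: "scaling b *v w = (\<chi> m. \<eta> m)"
    using sb by (simp add: vec_eq_iff scaling_def diagm_vec w_def)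
  have y: "matrix_inv (conj_transpose (scaling b)) *v w = (\<chi> m. \<eta> m * of_real (b m))"
    using sq by (simp add: scaling_facts[of b, OF b] vec_eq_iff diagm_vec w_def mult_ac)
  have ux: "cinner u (scaling b *v w) = 0" unfolding cu x using ijk
    by (simp add: \<eta>_def algebra_simps \<omega>\<omega> \<omega>)
  have uy: "cinner u (matrix_inv (conj_transpose (scaling b)) *v w) = 0" unfolding cu y using ijk
    by (simp add: \<eta>_def algebra_simps \<omega>\<omega> \<omega>)
  define t where "t i = l i / complex_of_real (sqrt (b i))" for i
  have t: "t i \<noteq> 0" for i using l sb by (simp add: t_def)
  have T: "invertible (diagm t)" by (rule invertible_diagm[OF t])
  {
    assume a: "\<alpha> = conjug (diagm (\<lambda>i. l i / complex_of_real (sqrt (b i))))"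
    hence "\<alpha> \<in> conj_maps" using T conj_maps_iff unfolding t_def[abs_def] by blast
    from corner[OF scaling_facts(1)[of b, OF b] \<alpha> this w0 u0 ux uy]
    have "ray_proj u ** conjug (diagm t) (ray_proj w) = 0" by (simp add: a t_def[abs_def])
    hence "cinner u (diagm t *v w) = 0" by (rule ray_proj_diag_orthogonal[OF t w0 u0])
    moreover have "diagm t *v w = (\<chi> m. \<eta> m * l m)"
      using sb by (simp add: vec_eq_iff diagm_vec t_def w_def)
    ultimately show "of_real (b j - b k) * l i + of_real (b k - b i) * l j + of_real (b i - b j) * l k = 0"
      unfolding cu using ijk by (simp add: \<eta>_def mult_ac \<omega>\<omega>)
  }
  {
    assume a: "\<alpha> = (\<lambda>N. conjug (diagm (\<lambda>i. l i / complex_of_real (sqrt (b i)))) (transpose N))"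
    hence "\<alpha> \<in> conj_maps" using T conj_maps_iff unfolding t_def[abs_def] by blast
    from corner[OF scaling_facts(1)[of b, OF b] \<alpha> this w0 u0 ux uy]
    have orth: "ray_proj u ** conjug (diagm t) (ray_proj (\<chi> i. cnj (w $ i))) = 0"
      by (simp add: a t_def[abs_def] transpose_ray_proj)
    have nz: "(\<chi> i. cnj (w $ i)) \<noteq> 0" using w0 by (simp add: vec_eq_iff)
    have "cinner u (diagm t *v (\<chi> i. cnj (w $ i))) = 0"
      by (rule ray_proj_diag_orthogonal[OF t nz u0 orth])
    moreover have "diagm t *v (\<chi> i. cnj (w $ i)) = (\<chi> m. cnj (\<eta> m) * l m)"
      using sb by (simp add: vec_eq_iff diagm_vec t_def w_def)
    ultimately show "of_real (b j - b k) * l i + of_real (b k - b i) * l j + of_real (b i - b j) * (cnj \<omega> * cnj \<omega>) * l k = 0"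
      unfolding cu using ijk by (simp add: \<eta>_def mult_ac)
  }
qed

section \<open>Weights of a diagonal scaling\<close>

lemma scaling_no_transpose:
  assumes b: "\<And>i. b i > 0"
  obtains l where "\<And>i. l i \<noteq> 0"
    "\<And>N. N \<in> spec_normal X \<Longrightarrow> \<phi> (conjug (scaling b) N) = conjug (diagm (\<lambda>i. l i / complex_of_real (sqrt (b i)))) N"
proof (cases "\<exists>i j. b i \<noteq> b j")
  case False
  define c where "c = b undefined"
  have bc: "b = (\<lambda>_. c)" using False by (auto simp: c_def)
  have c: "c > 0" using b bc by simp
  have "scaling b = mat (of_real (1 / sqrt c))" by (simp add: scaling_def bc diagm_const)
  moreover have "(\<lambda>i. 1 / complex_of_real (sqrt (b i))) = (\<lambda>_. of_real (1 / sqrt c))" by (simp add: bc)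
  ultimately have "scaling b = diagm (\<lambda>i. 1 / complex_of_real (sqrt (b i)))" by (simp add: diagm_const)
  moreover have "conjug (scaling b) N = N" for N
    by (rule conjug_eqI[OF scaling_facts(1)[of b, OF b], symmetric])
       (simp add: \<open>scaling b = mat (of_real (1 / sqrt c))\<close> mat_commute)
  ultimately show ?thesis using that[of "\<lambda>_. 1"] normal by simp
next
  case True
  then obtain i j where ij: "b i \<noteq> b j" by blast
  hence "i \<noteq> j" by auto
  obtain k where k: "k \<noteq> i" "k \<noteq> j" using two_more_indices .
  obtain l where l: "\<And>i. l i \<noteq> 0"
    "(\<forall>N\<in>spec_normal X. \<phi> (conjug (scaling b) N) = conjug (diagm (\<lambda>i. l i / complex_of_real (sqrt (b i)))) N) \<or>
     (\<forall>N\<in>spec_normal X. \<phi> (conjug (scaling b) N) = conjug (diagm (\<lambda>i. l i / complex_of_real (sqrt (b i)))) (transpose N))"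
    using scaling_image[of b] b by blast
  from l(2) show ?thesis
  proof
    assume "\<forall>N\<in>spec_normal X. \<phi> (conjug (scaling b) N) = conjug (diagm (\<lambda>i. l i / complex_of_real (sqrt (b i)))) N"
    thus ?thesis using that[of l] l(1) by blast
  next
    assume a: "\<forall>N\<in>spec_normal X. \<phi> (conjug (scaling b) N) = conjug (diagm (\<lambda>i. l i / complex_of_real (sqrt (b i)))) (transpose N)"
    note rel = scaling_relation(2)[where b=b and l=l, OF b \<open>i \<noteq> j\<close> k(1)[symmetric] k(2)[symmetric] ij l(1)
        a[rule_format] _ refl]
    define S where "S = of_real (b j - b k) * l i + of_real (b k - b i) * l j"
    define c where "c = of_real (b i - b j) * l k"
    \<comment> \<open>The phases 1 and \<open>\<i>\<close> give opposite signs for \<open>c\<close>,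
      so the weight at k would have to vanish.\<close>
    have "S + c = 0" using rel[of 1] by (simp add: S_def c_def)
    moreover have "S - c = 0" using rel[of \<i>] by (simp add: S_def c_def algebra_simps)
    ultimately have "c = 0" by simp
    thus ?thesis using ij l(1)[of k] by (simp add: c_def)
  qed
qed

text \<open>The weights are determined only up to a common factor, so what follows compares their
  ratios for one and the same \<open>b\<close>.\<close>

definition weights :: "('n \<Rightarrow> real) \<Rightarrow> 'n \<Rightarrow> complex" where
  "weights b = (SOME l. (\<forall>i. l i \<noteq> 0) \<and> (\<forall>N\<in>spec_normal X. \<phi> (conjug (scaling b) N) =
     conjug (diagm (\<lambda>i. l i / complex_of_real (sqrt (b i)))) N))"

lemma weights:
  assumes "\<And>i. b i > 0"
  shows "weights b i \<noteq> 0"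
    "\<And>N. N \<in> spec_normal X \<Longrightarrow> \<phi> (conjug (scaling b) N) = conjug (diagm (\<lambda>i. weights b i / complex_of_real (sqrt (b i)))) N"
proof -
  have "\<exists>l. (\<forall>i. l i \<noteq> 0) \<and> (\<forall>N\<in>spec_normal X. \<phi> (conjug (scaling b) N) =
     conjug (diagm (\<lambda>i. l i / complex_of_real (sqrt (b i)))) N)"
    using scaling_no_transpose[of b] assms by metis
  from someI_ex[OF this] show "weights b i \<noteq> 0"
    "\<And>N. N \<in> spec_normal X \<Longrightarrow> \<phi> (conjug (scaling b) N) = conjug (diagm (\<lambda>i. weights b i / complex_of_real (sqrt (b i)))) N"
    unfolding weights_def by blast+
qed

lemma weights_relation:
  assumes b: "\<And>i. b i > 0" and ijk: "i \<noteq> j" "i \<noteq> k" "j \<noteq> k" "b i \<noteq> b j"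
  shows "of_real (b j - b k) * weights b i + of_real (b k - b i) * weights b j + of_real (b i - b j) * weights b k = 0"
  by (rule scaling_relation(1)[where b=b and l="weights b" and \<omega>=1 and
        \<alpha>="conjug (diagm (\<lambda>i. weights b i / complex_of_real (sqrt (b i))))"])
     (use b ijk weights(1)[of b, OF b] weights(2)[of b, OF b] in simp_all)

lemma conjug_diagm_nth: "(\<And>i. t i \<noteq> 0) \<Longrightarrow> conjug (diagm t) A $ i $ j = t i * A $ i $ j / (t j :: complex)"
  by (simp add: conjug_def matrix_inv_diagm mult_diagm_nth diagm_mult_nth field_simps)

text \<open>The projection onto the line spanned by the sum of the axes i and j feels a scaling only
  through the ratio of \<open>b i\<close> and \<open>b j\<close>. Scalings with equal ratio send it
  to the same matrix, and one off-diagonal entry of the image under \<phi> displays both weight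
  ratios.\<close>

lemma weights_ratio:
  assumes b: "\<And>i. b i > 0" "\<And>i. c i > 0" and eq: "b i * c j = b j * c i" and ij: "i \<noteq> j"
  shows "weights b i * weights c j = weights b j * weights c i"
proof -
  have sb: "complex_of_real (sqrt (b i)) \<noteq> 0" "complex_of_real (sqrt (c i)) \<noteq> 0" for i
    using b(1)[of i] b(2)[of i] by simp_all
  define w :: "complex^'n" where "w = axis i 1 + axis j 1"
  have wi: "w $ i = 1" "w $ j = 1" "\<And>k. k \<noteq> i \<Longrightarrow> k \<noteq> j \<Longrightarrow> w $ k = 0"
    using ij by (auto simp: w_def axis_def)
  have w0: "w \<noteq> 0" using wi(1) by auto
  have e: "complex_of_real (sqrt (b i)) * of_real (sqrt (c j)) = of_real (sqrt (b j)) * of_real (sqrt (c i))"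
    unfolding of_real_mult[symmetric] real_sqrt_mult[symmetric] eq ..
  have pr: "ray_proj w $ p $ q = w $ p * cnj (w $ q) / cinner w w" for p q by (simp add: ray_proj_def)
  have sc: "conjug (scaling f) A $ p $ q = (of_real (sqrt (f q)) / of_real (sqrt (f p))) * A $ p $ q"
    if "\<And>i. f i > 0" for f A p q
  proof -
    have "complex_of_real (1 / sqrt (f i)) \<noteq> 0" for i using that[of i] by simp
    thus ?thesis unfolding scaling_def by (subst conjug_diagm_nth) simp_all
  qed
  have "complex_of_real (sqrt (b j)) / of_real (sqrt (b i)) = of_real (sqrt (c j)) / of_real (sqrt (c i))"
    "complex_of_real (sqrt (b i)) / of_real (sqrt (b j)) = of_real (sqrt (c i)) / of_real (sqrt (c j))"
    using sb e by (simp_all add: frac_eq_eq mult.commute)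
  hence rat: "complex_of_real (sqrt (b q)) / of_real (sqrt (b p)) = of_real (sqrt (c q)) / of_real (sqrt (c p))"
    if "p \<in> {i, j}" "q \<in> {i, j}" for p q
    using that sb by auto
  have "conjug (scaling b) (ray_proj w) $ p $ q = conjug (scaling c) (ray_proj w) $ p $ q" for p q
  proof (cases "p \<in> {i, j} \<and> q \<in> {i, j}")
    case True
    thus ?thesis using rat[of p q] by (simp only: sc[of b, OF b(1)] sc[of c, OF b(2)])
  next
    case False
    thus ?thesis using wi(3) by (auto simp: sc[of b, OF b(1)] sc[of c, OF b(2)] pr)
  qed
  hence "conjug (scaling b) (ray_proj w) = conjug (scaling c) (ray_proj w)" by (simp add: vec_eq_iff)
  hence "\<phi> (conjug (scaling b) (tv (ray_proj w))) = \<phi> (conjug (scaling c) (tv (ray_proj w)))"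
    using scaling_facts(1) b by (simp add: conjug_two_valued)
  hence "conjug (diagm (\<lambda>i. weights b i / complex_of_real (sqrt (b i)))) (tv (ray_proj w)) =
    conjug (diagm (\<lambda>i. weights c i / complex_of_real (sqrt (c i)))) (tv (ray_proj w))"
    using weights(2)[of b, OF b(1) tv_normal[OF w0]] weights(2)[of c, OF b(2) tv_normal[OF w0]] by simp
  hence eqn: "conjug (diagm (\<lambda>i. weights b i / complex_of_real (sqrt (b i)))) (tv (ray_proj w)) $ i $ j =
    conjug (diagm (\<lambda>i. weights c i / complex_of_real (sqrt (c i)))) (tv (ray_proj w)) $ i $ j" by simp
  have tv0: "tv (ray_proj w) $ i $ j \<noteq> 0"
    using two(3) ij w0 by (simp add: two_valued_def mat_nth mat_mult_nth pr wi)
  have nb: "weights b i / complex_of_real (sqrt (b i)) \<noteq> 0" "weights c i / complex_of_real (sqrt (c i)) \<noteq> 0" for i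
    using sb weights(1)[of b, OF b(1)] weights(1)[of c, OF b(2)] by simp_all
  have "(weights b i / of_real (sqrt (b i))) / (weights b j / of_real (sqrt (b j))) * tv (ray_proj w) $ i $ j =
     (weights c i / of_real (sqrt (c i))) / (weights c j / of_real (sqrt (c j))) * tv (ray_proj w) $ i $ j"
    using eqn unfolding conjug_diagm_nth[of "\<lambda>i. weights b i / complex_of_real (sqrt (b i))", OF nb(1)]
      conjug_diagm_nth[of "\<lambda>i. weights c i / complex_of_real (sqrt (c i))", OF nb(2)]
    by (simp only: times_divide_eq_left)
  hence "(weights b i / of_real (sqrt (b i))) / (weights b j / of_real (sqrt (b j))) =
     (weights c i / of_real (sqrt (c i))) / (weights c j / of_real (sqrt (c j)))"
    by (rule iffD1[OF mult_right_cancel[OF tv0]])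
  hence "weights b i * weights c j * (of_real (sqrt (b j)) * of_real (sqrt (c i))) =
    weights b j * weights c i * (of_real (sqrt (b i)) * of_real (sqrt (c j)))"
    using sb weights(1)[of b, OF b(1)] weights(1)[of c, OF b(2)] by (simp add: field_simps)
  thus ?thesis using sb by (simp add: e)
qed

text \<open>\<open>G i j\<close> is the weight ratio as a function of the ratio \<beta> of
  \<open>b i\<close> and \<open>b j\<close>. The relation with a third index gives it the form 1 + m
  (\<beta> - 1), and exchanging i and j inverts both \<beta> and the value. Only the slopes 0 and 1
  are compatible with this; they belong to the identity and to \<Phi>.\<close>

lemma affine_weights:
  "\<exists>m\<in>{0, 1}. \<forall>b i j. (\<forall>i. b i > 0) \<longrightarrow> b i \<noteq> b j \<longrightarrow>
     weights b i * of_real (b j) = weights b j * (of_real (b j) + m * (of_real (b i) - of_real (b j)))"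
proof -
  define one :: "'n \<Rightarrow> real" where "one = (\<lambda>_. 1)"
  define G where "G i j \<beta> = weights (one(i := \<beta>)) i / weights (one(i := \<beta>)) j" for i j \<beta>
  have rat: "weights b i / weights b j = G i j (b i / b j)" if b: "\<And>i. b i > 0" and ij: "i \<noteq> j" for b i j
  proof -
    have c: "\<And>k. (one(i := b i / b j)) k > 0" using b by (simp add: one_def)
    have "weights b i * weights (one(i := b i / b j)) j = weights b j * weights (one(i := b i / b j)) i"
      by (rule weights_ratio[of b "one(i := b i / b j)", OF b c _ ij])
         (use ij b[of j] in \<open>simp add: one_def\<close>)
    thus ?thesis using weights(1)[of b, OF b] weights(1)[of "one(i := b i / b j)", OF c]
      by (simp add: G_def field_simps)
  qed
  define m where "m i j = G i j 2 - 1" for i j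
  have rel: "(1 - of_real k') * G i j \<beta> + of_real (k' - \<beta>) + (of_real \<beta> - 1) * G k j k' = 0"
    if d: "i \<noteq> j" "i \<noteq> k" "j \<noteq> k" and p: "\<beta> > 0" "k' > 0" "\<beta> \<noteq> 1" for i j k \<beta> k'
  proof -
    define b where "b = one(i := \<beta>, k := k')"
    have b: "\<And>l. b l > 0" using p by (simp add: b_def one_def)
    have bv: "b i = \<beta>" "b j = 1" "b k = k'" using d by (auto simp: b_def one_def)
    note w0 = weights(1)[of b, OF b]
    have "of_real (b j - b k) * weights b i + of_real (b k - b i) * weights b j + of_real (b i - b j) * weights b k = 0"
      by (rule weights_relation[of b, OF b d]) (use p bv in simp)
    moreover have "weights b i = G i j \<beta> * weights b j" "weights b k = G k j k' * weights b j"
      using rat[of b i j, OF b d(1)] rat[of b k j, OF b d(3)[symmetric]] w0 unfolding bv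
      by (simp_all add: nonzero_divide_eq_eq)
    ultimately have "((1 - of_real k') * G i j \<beta> + of_real (k' - \<beta>) + (of_real \<beta> - 1) * G k j k') * weights b j = 0"
      by (simp add: bv algebra_simps)
    thus ?thesis using w0[of j] by simp
  qed
  \<comment> \<open>\<open>rel\<close> at the reference value k' = 2, the one used in the definition
    of \<open>m\<close>. The slope involves only k and j, hence is independent of i.\<close>
  have G: "G i j \<beta> = 1 + m k j * (of_real \<beta> - 1)"
    if "i \<noteq> j" "i \<noteq> k" "j \<noteq> k" "\<beta> > 0" "\<beta> \<noteq> 1" for i j k \<beta>
    using rel[OF that(1-4) _ that(5), of 2] by (simp add: m_def algebra_simps)
  have mm: "m i j = m k j" if "i \<noteq> j" "i \<noteq> k" "j \<noteq> k" for i j k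
    using G[OF that, of 2] by (simp add: m_def)
  have Gm: "G i j \<beta> = 1 + m i j * (of_real \<beta> - 1)" if "i \<noteq> j" "\<beta> > 0" "\<beta> \<noteq> 1" for i j \<beta>
  proof -
    obtain k where "k \<noteq> i" "k \<noteq> j" using two_more_indices .
    thus ?thesis using G[of i j k \<beta>] mm[of i j k] that by auto
  qed
  have inv: "G i j \<beta> * G j i (1 / \<beta>) = 1" if ij: "i \<noteq> j" and \<beta>: "\<beta> > 0" for i j \<beta>
  proof -
    define b where "b = one(i := \<beta>)"
    have b: "\<And>l. b l > 0" using \<beta> by (simp add: b_def one_def)
    have bv: "b i = \<beta>" "b j = 1" using ij by (auto simp: b_def one_def)
    note w0 = weights(1)[of b, OF b]
    have "weights b i / weights b j = G i j \<beta>" "weights b j / weights b i = G j i (1 / \<beta>)"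
      using rat[of b i j, OF b ij] rat[of b j i, OF b ij[symmetric]] unfolding bv by simp_all
    thus ?thesis using w0[of i] w0[of j] by (metis nonzero_mult_div_cancel_left times_divide_times_eq divide_self mult.commute no_zero_divisors)
  qed
  \<comment> \<open>Inversion at \<beta> = 2 and \<beta> = 3 gives two equations. Eliminating the
    product of the two slopes shows that they agree, and either equation then becomes m (1 - m) =
    0.\<close>
  have m01: "m i j = m j i \<and> m i j \<in> {0, 1}" if ij: "i \<noteq> j" for i j
  proof -
    have "(1 + m i j) * (1 + m j i * (1 / 2 - 1)) = 1"
      using inv[OF ij, of 2] Gm[OF ij, of 2] Gm[OF ij[symmetric], of "1 / 2"] by simp
    hence 1: "2 * m i j - m j i - m i j * m j i = 0" by (simp add: field_simps)
    have "(1 + m i j * 2) * (1 + m j i * (1 / 3 - 1)) = 1"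
      using inv[OF ij, of 3] Gm[OF ij, of 3] Gm[OF ij[symmetric], of "1 / 3"] by simp
    hence "2 * (3 * m i j - m j i - 2 * (m i j * m j i)) = 0" by (simp add: field_simps)
    hence 2: "3 * m i j - m j i - 2 * (m i j * m j i) = 0" by (metis mult_eq_0_iff zero_neq_numeral)
    have "m i j - m j i = 2 * (2 * m i j - m j i - m i j * m j i) - (3 * m i j - m j i - 2 * (m i j * m j i))"
      by (simp add: algebra_simps)
    hence e: "m i j = m j i" using 1 2 by simp
    hence "m i j * (1 - m i j) = 0" using 1 by (simp add: algebra_simps)
    thus ?thesis using e by auto
  qed
  obtain i0 j0 :: 'n where ij0: "i0 \<noteq> j0" using two_more_indices by metis
  have mc: "m i j = m i0 j0" if "i \<noteq> j" for i j
  proof -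
    have a: "m i j0 = m i0 j0" if "i \<noteq> j0" for i using mm[of i j0 i0] that ij0 by (cases "i = i0") auto
    show ?thesis
    proof (cases "j = j0")
      case False
      hence "m i j = m j0 j" using mm[of i j j0] that by (cases "i = j0") auto
      thus ?thesis using m01[of j0 j] a[of j] False by auto
    qed (use a that in auto)
  qed
  have "weights b i * of_real (b j) = weights b j * (of_real (b j) + m i0 j0 * (of_real (b i) - of_real (b j)))"
    if b: "\<And>i. b i > 0" and ne: "b i \<noteq> b j" for b i j
  proof -
    have ij: "i \<noteq> j" using ne by auto
    have q: "b i / b j > 0" "b i / b j \<noteq> 1" using b[of i] b[of j] ne by auto
    have bj: "complex_of_real (b j) \<noteq> 0" using b[of j] by simp
    have "weights b i / weights b j = 1 + m i0 j0 * (of_real (b i / b j) - 1)"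
      using rat[of b i j, OF b ij] Gm[OF ij q] mc[OF ij] by simp
    hence "weights b i = weights b j * (1 + m i0 j0 * (of_real (b i / b j) - 1))"
      using weights(1)[of b, OF b] by (simp add: nonzero_divide_eq_eq mult.commute)
    thus ?thesis using bj by (simp add: field_simps)
  qed
  thus ?thesis using m01[OF ij0] by blast
qed

lemma weights_dichotomy:
  "(\<forall>b i j. (\<forall>i. b i > 0) \<longrightarrow> weights b i = weights b j) \<or>
   (\<forall>b i j. (\<forall>i. b i > 0) \<longrightarrow> weights b i * of_real (b j) = weights b j * of_real (b i))"
proof -
  obtain m where m: "m = 0 \<or> m = 1" "\<And>b i j. (\<And>i. b i > 0) \<Longrightarrow> b i \<noteq> b j \<Longrightarrow>
     weights b i * of_real (b j) = weights b j * (of_real (b j) + m * (of_real (b i) - of_real (b j)))"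
    using affine_weights by blast
  have eq: "weights b i = weights b j" if b: "\<And>i. b i > 0" and eq: "b i = b j" for b i j
  proof (cases "i = j")
    case False
    obtain k where k: "k \<noteq> i" "k \<noteq> j" using two_more_indices .
    \<comment> \<open>Equal entries are not covered by the affine relation. Doubling a third entry
      makes i and j comparable with k, and \<open>weights_ratio\<close> carries the result back to
      \<open>b\<close>.\<close>
    define c where "c = b(k := 2 * b i)"
    have c: "\<And>i. c i > 0" using b by (simp add: c_def)
    have cv: "c i = b i" "c j = b i" "c k = 2 * b i" "c i \<noteq> c k" "c j \<noteq> c k"
      using k eq b[of i] b[of j] by (auto simp: c_def)
    have "weights c i * of_real (2 * b i) = weights c j * of_real (2 * b i)"
      using m(2)[of c i k, OF c cv(4)] m(2)[of c j k, OF c cv(5)] unfolding cv by simp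
    moreover have "complex_of_real (2 * b i) \<noteq> 0" using b[of i] by simp
    ultimately have "weights c i = weights c j" by (metis mult_right_cancel)
    moreover have "weights b i * weights c j = weights b j * weights c i"
      by (rule weights_ratio[of b c, OF b c _ False]) (use eq cv in auto)
    ultimately show ?thesis using weights(1)[of c, OF c] by simp
  qed simp
  have bz: "complex_of_real (b j) \<noteq> 0" if "\<And>i. b i > 0" for b :: "'n \<Rightarrow> real" and j
    using that[of j] by simp
  from m(1) show ?thesis
  proof
    assume "m = 0"
    hence "weights b i = weights b j" if "\<And>i. b i > 0" for b i j
      using m(2)[of b i j, OF that] eq[of b i j, OF that] bz[of b j, OF that] by (cases "b i = b j") auto
    thus ?thesis by blast
  next
    assume "m = 1"
    hence "weights b i * of_real (b j) = weights b j * of_real (b i)" if "\<And>i. b i > 0" for b i j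
      using m(2)[of b i j, OF that] eq[of b i j, OF that] by (cases "b i = b j") auto
    thus ?thesis by blast
  qed
qed

lemma scaling_dichotomy:
  "(\<forall>b. (\<forall>i. b i > 0) \<longrightarrow> (\<forall>N\<in>spec_normal X. \<phi> (conjug (scaling b) N) = conjug (scaling b) N)) \<or>
   (\<forall>b. (\<forall>i. b i > 0) \<longrightarrow> (\<forall>N\<in>spec_normal X. \<phi> (conjug (scaling b) N) = conjug (matrix_inv (scaling b)) N))"
proof -
  have sc: "conjug (mat c ** P) N = conjug P N" if "c \<noteq> 0" "invertible P" for c and P N :: "complex^'n^'n"
  proof -
    have i: "invertible (mat c :: complex^'n^'n)"
      by (rule invertibleI[of _ "mat (1 / c)"]) (use that in \<open>simp add: mat_mat\<close>)
    have "conjug P N = conjug (mat c) (conjug P N)" by (rule conjug_eqI[OF i]) (simp add: mat_commute)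
    thus ?thesis using i that(2) by (simp add: conjug_conjug)
  qed
  have key: "\<phi> (conjug (scaling b) N) = conjug P N"
    if b: "\<And>i. b i > 0" and N: "N \<in> spec_normal X" and P: "invertible P" "c \<noteq> 0"
      "diagm (\<lambda>i. weights b i / complex_of_real (sqrt (b i))) = mat c ** P" for b N c P
    using weights(2)[of b, OF b N] sc[OF P(2,1)] P(3) by simp
  from weights_dichotomy show ?thesis
  proof
    assume w: "\<forall>b i j. (\<forall>i. b i > 0) \<longrightarrow> weights b i = weights b j"
    have "\<phi> (conjug (scaling b) N) = conjug (scaling b) N" if b: "\<And>i. b i > 0" and N: "N \<in> spec_normal X" for b N
    proof (rule key[OF b N scaling_facts(1)[of b, OF b] weights(1)[of b undefined, OF b]])
      show "diagm (\<lambda>i. weights b i / complex_of_real (sqrt (b i))) = mat (weights b undefined) ** scaling b"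
        using w b by (auto simp: vec_eq_iff mat_mult_nth scaling_def diagm_nth)
    qed
    thus ?thesis by blast
  next
    assume w: "\<forall>b i j. (\<forall>i. b i > 0) \<longrightarrow> weights b i * of_real (b j) = weights b j * of_real (b i)"
    have "\<phi> (conjug (scaling b) N) = conjug (matrix_inv (scaling b)) N"
      if b: "\<And>i. b i > 0" and N: "N \<in> spec_normal X" for b N
    proof (rule key[OF b N invertible_matrix_inv[OF scaling_facts(1)[of b, OF b]]])
      have bz: "complex_of_real (b i) \<noteq> 0" for i using b[of i] by simp
      define c where "c = weights b undefined / of_real (b undefined)"
      show "c \<noteq> 0" using weights(1)[of b undefined, OF b] bz by (simp add: c_def)
      have "weights b i / complex_of_real (sqrt (b i)) = c * complex_of_real (sqrt (b i))" for i
      proof -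
        have "weights b i = c * of_real (b i)"
          using w b bz by (simp add: c_def nonzero_eq_divide_eq)
        moreover have "complex_of_real (b i) = of_real (sqrt (b i)) * of_real (sqrt (b i))"
          using b[of i] by (simp add: less_imp_le flip: of_real_mult)
        moreover have "complex_of_real (sqrt (b i)) \<noteq> 0" using b[of i] by simp
        ultimately show ?thesis by simp
      qed
      thus "diagm (\<lambda>i. weights b i / complex_of_real (sqrt (b i))) = mat c ** matrix_inv (scaling b)"
        by (simp add: vec_eq_iff mat_mult_nth scaling_facts(2)[of b, OF b] diagm_nth)
    qed
    thus ?thesis by blast
  qed
qed

section \<open>The two alternatives for positive matrices with a given eigenbasis\<close>

definition fixed_type :: "complex^'n^'n \<Rightarrow> bool" where
  "fixed_type V \<longleftrightarrow> (\<forall>b. (\<forall>i. b i > 0) \<longrightarrow> (\<forall>N\<in>spec_normal X.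
     \<phi> (conjug (conjug V (scaling b)) N) = conjug (conjug V (scaling b)) N))"

definition inverse_type :: "complex^'n^'n \<Rightarrow> bool" where
  "inverse_type V \<longleftrightarrow> (\<forall>b. (\<forall>i. b i > 0) \<longrightarrow> (\<forall>N\<in>spec_normal X.
     \<phi> (conjug (conjug V (scaling b)) N) = conjug (matrix_inv (conjug V (scaling b))) N))"

lemma conjug_conjug_matrix:
  assumes "invertible V" "invertible S"
  shows "conjug (conjug V S) N = conjug V (conjug S (conjug (matrix_inv V) N))"
    "invertible (conjug V S)" "matrix_inv (conjug V S) = conjug V (matrix_inv S)"
proof -
  show "conjug (conjug V S) N = conjug V (conjug S (conjug (matrix_inv V) N))"
    using assms by (simp add: conjug_conjug invertible_mult invertible_matrix_inv conjug_def[of V S] matrix_mul_assoc)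
  have "conjug V S ** conjug V (matrix_inv S) = mat 1"
    using assms by (simp add: conjug_mult[symmetric] matrix_inv_mult)
  thus "invertible (conjug V S)" "matrix_inv (conjug V S) = conjug V (matrix_inv S)"
    using invertibleI matrix_inv_eqI by blast+
qed

lemma type_dichotomy:
  assumes V: "unitary V"
  shows "fixed_type V \<or> inverse_type V"
proof -
  interpret V: identity_on_normal X "\<lambda>A. conjug (conj_transpose V) (\<phi> (conjug V A))" \<kappa> \<mu>
    by (rule conjugate_unitary[OF V])
  note Vi = unitary_invertible[OF V]
  have inv: "conj_transpose V = matrix_inv V" by (simp add: unitary_matrix_inv V)
  have nn: "conjug (matrix_inv V) N \<in> spec_normal X" if "N \<in> spec_normal X" for N
    using that V unfolding spec_normal_iff inv[symmetric]
    by (metis conjug_conjug unitary_mult unitary_invertible unitary_conj_transpose)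
  have tr: "\<phi> (conjug (conjug V S) N) = conjug (conjug V S') N"
    if "invertible S" "invertible S'"
      "conjug (conj_transpose V) (\<phi> (conjug V (conjug S (conjug (matrix_inv V) N)))) = conjug S' (conjug (matrix_inv V) N)"
    for S S' N
  proof -
    have "\<phi> (conjug (conjug V S) N) = conjug V (conjug S' (conjug (matrix_inv V) N))"
      unfolding conjug_conjug_matrix(1)[OF Vi that(1)] that(3)[symmetric] using Vi by (simp add: inv)
    thus ?thesis using conjug_conjug_matrix(1)[OF Vi that(2)] by simp
  qed
  from V.scaling_dichotomy show ?thesis
  proof
    assume a: "\<forall>b. (\<forall>i. b i > 0) \<longrightarrow> (\<forall>N\<in>spec_normal X.
      conjug (conj_transpose V) (\<phi> (conjug V (conjug (scaling b) N))) = conjug (scaling b) N)"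
    have "fixed_type V" unfolding fixed_type_def
    proof (intro allI impI ballI)
      fix b :: "'n \<Rightarrow> real" and N :: "complex^'n^'n" assume b: "\<forall>i. b i > 0" and N: "N \<in> spec_normal X"
      show "\<phi> (conjug (conjug V (scaling b)) N) = conjug (conjug V (scaling b)) N"
        by (rule tr) (use a b nn[OF N] scaling_facts(1)[of b] in auto)
    qed
    thus ?thesis ..
  next
    assume a: "\<forall>b. (\<forall>i. b i > 0) \<longrightarrow> (\<forall>N\<in>spec_normal X.
      conjug (conj_transpose V) (\<phi> (conjug V (conjug (scaling b) N))) = conjug (matrix_inv (scaling b)) N)"
    have "inverse_type V" unfolding inverse_type_def
    proof (intro allI impI ballI)
      fix b :: "'n \<Rightarrow> real" and N :: "complex^'n^'n" assume b: "\<forall>i. b i > 0" and N: "N \<in> spec_normal X"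
      have i: "invertible (scaling b)" using scaling_facts(1)[of b] b by blast
      show "\<phi> (conjug (conjug V (scaling b)) N) = conjug (matrix_inv (conjug V (scaling b))) N"
        unfolding conjug_conjug_matrix(3)[OF Vi i]
        by (rule tr[OF i invertible_matrix_inv[OF i]]) (use a b nn[OF N] in auto)
    qed
    thus ?thesis ..
  qed
qed

text \<open>The positive matrix \<open>S\<close> with eigenvalue 2 on \<open>u\<close> and 1 on its
  complement is diagonal in every unitary frame containing \<open>u\<close>. If two such frames had
  different types, conjugation by \<open>S\<close> and by its inverse would agree on normal
  matrices, and \<open>S ** S\<close> would commute with every ray projection.\<close>

lemma types_exclusive:
  assumes V: "unitary V" "unitary V'" "column i V = column j V'" "fixed_type V" "inverse_type V'"
  shows False
proof -
  define u where "u = column i V"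
  define S where "S = mat 1 + ray_proj u"
  have uu: "cinner u u = 1" using V(1) by (simp add: u_def unitary_iff_columns)
  \<comment> \<open>The entry 1/4 becomes 1 / sqrt (1/4) = 2 in the scaling, which is therefore the
    identity plus a coordinate idempotent.\<close>
  define b :: "'n \<Rightarrow> 'n \<Rightarrow> real" where "b i k = (if k = i then 1 / 4 else 1)" for i k
  have b: "\<forall>k. b i k > 0" for i by (simp add: b_def)
  have s2: "sqrt (1 / 4) = 1 / 2" by (rule real_sqrt_unique) (simp_all add: power2_eq_square)
  have sc: "scaling (b i) = mat 1 + unit_diag i" for i
    by (auto simp: vec_eq_iff scaling_def diagm_nth b_def mat_nth unit_diag_nth s2)
  have SV: "conjug W (scaling (b k)) = S" if "unitary W" "column k W = u" for W k
    using that by (simp add: sc conjug_add unitary_invertible ray_proj_column[symmetric] S_def)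
  have Si: "invertible S"
    using SV[OF V(1), of i] conjug_conjug_matrix(2)[OF unitary_invertible[OF V(1)]] scaling_facts(1)[of "b i"] b
    by (metis u_def)
  have SN: "conjug S N = conjug (matrix_inv S) N" if N: "N \<in> spec_normal X" for N
    using V(4,5) b N SV[OF V(1), of i] SV[OF V(2), of j] V(3)
    unfolding fixed_type_def inverse_type_def u_def by metis
  obtain z where z: "cinner z z = 1" "cinner u z = 0" using common_orthogonal_vector[OF card3, of u u] by blast
  \<comment> \<open>Not an eigenvector of \<open>S ** S\<close>, which multiplies \<open>u\<close>
    by 4 and \<open>z\<close> by 1; so the projection onto it cannot commute with
    \<open>S ** S\<close>.\<close>
  define w where "w = u + z"
  have zu: "cinner z u = 0" using z(2) cinner_eq_0_sym by blast
  have w: "cinner w u = 1" "cinner u w = 1" "cinner w z = 1"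
    by (simp_all add: w_def cinner_simps uu z zu)
  have w0: "w \<noteq> 0" using w by auto
  have "tv (conjug S (ray_proj w)) = tv (conjug (matrix_inv S) (ray_proj w))"
    using SN[OF tv_normal[OF w0]] Si invertible_matrix_inv[OF Si] by (simp add: conjug_two_valued)
  hence "conjug S (ray_proj w) = conjug (matrix_inv S) (ray_proj w)" using two_valued_inj two(3) by blast
  hence "conjug S (conjug S (ray_proj w)) = ray_proj w" using Si by simp
  hence "conjug (S ** S) (ray_proj w) = ray_proj w" using Si by (simp add: conjug_conjug)
  hence "ray_proj w ** (S ** S) = (S ** S) ** ray_proj w"
    using conjug_eqD[of "S ** S" "ray_proj w" "ray_proj w"] Si invertible_mult by metis
  hence eq: "ray_proj w ** (S ** S) *v z = (S ** S) ** ray_proj w *v z" by simp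
  have rp: "ray_proj v *v x = (cinner v x / cinner v v) *s v" for v x :: "complex^'n"
    by (simp add: vec_eq_iff matrix_vector_mult_def ray_proj_def cinner_def sum_distrib_left sum_distrib_right
        sum_divide_distrib mult_ac)
  have Sx: "S *v x = x + cinner u x *s u" for x
    by (simp add: S_def matrix_vector_mult_add_rdistrib rp uu)
  have "ray_proj w *v z = ray_proj w ** (S ** S) *v z"
    by (simp add: matrix_vector_mul_assoc[symmetric] Sx z)
  also have "\<dots> = (1 / cinner w w) *s (S *v (S *v w))"
    unfolding eq by (simp add: matrix_vector_mul_assoc[symmetric] rp w matrix_vector_smult)
  also have "S *v (S *v w) = w + 3 *s u" by (simp add: Sx cinner_simps w uu vec_eq_iff)
  finally have "(1 / cinner w w) *s w = (1 / cinner w w) *s (w + 3 *s u)" by (simp add: rp w)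
  hence "3 *s u = 0" using w0 by (auto simp: vec_eq_iff)
  thus False using uu by auto
qed

text \<open>Two frames need not share a vector, but a vector \<open>z\<close> orthogonal to one
  member of each links them: \<open>V\<close>, \<open>V1\<close>, \<open>V2\<close>,
  \<open>V'\<close> successively share \<open>u\<close>, \<open>z\<close> and \<open>w\<close>, and
  the type is passed along this chain.\<close>

lemma type_uniform:
  "(\<forall>V. unitary V \<longrightarrow> fixed_type V) \<or> (\<forall>V. unitary V \<longrightarrow> inverse_type V)"
proof (rule ccontr)
  assume n: "\<not> ?thesis"
  then obtain V V' where V: "unitary V" "\<not> inverse_type V" "unitary V'" "\<not> fixed_type V'" by blast
  hence t: "fixed_type V" "inverse_type V'" using type_dichotomy by auto
  fix i :: 'n
  define u where "u = column i V"
  define w where "w = column i V'"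
  have uw: "cinner u u = 1" "cinner w w = 1" using V by (simp_all add: u_def w_def unitary_iff_columns)
  obtain z where z: "cinner z z = 1" "cinner u z = 0" "cinner w z = 0" using common_orthogonal_vector[OF card3] by blast
  obtain V1 a b where V1: "unitary V1" "column a V1 = u" "column b V1 = z"
    using orthonormal_pair_extends[OF uw(1) z(1,2) card2] by blast
  obtain V2 c d where V2: "unitary V2" "column c V2 = w" "column d V2 = z"
    using orthonormal_pair_extends[OF uw(2) z(1,3) card2] by blast
  have "fixed_type V1" using types_exclusive[OF V(1) V1(1), of i a] type_dichotomy[OF V1(1)] t(1) V1(2) u_def by auto
  hence "fixed_type V2" using types_exclusive[OF V1(1) V2(1), of b d] type_dichotomy[OF V2(1)] V1(3) V2(3) by auto
  thus False using types_exclusive[OF V2(1) V(3), of c i] t(2) V2(2) w_def by auto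
qed

lemma identity_or_Phi:
  "(\<forall>A\<in>spec_semisimple X. \<phi> A = A) \<or> (\<forall>A\<in>spec_semisimple X. \<phi> A = Phi A)"
proof -
  have form: "\<exists>V b N U d. unitary V \<and> (\<forall>i. b i > 0) \<and> unitary U \<and> N = conjug U (diagm d) \<and> N \<in> spec_normal X \<and>
      A = conjug (conjug V (scaling b)) N \<and> positive_matrix (conjug V (scaling b)) \<and> invertible (conjug V (scaling b))"
    if A: "A \<in> spec_semisimple X" for A
  proof -
    obtain P d where P: "invertible P" "range d \<subseteq> X" "A = conjug P (diagm d)" using A spec_semisimple_iff by blast
    obtain V r U where V: "unitary V" "\<And>i. r i > (0::real)" "unitary U"
      "P = conjug V (diagm (\<lambda>i. complex_of_real (r i))) ** U"
      using polar_decomposition[OF P(1)] by metis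
    \<comment> \<open>The choice for which the scaling has exactly the entries
      \<open>r\<close>.\<close>
    define b where "b i = 1 / (r i)\<^sup>2" for i
    have "1 / sqrt (b i) = r i" for i using V(2)[of i] by (simp add: b_def real_sqrt_divide)
    hence sb: "scaling b = diagm (\<lambda>i. complex_of_real (r i))" by (simp add: scaling_def)
    have "r i \<noteq> 0" for i using V(2)[of i] by simp
    hence b: "\<forall>i. b i > 0" by (simp add: b_def)
    note S = positive_conjug_unitary[of V r, OF V(1,2), folded sb]
    have "A = conjug (conjug V (scaling b)) (conjug U (diagm d))"
      using S(2) V(3) P(3) by (simp add: V(4) sb conjug_conjug unitary_invertible)
    moreover have "conjug U (diagm d) \<in> spec_normal X" using V(3) P(2) spec_normal_iff by blast
    ultimately show ?thesis using V(1,3) b S by blast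
  qed
  from type_uniform show ?thesis
  proof
    assume "\<forall>V. unitary V \<longrightarrow> fixed_type V"
    hence "\<phi> A = A" if "A \<in> spec_semisimple X" for A
      using form[OF that] unfolding fixed_type_def by auto
    thus ?thesis by blast
  next
    assume t: "\<forall>V. unitary V \<longrightarrow> inverse_type V"
    have "\<phi> A = Phi A" if A: "A \<in> spec_semisimple X" for A
    proof -
      obtain V b N U d where V: "unitary V" "\<forall>i. b i > 0" "unitary U" "N = conjug U (diagm d)" "N \<in> spec_normal X"
        "A = conjug (conjug V (scaling b)) N" "positive_matrix (conjug V (scaling b))" "invertible (conjug V (scaling b))"
        using form[OF A] by blast
      have "\<phi> A = conjug (matrix_inv (conjug V (scaling b))) N"
        using t V(1,2,5,6) unfolding inverse_type_def by blast
      thus ?thesis using Phi_conjug_positive[OF V(7,8,3)] V(4,6) by simp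
    qed
    thus ?thesis by blast
  qed
qed

end

theorem preserver_on_semisimple:
  assumes card: "CARD('n) \<ge> 3" and X: "perfect_set X" "connected (config_space CARD('n) X)"
    and \<phi>: "continuous_CS_preserver (spec_semisimple X) (\<phi> :: complex^'n^'n \<Rightarrow> complex^'n^'n)"
  shows "\<exists>\<alpha>\<in>conj_maps. (\<forall>A\<in>spec_semisimple X. \<phi> A = \<alpha> A) \<or> (\<forall>A\<in>spec_semisimple X. \<phi> A = \<alpha> (Phi A))"
proof -
  have "continuous_CS_preserver (spec_normal X) \<phi>"
    using \<phi> spec_normal_subset continuous_on_subset[of "spec_semisimple X" \<phi> "spec_normal X"]
    unfolding continuous_CS_preserver_def CS_preserver_def by blast
  then obtain \<alpha> where \<alpha>: "\<alpha> \<in> conj_maps" "\<And>A. A \<in> spec_normal X \<Longrightarrow> \<phi> A = \<alpha> A"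
    using preserver_on_normal[OF card X] by blast
  obtain \<beta> where \<beta>: "\<beta> \<in> conj_maps" "\<And>A. \<beta> (\<alpha> A) = A" "\<And>A. \<alpha> (\<beta> A) = A"
    using conj_maps_inverse[OF \<alpha>(1)] by metis
  show ?thesis
  proof (cases "X = {}")
    case True
    hence "spec_semisimple X = ({} :: (complex^'n^'n) set)"
      using matrix_spectrum_nonempty by (auto simp: spec_semisimple_def)
    thus ?thesis using \<alpha>(1) by auto
  next
    case False
    then obtain l where l: "l \<in> X" by blast
    then obtain \<mu> where \<mu>: "\<mu> \<in> X" "\<mu> \<noteq> l" using perfect_set_two_points X(1) by blast
    interpret identity_on_normal X "\<lambda>A. \<beta> (\<phi> A)" l \<mu>
    proof
      show "continuous_CS_preserver (spec_semisimple X) (\<lambda>A. \<beta> (\<phi> A))"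
        by (rule compose_CS_preserver[OF \<beta>(1) \<phi>])
    qed (use card X \<alpha> \<beta> l \<mu> in auto)
    show ?thesis using identity_or_Phi \<alpha>(1) \<beta>(3) by metis
  qed
qed

section \<open>Divided differences of complex conjugation\<close>

text \<open>The divided difference of complex conjugation in Lagrange form. It is symmetric in the
  nodes, so they are given as a set, which makes exchanging and removing nodes convenient.\<close>

definition ddiff :: "complex set \<Rightarrow> complex" where
  "ddiff S = (\<Sum>z\<in>S. cnj z / (\<Prod>w\<in>S - {z}. z - w))"

lemma ddiff_step:
  assumes S: "finite S" "a \<notin> S" "b \<notin> S" "a \<noteq> b"
  shows "ddiff (insert b S) - ddiff (insert a S) = (b - a) * ddiff (insert a (insert b S))"
proof -
  define dp where "dp z = (\<Prod>w\<in>S - {z}. z - w)" for z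
  have dp0: "dp z \<noteq> 0" for z using S(1) by (auto simp: dp_def prod_zero_iff)
  have Sx: "S - {x} = S" if "x \<notin> S" for x using that by auto
  have one: "ddiff (insert x S) = cnj x / dp x + (\<Sum>z\<in>S. cnj z / ((z - x) * dp z))" if "x \<notin> S" for x
  proof -
    have 1: "insert x S - {x} = S - {x}" using that by auto
    have "(\<Prod>w\<in>insert x S - {z}. z - w) = (z - x) * dp z" if z: "z \<in> S" for z
    proof -
      have "insert x S - {z} = insert x (S - {z})" using z \<open>x \<notin> S\<close> by auto
      thus ?thesis using S(1) \<open>x \<notin> S\<close> by (simp add: dp_def)
    qed
    thus ?thesis unfolding ddiff_def using S(1) that by (simp add: 1 dp_def)
  qed
  have two: "ddiff (insert a (insert b S)) = cnj a / ((a - b) * dp a) + cnj b / ((b - a) * dp b) +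
      (\<Sum>z\<in>S. cnj z / ((z - a) * ((z - b) * dp z)))"
  proof -
    have "insert a (insert b S) - {a} = insert b S" "insert a (insert b S) - {b} = insert a S" using S by auto
    moreover have "(\<Prod>w\<in>insert a (insert b S) - {z}. z - w) = (z - a) * ((z - b) * dp z)" if z: "z \<in> S" for z
    proof -
      have "insert a (insert b S) - {z} = insert a (insert b (S - {z}))" using z S by auto
      thus ?thesis using S by (simp add: dp_def)
    qed
    ultimately show ?thesis unfolding ddiff_def using S by (simp add: dp_def Sx)
  qed
  have z: "cnj z / ((z - b) * dp z) - cnj z / ((z - a) * dp z) = (b - a) * (cnj z / ((z - a) * ((z - b) * dp z)))"
    if "z \<in> S" for z
  proof -
    have "z - a \<noteq> 0" "z - b \<noteq> 0" using that S by auto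
    thus ?thesis using dp0[of z] by (simp add: divide_simps) (simp add: algebra_simps)
  qed
  have ab: "a - b \<noteq> 0" "b - a \<noteq> 0" using S(4) by auto
  have "(b - a) * (cnj a / ((a - b) * dp a)) = - (cnj a / dp a)" "(b - a) * (cnj b / ((b - a) * dp b)) = cnj b / dp b"
    using ab dp0[of a] by (simp_all add: divide_simps) (simp add: algebra_simps)
  moreover have "(b - a) * (\<Sum>z\<in>S. cnj z / ((z - a) * ((z - b) * dp z))) =
      (\<Sum>z\<in>S. cnj z / ((z - b) * dp z)) - (\<Sum>z\<in>S. cnj z / ((z - a) * dp z))"
    unfolding sum_distrib_left sum_subtractf[symmetric] by (intro sum.cong refl z[symmetric])
  ultimately show ?thesis
    unfolding one[OF S(2)] one[OF S(3)] two distrib_left by simp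
qed

lemma ddiff_singleton [simp]: "ddiff {z} = cnj z"
  by (simp add: ddiff_def)

text \<open>Dropping the first or the last node leaves the common inner nodes \<open>ys\<close>, and
  \<open>ddiff_step\<close> combines the two smaller divided differences.\<close>

lemma Delta_iterate_eq_ddiff:
  "distinct zs \<Longrightarrow> length zs = Suc k \<Longrightarrow> (Delta ^^ k) (\<lambda>zs. cnj (hd zs)) zs = ddiff (set zs)"
proof (induction k arbitrary: zs)
  case 0
  then obtain z where "zs = [z]" by (auto simp: length_Suc_conv)
  thus ?case by simp
next
  case (Suc k)
  then obtain a zs' where "zs = a # zs'" "length zs' = Suc k" by (auto simp: length_Suc_conv)
  moreover from this have "zs' \<noteq> []" by auto
  ultimately obtain ys b where zs: "zs = a # ys @ [b]" by (metis append_butlast_last_id)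
  have d: "a \<notin> set ys" "b \<notin> set ys" "a \<noteq> b" using Suc.prems(1) zs by auto
  have "(Delta ^^ Suc k) (\<lambda>zs. cnj (hd zs)) zs = Delta ((Delta ^^ k) (\<lambda>zs. cnj (hd zs))) zs" by simp
  also have "\<dots> = ((Delta ^^ k) (\<lambda>zs. cnj (hd zs)) (tl zs) - (Delta ^^ k) (\<lambda>zs. cnj (hd zs)) (butlast zs)) /
      (last zs - hd zs)" by (rule Delta_def)
  also have "(Delta ^^ k) (\<lambda>zs. cnj (hd zs)) (tl zs) = ddiff (set (tl zs))"
    by (rule Suc.IH) (use Suc.prems zs in auto)
  also have "(Delta ^^ k) (\<lambda>zs. cnj (hd zs)) (butlast zs) = ddiff (set (butlast zs))"
    by (rule Suc.IH) (use Suc.prems in \<open>auto simp: distinct_butlast\<close>)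
  also have "last zs - hd zs = b - a" using zs by simp
  also have "set (tl zs) = insert b (set ys)" using zs by auto
  also have "set (butlast zs) = insert a (set ys)" using zs by (simp add: butlast_append)
  also have "(ddiff (insert b (set ys)) - ddiff (insert a (set ys))) / (b - a) = ddiff (insert a (insert b (set ys)))"
    using d by (subst ddiff_step) auto
  finally show ?case using zs by (simp add: insert_commute)
qed

lemma Delta_cnj_eq_ddiff:
  assumes "x \<in> config_space n X" "n \<ge> 1"
  shows "Delta_cnj n x = ddiff (x ` {..<n})"
proof -
  have "distinct (map x [0..<n])"
    using assms(1) by (simp add: config_space_def distinct_map atLeast0LessThan)
  thus ?thesis unfolding Delta_cnj_def using assms(2)
    by (subst Delta_iterate_eq_ddiff) (auto simp: atLeast0LessThan)
qed

subsection \<open>Newton interpolation\<close>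

lemma inj_on_lessThan_notin: "inj_on x {..<n :: nat} \<Longrightarrow> k < n \<Longrightarrow> x k \<notin> x ` {..<k}"
proof
  assume i: "inj_on x {..<n}" "k < n" and "x k \<in> x ` {..<k}"
  then obtain j where "j < k" "x k = x j" by auto
  with i inj_onD[OF i(1), of k j] show False by auto
qed

lemma newton_remainder:
  fixes x :: "nat \<Rightarrow> complex"
  assumes "inj_on x {..<m}" "z \<notin> x ` {..<m}"
  shows "cnj z = (\<Sum>j<m. ddiff (x ` {..j}) * (\<Prod>i<j. z - x i)) + ddiff (insert z (x ` {..<m})) * (\<Prod>i<m. z - x i)"
  using assms
proof (induction m)
  case (Suc m)
  have i: "inj_on x {..<m}" using Suc.prems(1) by (rule inj_on_subset) auto
  have n: "z \<notin> x ` {..<m}" "z \<noteq> x m" using Suc.prems(2) by auto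
  have xm: "x m \<notin> x ` {..<m}" using inj_on_lessThan_notin[OF Suc.prems(1)] by simp
  have ins: "x ` {..<Suc m} = insert (x m) (x ` {..<m})" "x ` {..m} = insert (x m) (x ` {..<m})"
    by (auto simp: lessThan_Suc lessThan_Suc_atMost[symmetric])
  have E: "ddiff (insert z (x ` {..<m})) = ddiff (x ` {..m}) + (z - x m) * ddiff (insert z (x ` {..<Suc m}))"
    using ddiff_step[of "x ` {..<m}" "x m" z] xm n unfolding ins by (simp add: insert_commute algebra_simps)
  show ?case using Suc.IH[OF i n(1)] unfolding E by (simp add: algebra_simps)
qed simp

lemma newton_interpolation:
  fixes x :: "nat \<Rightarrow> complex"
  assumes "inj_on x {..<n}" "k < n"
  shows "cnj (x k) = (\<Sum>j<n. ddiff (x ` {..j}) * (\<Prod>i<j. x k - x i))"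
proof -
  have "inj_on x {..<k}" using inj_on_subset[OF assms(1)] assms(2) by auto
  moreover have "x k \<notin> x ` {..<k}" by (rule inj_on_lessThan_notin[OF assms])
  ultimately have "cnj (x k) = (\<Sum>j<k. ddiff (x ` {..j}) * (\<Prod>i<j. x k - x i)) +
      ddiff (insert (x k) (x ` {..<k})) * (\<Prod>i<k. x k - x i)" by (rule newton_remainder)
  also have "insert (x k) (x ` {..<k}) = x ` {..k}" by (auto simp: lessThan_Suc_atMost[symmetric] lessThan_Suc)
  also have "(\<Sum>j<k. ddiff (x ` {..j}) * (\<Prod>i<j. x k - x i)) + ddiff (x ` {..k}) * (\<Prod>i<k. x k - x i) =
      (\<Sum>j<Suc k. ddiff (x ` {..j}) * (\<Prod>i<j. x k - x i))" by simp
  \<comment> \<open>Every term with j > k contains the factor with i = k and vanishes.\<close>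
  also have "\<dots> = (\<Sum>j<n. ddiff (x ` {..j}) * (\<Prod>i<j. x k - x i))"
    using assms(2) by (intro sum.mono_neutral_left) (auto intro!: prod_zero)
  finally show ?thesis .
qed

lemma tendsto_ddiff_distinct:
  assumes "finite K" "inj_on \<mu> K" "\<And>m. inj_on (x m) K" "\<And>k. k \<in> K \<Longrightarrow> (\<lambda>m. x m k) \<longlonglongrightarrow> \<mu> k"
  shows "(\<lambda>m. ddiff (x m ` K)) \<longlonglongrightarrow> ddiff (\<mu> ` K)"
proof -
  have e: "ddiff (y ` K) = (\<Sum>k\<in>K. cnj (y k) / (\<Prod>l\<in>K - {k}. y k - y l))" if "inj_on y K" for y
  proof -
    have "y ` K - {y k} = y ` (K - {k})" if "k \<in> K" for k using \<open>inj_on y K\<close> that by (auto simp: inj_on_def)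
    moreover have "inj_on y (K - {k})" for k using that by (rule inj_on_subset) auto
    ultimately show ?thesis unfolding ddiff_def using that by (simp add: sum.reindex prod.reindex)
  qed
  have "(\<Prod>l\<in>K - {k}. \<mu> k - \<mu> l) \<noteq> 0" if "k \<in> K" for k
    using assms(1,2) that by (auto simp: prod_zero_iff inj_on_def)
  thus ?thesis unfolding e[OF assms(2)] e[OF assms(3)]
    by (intro tendsto_sum tendsto_divide tendsto_cnj tendsto_prod tendsto_diff assms(4)) auto
qed

subsection \<open>Local boundedness and limits\<close>

text \<open>Node sets in a ball replace configurations near the diagonal. This lets the number of
  nodes vary, as the coefficients of Newton interpolation require.\<close>

definition ddiff_bounded :: "complex set \<Rightarrow> complex \<Rightarrow> nat \<Rightarrow> bool" where
  "ddiff_bounded X z k \<longleftrightarrow> (\<exists>\<epsilon>>0. \<exists>K. \<forall>S. S \<subseteq> X \<inter> ball z \<epsilon> \<and> card S = k \<longrightarrow> norm (ddiff S) \<le> K)"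

definition ddiff_limit :: "complex set \<Rightarrow> complex \<Rightarrow> nat \<Rightarrow> complex \<Rightarrow> bool" where
  "ddiff_limit X z k l \<longleftrightarrow> (\<forall>\<eta>>0. \<exists>\<epsilon>>0. \<forall>S. S \<subseteq> X \<inter> ball z \<epsilon> \<and> card S = k \<longrightarrow> norm (ddiff S - l) < \<eta>)"

lemma ddiff_limit_bounded:
  assumes "ddiff_limit X z k l" shows "ddiff_bounded X z k"
proof -
  obtain \<epsilon> where \<epsilon>: "\<epsilon> > 0" "\<And>S. S \<subseteq> X \<inter> ball z \<epsilon> \<and> card S = k \<Longrightarrow> norm (ddiff S - l) < 1"
    using assms zero_less_one unfolding ddiff_limit_def by blast
  have "norm (ddiff S) \<le> norm l + 1" if "S \<subseteq> X \<inter> ball z \<epsilon> \<and> card S = k" for S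
    using \<epsilon>(2)[OF that] norm_triangle_ineq[of "ddiff S - l" l] by simp
  thus ?thesis unfolding ddiff_bounded_def using \<epsilon>(1) by blast
qed

text \<open>Exchanging one node changes the divided difference by the next order one times the
  distance of the exchanged nodes.\<close>

lemma ddiff_lipschitz:
  assumes K: "\<And>S. S \<subseteq> X \<inter> ball z \<epsilon> \<Longrightarrow> card S = Suc k \<Longrightarrow> norm (ddiff S) \<le> K" "K \<ge> 0"
    and S: "S \<subseteq> X \<inter> ball z \<delta>" "card S = k" and T: "T \<subseteq> X \<inter> ball z \<delta>" "card T = k"
    and k: "k \<ge> 1" and \<delta>: "\<delta> \<le> \<epsilon>"
  shows "norm (ddiff S - ddiff T) \<le> 2 * \<delta> * K * card (S - T)"
proof -
  have fin: "finite A" if "card A = k" for A :: "complex set" using that k card_ge_0_finite[of A] by simp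
  show ?thesis using S
  proof (induction "card (S - T)" arbitrary: S)
    case 0
    hence "S \<subseteq> T" using fin[OF 0(3)] by simp
    hence "S = T" using 0 T fin by (metis card_subset_eq)
    thus ?case by simp
  next
    case (Suc c)
    note fS = fin[OF Suc.prems(2)] and fT = fin[OF T(2)]
    from Suc.hyps(2) obtain a where a: "a \<in> S" "a \<notin> T" by (metis Diff_iff card.empty ex_in_conv nat.distinct(1))
    have "card (T - S) = card (S - T)"
      using fS fT Suc.prems(2) T(2) by (simp add: card_Diff_subset_Int Int_commute)
    then obtain b where b: "b \<in> T" "b \<notin> S" using Suc.hyps(2) by (metis Diff_iff card.empty ex_in_conv nat.distinct(1))
    define R where "R = S - {a}"
    have ab: "a \<notin> R" "b \<notin> R" "a \<noteq> b" "finite R" using a b fS by (auto simp: R_def)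
    have SR: "S = insert a R" using a by (auto simp: R_def)
    have cR: "Suc (card R) = k" using SR ab Suc.prems(2) by simp
    have sub: "insert b R \<subseteq> X \<inter> ball z \<delta>" using Suc.prems(1) b T(1) by (auto simp: R_def)
    have "insert b R - T = (S - T) - {a}" using b by (auto simp: R_def)
    hence c: "c = card (insert b R - T)" using Suc.hyps(2) a fS by simp
    have IH: "norm (ddiff (insert b R) - ddiff T) \<le> 2 * \<delta> * K * c"
      using Suc.hyps(1)[OF c sub] ab cR c by simp
    have "norm (ddiff (insert b R) - ddiff S) = norm (b - a) * norm (ddiff (insert a (insert b R)))"
      unfolding SR ddiff_step[OF ab(4,1,2,3)] by (simp add: norm_mult)
    also have "norm (ddiff (insert a (insert b R))) \<le> K"
    proof (rule K(1))
      show "insert a (insert b R) \<subseteq> X \<inter> ball z \<epsilon>"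
        using sub Suc.prems(1) a \<delta> by auto
      show "card (insert a (insert b R)) = Suc k" using ab cR by simp
    qed
    hence "norm (b - a) * norm (ddiff (insert a (insert b R))) \<le> (2 * \<delta>) * K"
    proof (intro mult_mono)
      have "dist z a < \<delta>" "dist z b < \<delta>" using Suc.prems(1) a(1) b(1) T(1) by auto
      hence "dist b a < \<delta> + \<delta>" using dist_triangle_less_add[of b z \<delta> a \<delta>] by (simp add: dist_commute)
      thus "norm (b - a) \<le> 2 * \<delta>" by (simp add: dist_norm)
      have "0 \<le> dist z a" by simp
      thus "0 \<le> 2 * \<delta>" using \<open>dist z a < \<delta>\<close> by linarith
    qed (use K(2) in auto)
    finally have "norm (ddiff (insert b R) - ddiff S) \<le> 2 * \<delta> * K" .
    moreover have "norm (ddiff S - ddiff T) \<le> norm (ddiff (insert b R) - ddiff S) + norm (ddiff (insert b R) - ddiff T)"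
      using norm_triangle_ineq4[of "ddiff (insert b R) - ddiff T" "ddiff (insert b R) - ddiff S"] by simp
    ultimately have "norm (ddiff S - ddiff T) \<le> 2 * \<delta> * K + 2 * \<delta> * K * c" using IH by simp
    thus ?case using Suc.hyps(2) by (metis (no_types, opaque_lifting) add.commute distrib_left mult.right_neutral of_nat_1 of_nat_Suc)
  qed
qed

text \<open>By \<open>ddiff_lipschitz\<close>, the divided differences over k nodes in a ball of
  radius \<delta> differ from each other by a constant times \<delta>. This is a Cauchy condition,
  and the limit along one sequence of node sets serves for all of them.\<close>

lemma ddiff_bounded_limit:
  assumes "ddiff_bounded X z (Suc k)" "k \<ge> 1"
  shows "\<exists>l. ddiff_limit X z k l"
proof -
  obtain \<epsilon> K0 where \<epsilon>: "\<epsilon> > 0" and K0: "\<And>S. S \<subseteq> X \<inter> ball z \<epsilon> \<Longrightarrow> card S = Suc k \<Longrightarrow> norm (ddiff S) \<le> K0"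
    using assms(1) unfolding ddiff_bounded_def by blast
  define K where "K = max K0 1"
  have K: "\<And>S. S \<subseteq> X \<inter> ball z \<epsilon> \<Longrightarrow> card S = Suc k \<Longrightarrow> norm (ddiff S) \<le> K" "K \<ge> 0" "K > 0"
    using K0 by (auto simp: K_def le_max_iff_disj)
  have lip: "norm (ddiff S - ddiff T) \<le> 2 * \<delta> * K * k"
    if "S \<subseteq> X \<inter> ball z \<delta>" "card S = k" "T \<subseteq> X \<inter> ball z \<delta>" "card T = k" "\<delta> \<le> \<epsilon>" "\<delta> > 0" for S T \<delta>
  proof -
    have "finite S" using that(2) assms(2) card_ge_0_finite[of S] by simp
    hence "card (S - T) \<le> k" using that(2) by (metis card_mono Diff_subset)
    hence "2 * \<delta> * K * card (S - T) \<le> 2 * \<delta> * K * k" using that K by (intro mult_left_mono) auto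
    thus ?thesis using ddiff_lipschitz[of X z \<epsilon> k K S \<delta> T] K that assms(2) by (metis order_trans)
  qed
  show ?thesis
  proof (cases "\<forall>\<delta>>0. \<exists>S. S \<subseteq> X \<inter> ball z \<delta> \<and> card S = k")
    \<comment> \<open>If some ball contains no set of k nodes, every value is a limit
      vacuously.\<close>
    case False
    then obtain \<delta> where "\<delta> > 0" "\<And>S. \<not> (S \<subseteq> X \<inter> ball z \<delta> \<and> card S = k)" by blast
    thus ?thesis unfolding ddiff_limit_def by blast
  next
    case True
    define \<delta> where "\<delta> m = \<epsilon> / real (Suc m)" for m
    have \<delta>: "\<delta> m > 0" "\<delta> m \<le> \<epsilon>" for m using \<epsilon> by (auto simp: \<delta>_def field_simps)
    have \<delta>0: "\<delta> \<longlonglongrightarrow> 0" unfolding \<delta>_def by (rule LIMSEQ_Suc[OF lim_const_over_n])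
    have \<delta>mono: "\<delta> m' \<le> \<delta> m" if "m \<le> m'" for m m' using that \<epsilon> by (auto simp: \<delta>_def field_simps)
    have "\<forall>m. \<exists>S. S \<subseteq> X \<inter> ball z (\<delta> m) \<and> card S = k" using True \<delta> by blast
    then obtain S where S: "\<And>m. S m \<subseteq> X \<inter> ball z (\<delta> m)" "\<And>m. card (S m) = k" by metis
    have small: "\<exists>M. 2 * \<delta> M * K * k < \<eta>" if "\<eta> > 0" for \<eta>
    proof -
      have "(\<lambda>m. 2 * \<delta> m * K * k) \<longlonglongrightarrow> 2 * 0 * K * k" by (intro tendsto_intros \<delta>0)
      hence "\<forall>\<^sub>F m in sequentially. 2 * \<delta> m * K * k < \<eta>" using that by (intro order_tendstoD(2)) auto
      thus ?thesis unfolding eventually_sequentially by blast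
    qed
    have sub: "S m \<subseteq> X \<inter> ball z (\<delta> M)" if "M \<le> m" for m M
      using S(1)[of m] \<delta>mono[OF that] by auto
    have "Cauchy (\<lambda>m. ddiff (S m))"
    proof (rule metric_CauchyI)
      fix \<eta> :: real assume "\<eta> > 0"
      then obtain M where M: "2 * \<delta> M * K * k < \<eta>" using small by blast
      have "dist (ddiff (S m)) (ddiff (S m')) < \<eta>" if "m \<ge> M" "m' \<ge> M" for m m'
        using lip[OF sub[OF that(1)] S(2) sub[OF that(2)] S(2) \<delta>(2,1)] M by (simp add: dist_norm)
      thus "\<exists>M. \<forall>m\<ge>M. \<forall>m'\<ge>M. dist (ddiff (S m)) (ddiff (S m')) < \<eta>" by blast
    qed
    then obtain l where l: "(\<lambda>m. ddiff (S m)) \<longlonglongrightarrow> l" using Cauchy_convergent convergent_def by blast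
    have "ddiff_limit X z k l" unfolding ddiff_limit_def
    proof (intro allI impI)
      fix \<eta> :: real assume "\<eta> > 0"
      then obtain M where M: "2 * \<delta> M * K * k < \<eta>" using small by blast
      have "norm (ddiff T - l) < \<eta>" if T: "T \<subseteq> X \<inter> ball z (\<delta> M)" "card T = k" for T
      proof -
        have "(\<lambda>m. norm (ddiff T - ddiff (S m))) \<longlonglongrightarrow> norm (ddiff T - l)" by (intro tendsto_intros l)
        moreover have "\<exists>N. \<forall>m\<ge>N. norm (ddiff T - ddiff (S m)) \<le> 2 * \<delta> M * K * k"
          using lip[OF T sub S(2) \<delta>(2,1)] by blast
        ultimately have "norm (ddiff T - l) \<le> 2 * \<delta> M * K * k" by (rule LIMSEQ_le_const2)
        thus ?thesis using M by simp
      qed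
      thus "\<exists>\<epsilon>>0. \<forall>S. S \<subseteq> X \<inter> ball z \<epsilon> \<and> card S = k \<longrightarrow> norm (ddiff S - l) < \<eta>" using \<delta>(1) by blast
    qed
    thus ?thesis ..
  qed
qed

text \<open>Descent on the number of nodes: a bound for k + 1 nodes gives a limit, hence a bound,
  for k nodes. A hypothesis on n nodes thus controls all Newton coefficients.\<close>

lemma ddiff_bounded_lower:
  assumes "ddiff_bounded X z n" "1 \<le> k" "k \<le> n"
  shows "ddiff_bounded X z k" "k < n \<Longrightarrow> \<exists>l. ddiff_limit X z k l"
proof -
  have b: "ddiff_bounded X z k" if "1 \<le> k" "k \<le> n" for k
    using that(2,1)
  proof (induction k rule: inc_induct)
    case (step k)
    thus ?case using ddiff_bounded_limit ddiff_limit_bounded by (metis le_SucI)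
  qed (rule assms(1))
  show "ddiff_bounded X z k" by (rule b[OF assms(2,3)])
  show "\<exists>l. ddiff_limit X z k l" if "k < n"
    using ddiff_bounded_limit[OF b[of "Suc k"]] that assms by auto
qed

section \<open>Divided differences when the nodes converge to several points\<close>

lemma ddiff_image_split:
  assumes "finite K" "a \<in> K" "b \<in> K" "a \<noteq> b" "inj_on y K"
  shows "ddiff (y ` K) = (ddiff (y ` (K - {a})) - ddiff (y ` (K - {b}))) / (y b - y a)"
proof -
  define S where "S = y ` (K - {a, b})"
  have y: "y a \<noteq> y b" "y a \<notin> S" "y b \<notin> S" "finite S"
    using assms by (auto simp: S_def inj_on_def)
  have "y ` K = insert (y a) (insert (y b) S)" "y ` (K - {a}) = insert (y b) S" "y ` (K - {b}) = insert (y a) S"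
    using assms(2-4) unfolding S_def by auto
  thus ?thesis using ddiff_step[OF y(4,2,3,1)] y(1) by (simp add: field_simps)
qed

text \<open>Nodes with different limits are separated by the recursion for divided differences,
  whose denominator then stays away from 0. What remains are index sets whose nodes all converge to
  one point, where the local hypotheses apply.\<close>

lemma ddiff_cluster_induct:
  assumes const: "\<And>K z. finite K \<Longrightarrow> K \<noteq> {} \<Longrightarrow> card K \<le> N \<Longrightarrow> z \<in> X \<Longrightarrow> (\<forall>i\<in>K. \<mu> i = z) \<Longrightarrow> Q K"
    and split: "\<And>K a b. finite K \<Longrightarrow> a \<in> K \<Longrightarrow> b \<in> K \<Longrightarrow> \<mu> a \<noteq> \<mu> b \<Longrightarrow> Q (K - {a}) \<Longrightarrow> Q (K - {b}) \<Longrightarrow> Q K"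
    and K: "finite (K :: nat set)" "K \<noteq> {}" "card K \<le> N" "\<mu> ` K \<subseteq> (X :: complex set)"
  shows "Q K"
  using K
proof (induction "card K" arbitrary: K rule: less_induct)
  case less
  show ?case
  proof (cases "\<exists>a\<in>K. \<exists>b\<in>K. \<mu> a \<noteq> \<mu> b")
    case True
    then obtain a b where ab: "a \<in> K" "b \<in> K" "\<mu> a \<noteq> \<mu> b" by blast
    have Qc: "Q (K - {c})" if "c \<in> K" "\<exists>e\<in>K. e \<noteq> c" for c
    proof (rule less.hyps)
      show "card (K - {c}) < card K" using that less.prems(1) by (metis card_Diff1_less)
      thus "card (K - {c}) \<le> N" using less.prems(3) by simp
    qed (use that less.prems in auto)
    have ne: "a \<noteq> b" using ab(3) by auto
    have "Q (K - {a})" by (rule Qc[OF ab(1)], rule bexI[of _ b]) (use ne ab in auto)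
    moreover have "Q (K - {b})" by (rule Qc[OF ab(2)], rule bexI[of _ a]) (use ne ab in auto)
    ultimately show ?thesis by (rule split[OF less.prems(1) ab])
  next
    case False
    obtain i where "i \<in> K" using less.prems(2) by blast
    thus ?thesis using const[OF less.prems(1-3), of "\<mu> i"] False less.prems(4) by blast
  qed
qed

definition converging_nodes :: "complex set \<Rightarrow> nat set \<Rightarrow> (nat \<Rightarrow> complex) \<Rightarrow> (nat \<Rightarrow> nat \<Rightarrow> complex) \<Rightarrow> bool" where
  "converging_nodes X K \<mu> x \<longleftrightarrow> (\<forall>m. inj_on (x m) K \<and> x m ` K \<subseteq> X) \<and> (\<forall>i\<in>K. (\<lambda>m. x m i) \<longlonglongrightarrow> \<mu> i)"

lemma converging_nodes_subset: "converging_nodes X K \<mu> x \<Longrightarrow> K' \<subseteq> K \<Longrightarrow> converging_nodes X K' \<mu> x"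
  unfolding converging_nodes_def by (meson image_mono inj_on_subset order_trans subset_iff)

lemma converging_nodes_const:
  assumes "converging_nodes X K \<mu> x" "finite K" "\<forall>i\<in>K. \<mu> i = z" "\<epsilon> > 0"
  shows "\<forall>\<^sub>F m in sequentially. x m ` K \<subseteq> X \<inter> ball z \<epsilon> \<and> card (x m ` K) = card K"
proof -
  have "\<forall>i\<in>K. \<forall>\<^sub>F m in sequentially. dist (x m i) z < \<epsilon>"
    using assms unfolding converging_nodes_def by (auto dest!: bspec intro: tendstoD)
  hence "\<forall>\<^sub>F m in sequentially. \<forall>i\<in>K. dist (x m i) z < \<epsilon>"
    using assms(2) by (simp add: eventually_ball_finite_distrib)
  thus ?thesis
    using assms(1) unfolding converging_nodes_def
    by (elim eventually_mono) (auto simp: dist_commute card_image)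
qed

lemma ddiff_seq_converges:
  assumes "\<And>z k. z \<in> X \<Longrightarrow> 1 \<le> k \<Longrightarrow> k \<le> N \<Longrightarrow> \<exists>l. ddiff_limit X z k l"
    and K: "finite K" "K \<noteq> {}" "card K \<le> N" "\<mu> ` K \<subseteq> X"
  shows "\<exists>L. \<forall>x. converging_nodes X K \<mu> x \<longrightarrow> (\<lambda>m. ddiff (x m ` K)) \<longlonglongrightarrow> L"
  using K
proof (rule ddiff_cluster_induct[rotated 2, where \<mu>=\<mu> and X=X and N=N])
  fix K z assume K: "finite (K :: nat set)" "K \<noteq> {}" "card K \<le> N" "z \<in> X" "\<forall>i\<in>K. \<mu> i = z"
  have "1 \<le> card K" using K by (simp add: Suc_leI card_gt_0_iff)
  then obtain l where l: "ddiff_limit X z (card K) l" using assms(1) K by blast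
  have "(\<lambda>m. ddiff (x m ` K)) \<longlonglongrightarrow> l" if x: "converging_nodes X K \<mu> x" for x
  proof (rule tendstoI)
    fix \<eta> :: real assume "\<eta> > 0"
    then obtain \<epsilon> where \<epsilon>: "\<epsilon> > 0" "\<And>S. S \<subseteq> X \<inter> ball z \<epsilon> \<and> card S = card K \<Longrightarrow> norm (ddiff S - l) < \<eta>"
      using l unfolding ddiff_limit_def by blast
    show "\<forall>\<^sub>F m in sequentially. dist (ddiff (x m ` K)) l < \<eta>"
      using converging_nodes_const[OF x K(1,5) \<epsilon>(1)]
      by (elim eventually_mono) (auto simp: dist_norm intro: \<epsilon>(2))
  qed
  thus "\<exists>L. \<forall>x. converging_nodes X K \<mu> x \<longrightarrow> (\<lambda>m. ddiff (x m ` K)) \<longlonglongrightarrow> L" by blast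
next
  fix K a b assume K: "finite (K :: nat set)" "a \<in> K" "b \<in> K" "\<mu> a \<noteq> \<mu> b"
  assume "\<exists>L. \<forall>x. converging_nodes X (K - {a}) \<mu> x \<longrightarrow> (\<lambda>m. ddiff (x m ` (K - {a}))) \<longlonglongrightarrow> L"
  then obtain L1 where L1: "\<And>x. converging_nodes X (K - {a}) \<mu> x \<Longrightarrow> (\<lambda>m. ddiff (x m ` (K - {a}))) \<longlonglongrightarrow> L1" by blast
  assume "\<exists>L. \<forall>x. converging_nodes X (K - {b}) \<mu> x \<longrightarrow> (\<lambda>m. ddiff (x m ` (K - {b}))) \<longlonglongrightarrow> L"
  then obtain L2 where L2: "\<And>x. converging_nodes X (K - {b}) \<mu> x \<Longrightarrow> (\<lambda>m. ddiff (x m ` (K - {b}))) \<longlonglongrightarrow> L2" by blast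
  have "(\<lambda>m. ddiff (x m ` K)) \<longlonglongrightarrow> (L1 - L2) / (\<mu> b - \<mu> a)" if x: "converging_nodes X K \<mu> x" for x
  proof -
    have "ddiff (x m ` K) = (ddiff (x m ` (K - {a})) - ddiff (x m ` (K - {b}))) / (x m b - x m a)" for m
      by (rule ddiff_image_split) (use K x in \<open>auto simp: converging_nodes_def\<close>)
    moreover have "(\<lambda>m. x m a) \<longlonglongrightarrow> \<mu> a" "(\<lambda>m. x m b) \<longlonglongrightarrow> \<mu> b"
      using x K unfolding converging_nodes_def by auto
    moreover have "(\<lambda>m. ddiff (x m ` (K - {a}))) \<longlonglongrightarrow> L1" "(\<lambda>m. ddiff (x m ` (K - {b}))) \<longlonglongrightarrow> L2"
      using L1 L2 converging_nodes_subset[OF x] by auto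
    ultimately show ?thesis using K(4) by (simp add: tendsto_intros)
  qed
  thus "\<exists>L. \<forall>x. converging_nodes X K \<mu> x \<longrightarrow> (\<lambda>m. ddiff (x m ` K)) \<longlonglongrightarrow> L" by blast
qed

lemma ddiff_seq_bounded:
  assumes "\<And>z k. z \<in> X \<Longrightarrow> 1 \<le> k \<Longrightarrow> k \<le> N \<Longrightarrow> ddiff_bounded X z k"
    and K: "finite K" "K \<noteq> {}" "card K \<le> N" "\<mu> ` K \<subseteq> X"
  shows "\<forall>x. converging_nodes X K \<mu> x \<longrightarrow> Bfun (\<lambda>m. ddiff (x m ` K)) sequentially"
  using K
proof (rule ddiff_cluster_induct[rotated 2, where \<mu>=\<mu> and X=X and N=N])
  fix K z assume K: "finite (K :: nat set)" "K \<noteq> {}" "card K \<le> N" "z \<in> X" "\<forall>i\<in>K. \<mu> i = z"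
  have "1 \<le> card K" using K by (simp add: Suc_leI card_gt_0_iff)
  then obtain \<epsilon> B where B: "\<epsilon> > 0" "\<And>S. S \<subseteq> X \<inter> ball z \<epsilon> \<and> card S = card K \<Longrightarrow> norm (ddiff S) \<le> B"
    using assms(1) K unfolding ddiff_bounded_def by blast
  show "\<forall>x. converging_nodes X K \<mu> x \<longrightarrow> Bfun (\<lambda>m. ddiff (x m ` K)) sequentially"
  proof (intro allI impI)
    fix x assume x: "converging_nodes X K \<mu> x"
    show "Bfun (\<lambda>m. ddiff (x m ` K)) sequentially"
      by (rule BfunI[of _ B], rule eventually_mono[OF converging_nodes_const[OF x K(1,5) B(1)]]) (auto intro: B(2))
  qed
next
  fix K a b assume K: "finite (K :: nat set)" "a \<in> K" "b \<in> K" "\<mu> a \<noteq> \<mu> b"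
  assume 1: "\<forall>x. converging_nodes X (K - {a}) \<mu> x \<longrightarrow> Bfun (\<lambda>m. ddiff (x m ` (K - {a}))) sequentially"
  assume 2: "\<forall>x. converging_nodes X (K - {b}) \<mu> x \<longrightarrow> Bfun (\<lambda>m. ddiff (x m ` (K - {b}))) sequentially"
  show "\<forall>x. converging_nodes X K \<mu> x \<longrightarrow> Bfun (\<lambda>m. ddiff (x m ` K)) sequentially"
  proof (intro allI impI)
    fix x assume x: "converging_nodes X K \<mu> x"
    have e: "ddiff (x m ` K) = (ddiff (x m ` (K - {a})) - ddiff (x m ` (K - {b}))) * inverse (x m b - x m a)" for m
      unfolding divide_inverse[symmetric]
      by (rule ddiff_image_split) (use K x in \<open>auto simp: converging_nodes_def\<close>)
    have "(\<lambda>m. x m a) \<longlonglongrightarrow> \<mu> a" "(\<lambda>m. x m b) \<longlonglongrightarrow> \<mu> b"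
      using x K unfolding converging_nodes_def by auto
    hence "(\<lambda>m. inverse (x m b - x m a)) \<longlonglongrightarrow> inverse (\<mu> b - \<mu> a)"
      using K(4) by (intro tendsto_intros) auto
    hence i: "Bseq (\<lambda>m. inverse (x m b - x m a))" using convergentI convergent_imp_Bseq by blast
    have "Bseq (\<lambda>m. ddiff (x m ` (K - {a})))" "Bseq (\<lambda>m. ddiff (x m ` (K - {b})))"
      using 1 2 converging_nodes_subset[OF x] by (simp_all add: Diff_subset)
    hence "Bseq (\<lambda>m. ddiff (x m ` (K - {a})) - ddiff (x m ` (K - {b})))"
      unfolding Bseq_def by (meson add_mono add_pos_pos norm_triangle_ineq4 order_trans)
    thus "Bfun (\<lambda>m. ddiff (x m ` K)) sequentially" unfolding e using Bseq_mult[OF _ i] by simp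
  qed
qed

section \<open>From node sets back to configuration spaces\<close>

lemma tendsto_coordinatewise:
  fixes f :: "'b \<Rightarrow> nat \<Rightarrow> complex"
  shows "(f \<longlongrightarrow> l) F \<longleftrightarrow> (\<forall>i. ((\<lambda>c. f c i) \<longlongrightarrow> l i) F)"
  using limitin_componentwise[of "\<lambda>_. euclidean" UNIV f l F]
  by (simp add: euclidean_product_topology)

lemma config_space_enumerates:
  assumes "S \<subseteq> X" "card S = n" "n \<ge> 1"
  shows "\<exists>x\<in>config_space n X. x ` {..<n} = S"
proof -
  have "finite S" using assms card_ge_0_finite[of S] by simp
  then obtain h where h: "bij_betw h {0..<n} S" using ex_bij_betw_nat_finite assms(2) by blast
  let ?x = "\<lambda>k\<in>{..<n}. h k"
  have im: "?x ` {..<n} = S" using h by (auto simp: bij_betw_def atLeast0LessThan)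
  have "inj_on ?x {..<n}" using h by (auto simp: bij_betw_def inj_on_def)
  moreover have "?x \<in> {..<n} \<rightarrow>\<^sub>E X" using im assms(1) by (auto simp: image_subset_iff)
  ultimately show ?thesis using im by (intro bexI[of _ ?x]) (auto simp: config_space_def)
qed

lemma shrinking_nodes:
  assumes S: "\<And>m. S m \<subseteq> X \<inter> ball z (1 / real (Suc m))" "\<And>m. card (S m) = n" and n: "n \<ge> 1"
  obtains x where "\<forall>m. x m \<in> config_space n X \<and> x m ` {..<n} = S m" "x \<longlonglongrightarrow> diagonal_point n z"
    "\<forall>i<n. (\<lambda>m. x m i) \<longlonglongrightarrow> z"
proof -
  have "\<forall>m. \<exists>x. x \<in> config_space n X \<and> x ` {..<n} = S m"
    using config_space_enumerates[OF _ S(2) n] S(1) by blast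
  then obtain x where x: "\<And>m. x m \<in> config_space n X" "\<And>m. x m ` {..<n} = S m" by metis
  have lim: "(\<lambda>m. x m i) \<longlonglongrightarrow> z" if "i < n" for i
  proof (subst tendsto_dist_iff, rule tendsto_sandwich[OF _ _ tendsto_const LIMSEQ_inverse_real_of_nat])
    have mem: "x m i \<in> S m" for m using x(2) that by blast
    have "dist (x m i) z < inverse (real (Suc m))" for m
      using subsetD[OF S(1) mem, of m] by (simp add: dist_commute inverse_eq_divide del: of_nat_Suc)
    thus "\<forall>\<^sub>F m in sequentially. dist (x m i) z \<le> inverse (real (Suc m))" by (simp add: less_imp_le)
  qed auto
  have "(\<lambda>m. x m i) \<longlonglongrightarrow> diagonal_point n z i" for i
  proof (cases "i < n")
    case False
    \<comment> \<open>Outside the first n indices both the configurations and the diagonal point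
      take the default value, so convergence there is trivial.\<close>
    hence "x m i = undefined" for m using x(1)[of m] by (auto simp: config_space_def PiE_def extensional_def)
    thus ?thesis using False by (simp add: diagonal_point_def)
  qed (simp add: diagonal_point_def lim)
  hence "x \<longlonglongrightarrow> diagonal_point n z" by (simp add: tendsto_coordinatewise)
  thus ?thesis using that[of x] x lim by blast
qed

lemma not_ddiff_limit_seq:
  assumes "\<not> ddiff_limit X z k l"
  obtains \<eta> S where "\<eta> > 0" "\<forall>m. S m \<subseteq> X \<inter> ball z (1 / real (Suc m))" "\<forall>m. card (S m) = k"
    "\<forall>m. \<not> norm (ddiff (S m) - l) < \<eta>"
proof -
  have "\<exists>\<eta>>0. \<forall>m. \<exists>S. S \<subseteq> X \<inter> ball z (1 / real (Suc m)) \<and> card S = k \<and> \<not> norm (ddiff S - l) < \<eta>"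
  proof (rule ccontr)
    assume n: "\<not> ?thesis"
    have "ddiff_limit X z k l" unfolding ddiff_limit_def
    proof (intro allI impI)
      fix \<eta> :: real assume "\<eta> > 0"
      hence "\<exists>m. \<not> (\<exists>S. S \<subseteq> X \<inter> ball z (1 / real (Suc m)) \<and> card S = k \<and> \<not> norm (ddiff S - l) < \<eta>)"
        using n by metis
      then obtain m where m: "\<forall>S. S \<subseteq> X \<inter> ball z (1 / real (Suc m)) \<and> card S = k \<longrightarrow> norm (ddiff S - l) < \<eta>"
        by metis
      show "\<exists>\<epsilon>>0. \<forall>S. S \<subseteq> X \<inter> ball z \<epsilon> \<and> card S = k \<longrightarrow> norm (ddiff S - l) < \<eta>"
        by (rule exI[of _ "1 / real (Suc m)"], rule conjI[OF _ m]) simp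
    qed
    thus False using assms by contradiction
  qed
  then obtain \<eta> where \<eta>: "\<eta> > 0"
    "\<forall>m. \<exists>S. S \<subseteq> X \<inter> ball z (1 / real (Suc m)) \<and> card S = k \<and> \<not> norm (ddiff S - l) < \<eta>"
    by (elim exE conjE) (rule that)
  from choice[OF \<eta>(2)] obtain S where
    "\<forall>m. S m \<subseteq> X \<inter> ball z (1 / real (Suc m)) \<and> card (S m) = k \<and> \<not> norm (ddiff (S m) - l) < \<eta>" ..
  thus ?thesis using that[of \<eta> S] \<eta>(1) by simp
qed

lemma open_coordinate_ball: "open {x :: nat \<Rightarrow> complex. \<forall>i<n. x i \<in> ball z \<epsilon>}"
proof -
  have "{x :: nat \<Rightarrow> complex. \<forall>i<n. x i \<in> ball z \<epsilon>} = (\<Inter>i\<in>{..<n}. (\<lambda>x. x i) -` ball z \<epsilon>)" by auto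
  moreover have "open ((\<lambda>x :: nat \<Rightarrow> complex. x i) -` ball z \<epsilon>)" for i
    by (intro open_vimage open_ball continuous_on_product_coordinates)
  ultimately show ?thesis by (simp add: open_INT)
qed

lemma config_space_coordinate_ball:
  assumes "x \<in> config_space n X" "\<forall>i<n. x i \<in> ball z \<epsilon>"
  shows "x ` {..<n} \<subseteq> X \<inter> ball z \<epsilon>" "card (x ` {..<n}) = n"
  using assms by (auto simp: config_space_def card_image PiE_iff)

lemma locally_bounded_iff:
  assumes n: "n \<ge> 1"
  shows "Delta_cnj_locally_bounded n X \<longleftrightarrow> (\<forall>z\<in>X. ddiff_bounded X z n)"
proof
  assume lb: "Delta_cnj_locally_bounded n X"
  show "\<forall>z\<in>X. ddiff_bounded X z n"
  proof (rule ballI, rule ccontr)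
    fix z assume z: "z \<in> X" and nb: "\<not> ddiff_bounded X z n"
    have "\<forall>m. \<exists>S. S \<subseteq> X \<inter> ball z (1 / real (Suc m)) \<and> card S = n \<and> norm (ddiff S) > real m"
    proof
      fix m
      show "\<exists>S. S \<subseteq> X \<inter> ball z (1 / real (Suc m)) \<and> card S = n \<and> norm (ddiff S) > real m"
        using nb unfolding ddiff_bounded_def not_ex not_all not_le de_Morgan_conj not_imp
        by (metis (no_types, lifting) divide_pos_pos not_le of_nat_0_less_iff zero_less_Suc zero_less_one)
    qed
    then obtain S where S: "\<And>m. S m \<subseteq> X \<inter> ball z (1 / real (Suc m))" "\<And>m. card (S m) = n"
      "\<And>m. norm (ddiff (S m)) > real m" by metis
    obtain x where x: "\<forall>m. x m \<in> config_space n X \<and> x m ` {..<n} = S m" "x \<longlonglongrightarrow> diagonal_point n z"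
      using shrinking_nodes[OF S(1,2) n] by metis
    obtain U where U: "open U" "diagonal_point n z \<in> U" "bounded (Delta_cnj n ` (U \<inter> config_space n X))"
      using lb z unfolding Delta_cnj_locally_bounded_def by blast
    then obtain B where B: "\<And>y. y \<in> U \<Longrightarrow> y \<in> config_space n X \<Longrightarrow> norm (Delta_cnj n y) \<le> B"
      unfolding bounded_iff by auto
    have "\<forall>\<^sub>F m in sequentially. x m \<in> U" using x(2) U(1,2) by (rule topological_tendstoD)
    hence "\<forall>\<^sub>F m in sequentially. real m < B"
    proof (rule eventually_mono)
      fix m assume "x m \<in> U"
      hence "norm (ddiff (S m)) \<le> B"
        using B[of "x m"] x(1) Delta_cnj_eq_ddiff[of "x m" n X] n by metis
      thus "real m < B" using S(3)[of m] by linarith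
    qed
    moreover have "\<forall>\<^sub>F m in sequentially. real m \<ge> B"
      using eventually_ge_at_top[of "nat \<lceil>B\<rceil>"] by (rule eventually_mono) linarith
    ultimately have "\<forall>\<^sub>F m in sequentially. False" by (rule eventually_elim2) auto
    thus False by simp
  qed
next
  assume b: "\<forall>z\<in>X. ddiff_bounded X z n"
  show "Delta_cnj_locally_bounded n X" unfolding Delta_cnj_locally_bounded_def
  proof
    fix z assume "z \<in> X"
    hence "ddiff_bounded X z n" using b by blast
    then obtain \<epsilon> K where \<epsilon>: "\<epsilon> > 0" "\<And>S. S \<subseteq> X \<inter> ball z \<epsilon> \<Longrightarrow> card S = n \<Longrightarrow> norm (ddiff S) \<le> K"
      unfolding ddiff_bounded_def by metis
    let ?U = "{x :: nat \<Rightarrow> complex. \<forall>i<n. x i \<in> ball z \<epsilon>}"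
    have "norm (Delta_cnj n x) \<le> K" if "x \<in> ?U \<inter> config_space n X" for x
      using \<epsilon>(2) config_space_coordinate_ball[of x n X z \<epsilon>] that Delta_cnj_eq_ddiff[of x n X] n by auto
    hence "bounded (Delta_cnj n ` (?U \<inter> config_space n X))" unfolding bounded_iff by blast
    moreover have "diagonal_point n z \<in> ?U" using \<epsilon>(1) by (simp add: diagonal_point_def)
    ultimately show "\<exists>U. open U \<and> diagonal_point n z \<in> U \<and> bounded (Delta_cnj n ` (U \<inter> config_space n X))"
      using open_coordinate_ball by blast
  qed
qed

lemma has_limits_iff:
  assumes n: "n \<ge> 2"
  shows "Delta_cnj_has_limits n X \<longleftrightarrow> (\<forall>z\<in>X. \<exists>l. ddiff_limit X z n l)"
proof
  assume hl: "Delta_cnj_has_limits n X"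
  show "\<forall>z\<in>X. \<exists>l. ddiff_limit X z n l"
  proof
    fix z assume z: "z \<in> X"
    then obtain l where l: "(Delta_cnj n \<longlongrightarrow> l) (at (diagonal_point n z) within config_space n X)"
      using hl unfolding Delta_cnj_has_limits_def by blast
    have "ddiff_limit X z n l"
    proof (rule ccontr)
      assume "\<not> ddiff_limit X z n l"
      then obtain \<eta> S where \<eta>: "\<eta> > 0" and S': "\<forall>m. S m \<subseteq> X \<inter> ball z (1 / real (Suc m))"
        "\<forall>m. card (S m) = n" "\<forall>m. \<not> norm (ddiff (S m) - l) < \<eta>" by (rule not_ddiff_limit_seq)
      note S = S'[rule_format]
      obtain x where x: "\<forall>m. x m \<in> config_space n X \<and> x m ` {..<n} = S m" "x \<longlonglongrightarrow> diagonal_point n z"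
        using shrinking_nodes[OF S(1,2)] n by (metis one_le_numeral order_trans)
      \<comment> \<open>The filter \<open>at\<close> excludes its base point; a configuration of at
        least two distinct nodes never equals the diagonal point.\<close>
      have "x m \<noteq> diagonal_point n z" for m
      proof
        assume e: "x m = diagonal_point n z"
        have i: "inj_on (x m) {..<n}" using x(1) by (simp add: config_space_def)
        have "x m 0 = x m 1" using n unfolding e by (simp add: diagonal_point_def)
        thus False using n inj_onD[OF i, of 0 1] by simp
      qed
      hence "filterlim x (at (diagonal_point n z) within config_space n X) sequentially"
        using x by (simp add: filterlim_at)
      hence "(\<lambda>m. Delta_cnj n (x m)) \<longlonglongrightarrow> l" by (rule filterlim_compose[OF l])
      hence "\<forall>\<^sub>F m in sequentially. dist (Delta_cnj n (x m)) l < \<eta>" using \<eta>(1) by (rule tendstoD)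
      then obtain m where "dist (Delta_cnj n (x m)) l < \<eta>" by (auto simp: eventually_sequentially)
      moreover have "Delta_cnj n (x m) = ddiff (S m)" using Delta_cnj_eq_ddiff[of "x m" n X] x(1) n by simp
      ultimately show False using S(3)[of m] by (simp add: dist_norm)
    qed
    thus "\<exists>l. ddiff_limit X z n l" ..
  qed
next
  assume h: "\<forall>z\<in>X. \<exists>l. ddiff_limit X z n l"
  show "Delta_cnj_has_limits n X" unfolding Delta_cnj_has_limits_def
  proof
    fix z assume "z \<in> X"
    then obtain l where l: "ddiff_limit X z n l" using h by blast
    have "(Delta_cnj n \<longlongrightarrow> l) (at (diagonal_point n z) within config_space n X)"
    proof (rule tendstoI)
      fix \<eta> :: real assume "\<eta> > 0"
      then obtain \<epsilon> where \<epsilon>: "\<epsilon> > 0" "\<And>S. S \<subseteq> X \<inter> ball z \<epsilon> \<Longrightarrow> card S = n \<Longrightarrow> norm (ddiff S - l) < \<eta>"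
        using l unfolding ddiff_limit_def by metis
      let ?U = "{x :: nat \<Rightarrow> complex. \<forall>i<n. x i \<in> ball z \<epsilon>}"
      have "dist (Delta_cnj n x) l < \<eta>" if "x \<in> ?U" "x \<in> config_space n X" for x
        using \<epsilon>(2) config_space_coordinate_ball[of x n X z \<epsilon>] that Delta_cnj_eq_ddiff[of x n X] n
        by (auto simp: dist_norm)
      moreover have "diagonal_point n z \<in> ?U" using \<epsilon>(1) by (simp add: diagonal_point_def)
      ultimately show "\<forall>\<^sub>F x in at (diagonal_point n z) within config_space n X. dist (Delta_cnj n x) l < \<eta>"
        unfolding eventually_at_topological using open_coordinate_ball by blast
    qed
    thus "\<exists>l. (Delta_cnj n \<longlongrightarrow> l) (at (diagonal_point n z) within config_space n X)" ..
  qed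
qed

section \<open>Continuity of \<open>\<Phi>\<close>\<close>

fun newton_prod :: "complex^'n^'n \<Rightarrow> (nat \<Rightarrow> complex) \<Rightarrow> nat \<Rightarrow> complex^'n^'n" where
  "newton_prod A x 0 = mat 1"
| "newton_prod A x (Suc j) = newton_prod A x j ** (A - mat (x j))"

lemma newton_prod_conjug:
  assumes "invertible P"
  shows "newton_prod (conjug P (diagm d)) x j = conjug P (diagm (\<lambda>k. \<Prod>i<j. d k - x i))"
proof (induction j)
  case (Suc j)
  have "conjug P (diagm d) - mat (x j) = conjug P (diagm d - mat (x j))"
    using assms by (simp add: conjug_diff)
  also have "\<dots> = conjug P (diagm (\<lambda>k. d k - x j))" by (simp add: diagm_const[symmetric] diagm_diff)
  finally show ?case using Suc assms by (simp add: conjug_mult[symmetric] diagm_mult)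
qed (use assms in \<open>simp add: diagm_const\<close>)

lemma tendsto_newton_prod:
  assumes "(A \<longlongrightarrow> A0) F" "\<And>i. i < j \<Longrightarrow> ((\<lambda>m. x m i) \<longlongrightarrow> x0 i) F"
  shows "((\<lambda>m. newton_prod (A m) (x m) j) \<longlongrightarrow> newton_prod A0 x0 j) F"
  using assms(2) by (induction j) (auto intro!: tendsto_intros assms(1))

lemma newton_prod_commute: "A ** B = B ** A \<Longrightarrow> newton_prod A x j ** B = B ** newton_prod A x j"
proof (induction j)
  case (Suc j)
  have "(A - mat (x j)) ** B = B ** (A - mat (x j))"
    using Suc.prems by (simp add: matrix_distribs mat_commute)
  thus ?case using Suc by (metis matrix_mul_assoc newton_prod.simps(2))
qed simp

text \<open>Newton interpolation is transported to a diagonalizable matrix eigenvalue by eigenvalue.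
  Once the nodes used contain all eigenvalues, the product annihilates every eigenspace; the second
  claim later neutralizes coefficients that are only bounded.\<close>

lemma newton_matrix:
  assumes P: "invertible P" and x: "inj_on x {..<r}" and d: "\<And>k. d k \<in> x ` {..<r}"
  shows "conjug P (diagm (\<lambda>k. cnj (d k))) = (\<Sum>j<r. mat (ddiff (x ` {..j})) ** newton_prod (conjug P (diagm d)) x j)"
    and "j \<ge> r \<Longrightarrow> newton_prod (conjug P (diagm d)) x j = 0"
proof -
  have c: "cnj (d k) = (\<Sum>j<r. ddiff (x ` {..j}) * (\<Prod>i<j. d k - x i))" for k
    using d[of k] newton_interpolation[OF x] by auto
  have "(\<Sum>j<r. mat (ddiff (x ` {..j})) ** newton_prod (conjug P (diagm d)) x j) =
      conjug P (\<Sum>j<r. mat (ddiff (x ` {..j})) ** diagm (\<lambda>k. \<Prod>i<j. d k - x i))"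
    using P by (simp add: newton_prod_conjug conjug_sum conjug_smult)
  also have "(\<Sum>j<r. mat (ddiff (x ` {..j})) ** diagm (\<lambda>k. \<Prod>i<j. d k - x i)) = diagm (\<lambda>k. cnj (d k))"
    by (auto simp: vec_eq_iff mat_mult_nth diagm_nth c)
  finally show "conjug P (diagm (\<lambda>k. cnj (d k))) =
      (\<Sum>j<r. mat (ddiff (x ` {..j})) ** newton_prod (conjug P (diagm d)) x j)" by simp
  assume j: "j \<ge> r"
  have pz: "(\<Prod>i<j. d k - x i) = 0" for k
    using d[of k] j by (auto intro!: prod_zero)
  have "newton_prod (conjug P (diagm d)) x j = conjug P (diagm (\<lambda>_. 0))"
    by (simp only: newton_prod_conjug[OF P] pz)
  thus "newton_prod (conjug P (diagm d)) x j = 0" by (simp add: diagm_const)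
qed

section \<open>Matrices with simple spectrum and limits of their eigenvalues\<close>

definition simple_spec :: "complex set \<Rightarrow> (complex^'n^'n) set" where
  "simple_spec X = {A. \<exists>P d. invertible P \<and> inj d \<and> range d \<subseteq> X \<and> A = conjug P (diagm d)}"

lemma simple_spec_subset: "simple_spec X \<subseteq> spec_semisimple X"
  unfolding simple_spec_def using spec_semisimple_iff by blast

lemma spec_semisimple_subset: "spec_semisimple X \<subseteq> spec_all X"
  unfolding spec_semisimple_def spec_all_def by auto

lemma eigenvalue_bound:
  fixes A :: "complex^'n^'n"
  assumes "A *v v = c *s v" "v \<noteq> 0"
  shows "norm c \<le> (\<Sum>i\<in>UNIV. \<Sum>j\<in>UNIV. norm (A $ i $ j))"
proof -
  have "\<exists>i. \<forall>j. norm (v $ j) \<le> norm (v $ i)"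
  proof -
    have "Max (range (\<lambda>j. norm (v $ j))) \<in> range (\<lambda>j. norm (v $ j))" by (rule Max_in) auto
    then obtain i where "Max (range (\<lambda>j. norm (v $ j))) = norm (v $ i)" by (metis rangeE)
    thus ?thesis by (metis Max_ge finite_class.finite_UNIV finite_imageI rangeI)
  qed
  then obtain i where i: "\<And>j. norm (v $ j) \<le> norm (v $ i)" by blast
  have vi: "norm (v $ i) > 0"
  proof (rule ccontr)
    assume "\<not> norm (v $ i) > 0"
    hence "norm (v $ j) \<le> 0" for j using i[of j] by simp
    thus False using assms(2) by (simp add: vec_eq_iff)
  qed
  have "norm c * norm (v $ i) = norm ((A *v v) $ i)" by (simp add: assms(1) norm_mult)
  also have "\<dots> \<le> (\<Sum>j\<in>UNIV. norm (A $ i $ j * v $ j))"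
    unfolding matrix_vector_mult_def by (simp add: norm_sum)
  also have "\<dots> \<le> (\<Sum>j\<in>UNIV. norm (A $ i $ j) * norm (v $ i))"
    by (intro sum_mono) (simp add: norm_mult mult_left_mono i)
  also have "\<dots> = (\<Sum>j\<in>UNIV. norm (A $ i $ j)) * norm (v $ i)" by (simp add: sum_distrib_right)
  finally have "norm c \<le> (\<Sum>j\<in>UNIV. norm (A $ i $ j))" using vi by simp
  also have "\<dots> \<le> (\<Sum>i\<in>UNIV. \<Sum>j\<in>UNIV. norm (A $ i $ j))"
    by (rule member_le_sum) (auto intro: sum_nonneg)
  finally show ?thesis .
qed

lemma tendsto_det:
  assumes "(A \<longlongrightarrow> (A0 :: complex^'n^'n)) F" shows "((\<lambda>m. det (A m)) \<longlongrightarrow> det A0) F"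
  unfolding det_def by (intro tendsto_intros assms)

text \<open>The eigenvalues of a convergent sequence are bounded, so a subsequence of them converges
  as an n-tuple; continuity of the characteristic polynomial identifies the limits with
  multiplicities.\<close>

lemma eigenvalues_subsequence:
  fixes A :: "nat \<Rightarrow> complex^'n^'n"
  assumes A: "A \<longlonglongrightarrow> A0" and P: "\<And>m. invertible (P m)" "\<And>m. A m = conjug (P m) (diagm (d m))"
  shows "\<exists>r e. strict_mono r \<and> (\<forall>i. (\<lambda>m. d (r m) i) \<longlonglongrightarrow> e i) \<and> (\<forall>z. det (mat z - A0) = (\<Prod>i\<in>UNIV. z - e i))"
proof -
  have "(\<lambda>m. \<Sum>i\<in>UNIV. \<Sum>j\<in>UNIV. norm (A m $ i $ j)) \<longlonglongrightarrow> (\<Sum>i\<in>UNIV. \<Sum>j\<in>UNIV. norm (A0 $ i $ j))"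
    by (intro tendsto_intros A)
  hence "Bseq (\<lambda>m. \<Sum>i\<in>UNIV. \<Sum>j\<in>UNIV. norm (A m $ i $ j))" using convergentI convergent_imp_Bseq by blast
  then obtain B where B: "\<And>m. norm (\<Sum>i\<in>UNIV. \<Sum>j\<in>UNIV. norm (A m $ i $ j)) \<le> B"
    unfolding Bseq_def by blast
  have dB: "norm (d m i) \<le> B" for m i
  proof -
    have "d m i \<in> matrix_spectrum (A m)" using P by (simp add: spectrum_conjug_diagm)
    then obtain v where "v \<noteq> 0" "A m *v v = d m i *s v" by (auto simp: matrix_spectrum_def)
    hence "norm (d m i) \<le> (\<Sum>i\<in>UNIV. \<Sum>j\<in>UNIV. norm (A m $ i $ j))" using eigenvalue_bound by blast
    also have "\<dots> \<le> norm (\<Sum>i\<in>UNIV. \<Sum>j\<in>UNIV. norm (A m $ i $ j))" by simp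
    finally show ?thesis using B[of m] by linarith
  qed
  define D where "D m = (\<chi> i. d m i)" for m
  have "norm (D m) \<le> CARD('n) * B" for m
  proof -
    have "norm (D m) \<le> (\<Sum>i\<in>UNIV. norm (D m $ i))" unfolding norm_vec_def by (rule L2_set_le_sum) simp
    also have "\<dots> \<le> (\<Sum>i\<in>(UNIV :: 'n set). B)" by (intro sum_mono) (simp add: D_def dB)
    finally show ?thesis by simp
  qed
  hence "bounded (range D)" unfolding bounded_iff by blast
  then obtain e r where r: "strict_mono (r :: nat \<Rightarrow> nat)" "(D \<circ> r) \<longlonglongrightarrow> e"
    using bounded_imp_convergent_subsequence by blast
  have lim: "(\<lambda>m. d (r m) i) \<longlonglongrightarrow> e $ i" for i
    using tendsto_vec_nth[OF r(2), of i] by (simp add: D_def o_def)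
  have Ar: "(\<lambda>m. A (r m)) \<longlonglongrightarrow> A0" using LIMSEQ_subseq_LIMSEQ[OF A r(1)] by (simp add: o_def)
  have "det (mat z - A0) = (\<Prod>i\<in>UNIV. z - e $ i)" for z
  proof (rule LIMSEQ_unique)
    show "(\<lambda>m. det (mat z - A (r m))) \<longlonglongrightarrow> det (mat z - A0)"
      by (intro tendsto_det tendsto_intros Ar)
    have "det (mat z - A (r m)) = (\<Prod>i\<in>UNIV. z - d (r m) i)" for m
      unfolding P(2) using P(1) by (simp add: det_conjug det_char_diagm)
    thus "(\<lambda>m. det (mat z - A (r m))) \<longlonglongrightarrow> (\<Prod>i\<in>UNIV. z - e $ i)"
      by (simp add: tendsto_prod tendsto_diff lim)
  qed
  thus ?thesis using r(1) lim by (intro exI[of _ r] exI[of _ "\<lambda>i. e $ i"]) auto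
qed

lemma tendsto_subsequence_principle:
  fixes f :: "nat \<Rightarrow> 'a::metric_space"
  assumes "\<And>r :: nat \<Rightarrow> nat. strict_mono r \<Longrightarrow> \<exists>r' :: nat \<Rightarrow> nat. strict_mono r' \<and> (\<lambda>m. f (r (r' m))) \<longlonglongrightarrow> L"
  shows "f \<longlonglongrightarrow> L"
proof (rule ccontr)
  assume "\<not> f \<longlonglongrightarrow> L"
  then obtain \<epsilon> where \<epsilon>: "\<epsilon> > 0" "\<exists>\<^sub>F m in sequentially. \<not> dist (f m) L < \<epsilon>"
    unfolding tendsto_iff not_all not_imp not_eventually by blast
  hence "infinite {m. \<not> dist (f m) L < \<epsilon>}"
    using frequently_cofinite[of "\<lambda>m. \<not> dist (f m) L < \<epsilon>"] by (simp add: cofinite_eq_sequentially)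
  then obtain r :: "nat \<Rightarrow> nat" where r: "strict_mono r" "\<And>m. r m \<in> {m. \<not> dist (f m) L < \<epsilon>}"
    using infinite_enumerate by blast
  obtain r' where r': "strict_mono r'" "(\<lambda>m. f (r (r' m))) \<longlonglongrightarrow> L" using assms[OF r(1)] by blast
  have "\<forall>\<^sub>F m in sequentially. dist (f (r (r' m))) L < \<epsilon>" using r'(2) \<epsilon>(1) by (rule tendstoD)
  then obtain m where "dist (f (r (r' m))) L < \<epsilon>" by (auto simp: eventually_sequentially)
  thus False using r(2)[of "r' m"] by simp
qed

text \<open>An ordering of the eigenvalue indices for Newton interpolation. One index for each
  distinct value comes first, so that from position \<open>r\<close> on the limiting Newton products
  of a diagonalizable matrix vanish.\<close>

lemma representatives_first:
  fixes e :: "'n::finite \<Rightarrow> 'a"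
  shows "\<exists>g r. bij_betw g {..<CARD('n)} UNIV \<and> r \<le> CARD('n) \<and> inj_on (\<lambda>k. e (g k)) {..<r} \<and>
    (\<lambda>k. e (g k)) ` {..<r} = range e"
proof -
  obtain R where R: "inj_on e R" "range e = e ` R"
    using subset_image_inj[of "range e" e UNIV] by auto
  have cR: "card R \<le> CARD('n)" by (simp add: card_mono)
  obtain h1 where h1: "bij_betw h1 {0..<card R} R" using ex_bij_betw_nat_finite[of R] by auto
  obtain h2 where h2: "bij_betw h2 {0..<card (- R)} (- R)" using ex_bij_betw_nat_finite[of "- R"] by auto
  define g where "g k = (if k < card R then h1 k else h2 (k - card R))" for k
  have "bij_betw h1 {..<card R} R" using h1 by (simp add: atLeast0LessThan)
  hence g1: "bij_betw g {..<card R} R"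
    by (rule bij_betw_cong[THEN iffD1, rotated]) (simp add: g_def)
  have "bij_betw (\<lambda>k. k - card R) {card R..<CARD('n)} {0..<card (- R)}"
    by (rule bij_betw_byWitness[of _ "\<lambda>k. k + card R"]) (auto simp: Compl_eq_Diff_UNIV card_Diff_subset)
  hence "bij_betw (h2 \<circ> (\<lambda>k. k - card R)) {card R..<CARD('n)} (- R)" using h2 by (rule bij_betw_trans)
  hence g2: "bij_betw g {card R..<CARD('n)} (- R)"
    by (rule bij_betw_cong[THEN iffD1, rotated]) (simp add: g_def)
  have "bij_betw g ({..<card R} \<union> {card R..<CARD('n)}) (R \<union> - R)"
    by (rule bij_betw_combine[OF g1 g2]) auto
  moreover have "{..<card R} \<union> {card R..<CARD('n)} = {..<CARD('n)}" using cR by auto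
  ultimately have "bij_betw g {..<CARD('n)} UNIV" by simp
  moreover have "inj_on (\<lambda>k. e (g k)) {..<card R}"
    using g1 R(1) comp_inj_on[of g "{..<card R}" e] by (simp add: bij_betw_def o_def)
  moreover have "(\<lambda>k. e (g k)) ` {..<card R} = range e"
    using g1 R(2) by (metis bij_betw_def image_image)
  ultimately show ?thesis using cR by blast
qed

lemma nodes_of_bijection:
  assumes g: "bij_betw g {..<CARD('n)} (UNIV :: 'n::finite set)" and d: "\<And>m. inj (d m)" "\<And>m. range (d m) \<subseteq> X"
    and lim: "\<And>i. (\<lambda>m. d m i) \<longlonglongrightarrow> e i" and K: "K \<subseteq> {..<CARD('n)}"
  shows "converging_nodes X K (\<lambda>k. e (g k)) (\<lambda>m k. d m (g k))"
proof -
  have "inj_on g K" using g K inj_on_subset unfolding bij_betw_def by blast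
  hence "inj_on (\<lambda>k. d m (g k)) K" for m
    using d(1)[of m] by (auto simp: inj_on_def)
  moreover have "d m k \<in> X" for m k using d(2) by blast
  ultimately show ?thesis unfolding converging_nodes_def using lim by auto
qed

lemma Phi_star_newton:
  assumes g: "bij_betw g {..<CARD('n)} (UNIV :: 'n::finite set)" and d: "inj d" and P: "invertible (P :: complex^'n^'n)"
  shows "conj_transpose (Phi (conjug P (diagm d))) =
    (\<Sum>j<CARD('n). mat (ddiff ((\<lambda>k. d (g k)) ` {..j})) ** newton_prod (conjug P (diagm d)) (\<lambda>k. d (g k)) j)"
proof -
  have "inj_on (\<lambda>k. d (g k)) {..<CARD('n)}" using g d by (auto simp: bij_betw_def inj_on_def)
  moreover have "d i \<in> (\<lambda>k. d (g k)) ` {..<CARD('n)}" for i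
    using g unfolding bij_betw_def by (metis UNIV_I image_iff)
  ultimately show ?thesis using P by (simp add: Phi_conjug_diagm newton_matrix(1))
qed

text \<open>With the limits of the nodes ordered by representatives, the coefficients of order below
  \<open>q\<close> have distinct limit nodes and converge. The later ones are only bounded, but
  multiply Newton products that tend to 0 because the limit matrix is diagonalizable.\<close>

lemma Phi_tendsto_semisimple:
  fixes A :: "nat \<Rightarrow> complex^'n^'n"
  assumes bd: "\<And>z k. z \<in> X \<Longrightarrow> 1 \<le> k \<Longrightarrow> k \<le> CARD('n) \<Longrightarrow> ddiff_bounded X z k"
    and A: "A \<longlonglongrightarrow> A0" "\<And>m. A m \<in> simple_spec X" "A0 \<in> spec_semisimple X"
  shows "(\<lambda>m. Phi (A m)) \<longlonglongrightarrow> Phi A0"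
proof (rule tendsto_subsequence_principle)
  have key: "\<exists>r. strict_mono r \<and> (\<lambda>m. Phi (A (r m))) \<longlonglongrightarrow> Phi A0"
    if A: "A \<longlonglongrightarrow> A0" "\<And>m. A m \<in> simple_spec X" for A :: "nat \<Rightarrow> complex^'n^'n"
  proof -
    have "\<forall>m. \<exists>P d. invertible P \<and> inj d \<and> range d \<subseteq> X \<and> A m = conjug P (diagm d)"
      using A(2) unfolding simple_spec_def by blast
    then obtain P d where Pd: "\<And>m. invertible (P m)" "\<And>m. inj (d m)" "\<And>m. range (d m) \<subseteq> X"
      "\<And>m. A m = conjug (P m) (diagm (d m))" by metis
    obtain r e where r: "strict_mono r" "\<And>i. (\<lambda>m. d (r m) i) \<longlonglongrightarrow> e i" "\<And>z. det (mat z - A0) = (\<Prod>i\<in>UNIV. z - e i)"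
      using eigenvalues_subsequence[OF A(1) Pd(1,4)] by metis
    obtain Q a where Q: "invertible Q" "range a \<subseteq> X" "A0 = conjug Q (diagm a)"
      using assms(4) spec_semisimple_iff by blast
    have "(\<Prod>i\<in>UNIV. z - e i) = (\<Prod>i\<in>UNIV. z - a i)" for z
      using r(3)[of z] Q by (simp add: det_conjug det_char_diagm)
    hence "(\<exists>i. z = e i) \<longleftrightarrow> (\<exists>i. z = a i)" for z by (metis (no_types, lifting) UNIV_I eq_iff_diff_eq_0 finite_class.finite_UNIV prod_zero_iff)
    hence ea: "range e = range a" by (auto simp: set_eq_iff image_iff)
    obtain g q where g: "bij_betw g {..<CARD('n)} (UNIV :: 'n set)" "q \<le> CARD('n)" "inj_on (\<lambda>k. e (g k)) {..<q}"
      "(\<lambda>k. e (g k)) ` {..<q} = range e" using representatives_first[of e] by blast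
    define \<mu> where "\<mu> k = e (g k)" for k
    define x where "x m k = d (r m) (g k)" for m k
    have a\<mu>: "a i \<in> \<mu> ` {..<q}" for i using g(4) ea unfolding \<mu>_def by auto
    have inj\<mu>: "inj_on \<mu> {..<q}" using g(3) unfolding \<mu>_def .
    have Ar: "(\<lambda>m. A (r m)) \<longlonglongrightarrow> A0" using LIMSEQ_subseq_LIMSEQ[OF A(1) r(1)] by (simp add: o_def)
    have np: "(\<lambda>m. newton_prod (A (r m)) (x m) j) \<longlonglongrightarrow> newton_prod A0 \<mu> j" for j
      unfolding x_def \<mu>_def by (intro tendsto_newton_prod Ar r(2))
    have nodes: "converging_nodes X {..j} \<mu> x" if "j < CARD('n)" for j
      unfolding \<mu>_def[abs_def] x_def[abs_def]
      by (rule nodes_of_bijection[OF g(1)]) (use Pd r(2) that in auto)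
    have summand: "(\<lambda>m. mat (ddiff (x m ` {..j})) ** newton_prod (A (r m)) (x m) j) \<longlonglongrightarrow>
        (if j < q then mat (ddiff (\<mu> ` {..j})) ** newton_prod A0 \<mu> j else 0)" if j: "j < CARD('n)" for j
    proof (cases "j < q")
      case True
      have "(\<lambda>m. ddiff (x m ` {..j})) \<longlonglongrightarrow> ddiff (\<mu> ` {..j})"
      proof (rule tendsto_ddiff_distinct)
        show "inj_on \<mu> {..j}" using inj\<mu> True by (auto intro: inj_on_subset)
      qed (use nodes[OF j] in \<open>auto simp: converging_nodes_def\<close>)
      thus ?thesis using True np by (simp add: tendsto_intros)
    next
      case False
      have "Bfun (\<lambda>m. ddiff (x m ` {..j})) sequentially"
      proof (rule ddiff_seq_bounded[rule_format, where X=X and \<mu>=\<mu> and N="CARD('n)"])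
        show "\<mu> ` {..j} \<subseteq> X" using ea Q(2) unfolding \<mu>_def by auto
      qed (use bd nodes[OF j] j in auto)
      then obtain B where B: "\<And>m. norm (ddiff (x m ` {..j})) \<le> B" unfolding Bseq_def by blast
      have "newton_prod A0 \<mu> j = 0"
        unfolding Q(3) using False by (intro newton_matrix(2)[OF Q(1) inj\<mu> a\<mu>]) simp
      hence n0: "(\<lambda>m. newton_prod (A (r m)) (x m) j $ b $ c) \<longlonglongrightarrow> 0" for b c
        using tendsto_vec_nth[OF tendsto_vec_nth[OF np[of j]], of b c] by simp
      have "(\<lambda>m. ddiff (x m ` {..j}) * newton_prod (A (r m)) (x m) j $ b $ c) \<longlonglongrightarrow> 0" for b c
      proof (rule Lim_null_comparison)
        show "\<forall>\<^sub>F m in sequentially. norm (ddiff (x m ` {..j}) * newton_prod (A (r m)) (x m) j $ b $ c)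
            \<le> B * norm (newton_prod (A (r m)) (x m) j $ b $ c)"
          using B by (simp add: norm_mult mult_right_mono)
        have "(\<lambda>m. B * norm (newton_prod (A (r m)) (x m) j $ b $ c)) \<longlonglongrightarrow> B * norm (0 :: complex)"
          by (intro tendsto_intros n0)
        thus "(\<lambda>m. B * norm (newton_prod (A (r m)) (x m) j $ b $ c)) \<longlonglongrightarrow> 0" by simp
      qed
      hence "(\<lambda>m. mat (ddiff (x m ` {..j})) ** newton_prod (A (r m)) (x m) j) \<longlonglongrightarrow> 0"
        by (intro vec_tendstoI) (simp add: mat_mult_nth)
      thus ?thesis using False by simp
    qed
    have "(\<lambda>m. conj_transpose (Phi (A (r m)))) \<longlonglongrightarrow>
        (\<Sum>j<CARD('n). if j < q then mat (ddiff (\<mu> ` {..j})) ** newton_prod A0 \<mu> j else 0)"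
      unfolding Pd(4) Phi_star_newton[OF g(1) Pd(2,1)]
      unfolding Pd(4)[symmetric] x_def[symmetric] by (intro tendsto_sum summand) auto
    also have "(\<Sum>j<CARD('n). if j < q then mat (ddiff (\<mu> ` {..j})) ** newton_prod A0 \<mu> j else 0) =
        (\<Sum>j<q. mat (ddiff (\<mu> ` {..j})) ** newton_prod A0 \<mu> j)"
      using g(2) by (intro sum.mono_neutral_cong_right) auto
    also have "\<dots> = conj_transpose (Phi A0)"
      unfolding Q(3) using newton_matrix(1)[OF Q(1) inj\<mu> a\<mu>] Q(1) by (simp add: Phi_conjug_diagm)
    finally have "(\<lambda>m. conj_transpose (conj_transpose (Phi (A (r m))))) \<longlonglongrightarrow> conj_transpose (conj_transpose (Phi A0))"
      by (rule tendsto_conj_transpose)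
    thus ?thesis using r(1) by auto
  qed
  fix r :: "nat \<Rightarrow> nat" assume r: "strict_mono r"
  show "\<exists>r'. strict_mono r' \<and> (\<lambda>m. Phi (A (r (r' m)))) \<longlonglongrightarrow> Phi A0"
    by (rule key) (use LIMSEQ_subseq_LIMSEQ[OF A(1) r] A(2) in \<open>auto simp: o_def\<close>)
qed

text \<open>Limit eigenvalues of different subsequences have to be matched with multiplicities, not
  merely as sets, in order to give the same Newton nodes.\<close>

lemma same_char_poly_permutation:
  fixes d e :: "'n::finite \<Rightarrow> complex"
  assumes "\<And>z. (\<Prod>i\<in>UNIV. z - d i) = (\<Prod>i\<in>UNIV. z - e i)"
  shows "\<exists>p. p permutes UNIV \<and> (\<forall>i. d i = e (p i))"
proof -
  have pr: "proots (\<Prod>i\<in>UNIV. [:- f i, 1:]) = image_mset f (mset_set UNIV)" for f :: "'n \<Rightarrow> complex"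
    by (subst proots_prod) (auto simp: sum_unfold_sum_mset)
  have "poly (\<Prod>i\<in>UNIV. [:- d i, 1:]) = poly (\<Prod>i\<in>UNIV. [:- e i, 1:])"
    using assms by (auto simp: poly_prod fun_eq_iff)
  hence "(\<Prod>i\<in>UNIV. [:- d i, 1:]) = (\<Prod>i\<in>UNIV. [:- e i, 1:])" by (simp add: poly_eq_poly_eq_iff)
  hence "image_mset d (mset_set UNIV) = image_mset e (mset_set UNIV)" using pr by metis
  then obtain p where "p permutes UNIV" "\<forall>i\<in>UNIV. d i = e (p i)"
    using image_mset_eq_implies_permutes[OF finite_class.finite_UNIV] by metis
  thus ?thesis by blast
qed

lemma triangular_form:
  fixes A :: "complex^'n^'n"
  obtains f U T where "bij_betw f (UNIV :: 'n set) {..<CARD('n)}" "unitary U" "A = conjug U T"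
    "\<forall>i j. f j < f i \<longrightarrow> T $ i $ j = 0" "range (\<lambda>i. T $ i $ i) \<subseteq> matrix_spectrum A"
    "\<forall>z. det (mat z - A) = (\<Prod>i\<in>UNIV. z - T $ i $ i)"
proof -
  obtain f :: "'n \<Rightarrow> nat" where f: "bij_betw f UNIV {..<CARD('n)}" using finite_enumeration_exists by blast
  then obtain U T where U: "unitary U" "A = conjug U T" "\<forall>i j. f j < f i \<longrightarrow> T $ i $ j = 0"
    using schur_triangularization by blast
  have d: "det (mat z - A) = (\<Prod>i\<in>UNIV. z - T $ i $ i)" for z
    unfolding U(2) det_conjug[OF unitary_invertible[OF U(1)]]
    by (rule det_char_triangular[of f]) (use f U(3) in \<open>auto simp: bij_betw_def\<close>)
  hence "range (\<lambda>i. T $ i $ i) \<subseteq> matrix_spectrum A" by (auto simp: matrix_spectrum_det prod_zero_iff)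
  thus ?thesis using that f U d by blast
qed

text \<open>A permutation matches the limiting eigenvalues of any subsequence with one fixed
  enumeration of those of \<open>A0\<close>, so the coefficients \<open>c\<close> and nodes
  \<open>y\<close> serve all sequences. The limit is kept as a polynomial in \<open>A0\<close>
  because commutation is later read off from this form.\<close>

lemma Phi_star_limit:
  fixes A0 :: "complex^'n^'n"
  assumes lim: "\<And>z k. z \<in> X \<Longrightarrow> 1 \<le> k \<Longrightarrow> k \<le> CARD('n) \<Longrightarrow> \<exists>l. ddiff_limit X z k l"
    and A0: "A0 \<in> spec_all X"
  shows "\<exists>c y. \<forall>A. (\<forall>m. A m \<in> simple_spec X) \<and> A \<longlonglongrightarrow> A0 \<longrightarrow>
    (\<lambda>m. conj_transpose (Phi (A m))) \<longlonglongrightarrow> (\<Sum>j<CARD('n). mat (c j) ** newton_prod A0 y j)"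
proof -
  obtain f U T where T: "bij_betw f (UNIV :: 'n set) {..<CARD('n)}" "unitary U" "A0 = conjug U T"
    "\<forall>i j. f j < f i \<longrightarrow> T $ i $ j = 0" "range (\<lambda>i. T $ i $ i) \<subseteq> matrix_spectrum A0"
    "\<forall>z. det (mat z - A0) = (\<Prod>i\<in>UNIV. z - T $ i $ i)" using triangular_form[of A0] .
  define a where "a i = T $ i $ i" for i
  have aX: "range a \<subseteq> X" using T(5) A0 by (auto simp: a_def spec_all_def)
  obtain h where h: "bij_betw h {..<CARD('n)} (UNIV :: 'n set)" using bij_betw_inv[OF T(1)] by blast
  define \<nu> where "\<nu> k = a (h k)" for k
  have "\<forall>j. \<exists>L. j < CARD('n) \<longrightarrow> (\<forall>x. converging_nodes X {..j} \<nu> x \<longrightarrow> (\<lambda>m. ddiff (x m ` {..j})) \<longlonglongrightarrow> L)"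
  proof
    fix j
    show "\<exists>L. j < CARD('n) \<longrightarrow> (\<forall>x. converging_nodes X {..j} \<nu> x \<longrightarrow> (\<lambda>m. ddiff (x m ` {..j})) \<longlonglongrightarrow> L)"
    proof (cases "j < CARD('n)")
      case True
      have "\<exists>L. \<forall>x. converging_nodes X {..j} \<nu> x \<longrightarrow> (\<lambda>m. ddiff (x m ` {..j})) \<longlonglongrightarrow> L"
        by (rule ddiff_seq_converges[where N="CARD('n)"]) (use lim True aX in \<open>auto simp: \<nu>_def\<close>)
      thus ?thesis by blast
    qed simp
  qed
  then obtain L where L: "\<And>j x. j < CARD('n) \<Longrightarrow> converging_nodes X {..j} \<nu> x \<Longrightarrow> (\<lambda>m. ddiff (x m ` {..j})) \<longlonglongrightarrow> L j"
    by metis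
  let ?L = "\<Sum>j<CARD('n). mat (L j) ** newton_prod A0 \<nu> j"
  have key: "\<exists>r. strict_mono r \<and> (\<lambda>m. conj_transpose (Phi (A (r m)))) \<longlonglongrightarrow> ?L"
    if A: "A \<longlonglongrightarrow> A0" "\<And>m. A m \<in> simple_spec X" for A
  proof -
    have "\<forall>m. \<exists>P d. invertible P \<and> inj d \<and> range d \<subseteq> X \<and> A m = conjug P (diagm d)"
      using A(2) unfolding simple_spec_def by blast
    then obtain P d where Pd: "\<And>m. invertible (P m)" "\<And>m. inj (d m)" "\<And>m. range (d m) \<subseteq> X"
      "\<And>m. A m = conjug (P m) (diagm (d m))" by metis
    obtain r e where r: "strict_mono r" "\<And>i. (\<lambda>m. d (r m) i) \<longlonglongrightarrow> e i" "\<And>z. det (mat z - A0) = (\<Prod>i\<in>UNIV. z - e i)"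
      using eigenvalues_subsequence[OF A(1) Pd(1,4)] by metis
    have "(\<Prod>i\<in>UNIV. z - a i) = (\<Prod>i\<in>UNIV. z - e i)" for z using r(3)[of z] T(6)[rule_format, of z] by (simp add: a_def)
    then obtain p where p: "p permutes UNIV" "\<And>i. a i = e (p i)"
      using same_char_poly_permutation[of a e] by blast
    define g where "g k = p (h k)" for k
    have g: "bij_betw g {..<CARD('n)} (UNIV :: 'n set)"
      unfolding g_def using bij_betw_trans[OF h permutes_imp_bij[OF p(1)]] by (simp add: o_def)
    have \<nu>g: "\<nu> = (\<lambda>k. e (g k))" by (simp add: fun_eq_iff \<nu>_def g_def p(2))
    define x where "x m k = d (r m) (g k)" for m k
    have Ar: "(\<lambda>m. A (r m)) \<longlonglongrightarrow> A0" using LIMSEQ_subseq_LIMSEQ[OF A(1) r(1)] by (simp add: o_def)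
    have np: "(\<lambda>m. newton_prod (A (r m)) (x m) j) \<longlonglongrightarrow> newton_prod A0 \<nu> j" for j
      unfolding x_def \<nu>g by (intro tendsto_newton_prod Ar r(2))
    have nodes: "converging_nodes X {..j} \<nu> x" if "j < CARD('n)" for j
      unfolding \<nu>g x_def[abs_def]
      by (rule nodes_of_bijection[OF g]) (use Pd r(2) that in auto)
    have "(\<lambda>m. conj_transpose (Phi (A (r m)))) \<longlonglongrightarrow> ?L"
      unfolding Pd(4) Phi_star_newton[OF g Pd(2,1)]
      unfolding Pd(4)[symmetric] x_def[symmetric]
      by (intro tendsto_sum tendsto_matrix_mult tendsto_mat L nodes np) auto
    thus ?thesis using r(1) by blast
  qed
  have "(\<lambda>m. conj_transpose (Phi (A m))) \<longlonglongrightarrow> ?L" if A: "\<forall>m. A m \<in> simple_spec X" "A \<longlonglongrightarrow> A0" for A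
  proof (rule tendsto_subsequence_principle)
    fix r :: "nat \<Rightarrow> nat" assume r: "strict_mono r"
    show "\<exists>r'. strict_mono r' \<and> (\<lambda>m. conj_transpose (Phi (A (r (r' m))))) \<longlonglongrightarrow> ?L"
      by (rule key) (use LIMSEQ_subseq_LIMSEQ[OF A(2) r] A(1) in \<open>auto simp: o_def\<close>)
  qed
  thus ?thesis by blast
qed

subsection \<open>Density of matrices with simple spectrum\<close>

lemma simple_spec_of_triangular:
  assumes f: "inj (f :: 'n::finite \<Rightarrow> nat)" and T: "\<And>i j. f j < f i \<Longrightarrow> T $ i $ j = 0"
    and d: "inj (\<lambda>i. T $ i $ i)" "range (\<lambda>i. T $ i $ i) \<subseteq> X" and U: "invertible (U :: complex^'n^'n)"
  shows "conjug U T \<in> simple_spec X"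
proof -
  have "range (\<lambda>i. T $ i $ i) \<subseteq> matrix_spectrum T"
    using det_char_triangular[OF f T] by (auto simp: matrix_spectrum_det prod_zero_iff)
  then obtain P where P: "invertible P" "T = conjug P (diagm (\<lambda>i. T $ i $ i))"
    using distinct_eigenvalues_diagonalizable[OF d(1)] by blast
  hence "conjug U T = conjug (U ** P) (diagm (\<lambda>i. T $ i $ i))" using U by (metis conjug_conjug)
  thus ?thesis unfolding simple_spec_def using d P(1) U invertible_mult by blast
qed

text \<open>The diagonal of a Schur form is replaced by distinct nearby points of \<open>X\<close>;
  a triangular matrix with distinct diagonal entries is diagonalizable.\<close>

lemma simple_spec_dense:
  assumes "perfect_set X" "A \<in> spec_all X"
  shows "\<exists>s. (\<forall>m. s m \<in> simple_spec X) \<and> s \<longlonglongrightarrow> (A :: complex^'n^'n)"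
proof -
  obtain f U T where T: "bij_betw f (UNIV :: 'n set) {..<CARD('n)}" "unitary U" "A = conjug U T"
    "\<forall>i j. f j < f i \<longrightarrow> T $ i $ j = 0" "range (\<lambda>i. T $ i $ i) \<subseteq> matrix_spectrum A"
    "\<forall>z. det (mat z - A) = (\<Prod>i\<in>UNIV. z - T $ i $ i)" using triangular_form[of A] .
  have "range (\<lambda>i. T $ i $ i) \<subseteq> X" using T(5) assms(2) by (auto simp: spec_all_def)
  then obtain s where s': "\<forall>m. inj (s m)" "\<forall>m. range (s m) \<subseteq> X" "\<forall>i. (\<lambda>m. s m i) \<longlonglongrightarrow> T $ i $ i"
    by (rule perfect_set_approx_seq[OF assms(1)])
  note s = s'[rule_format]
  define S :: "nat \<Rightarrow> complex^'n^'n" where "S m = (\<chi> i j. if i = j then s m i else T $ i $ j)" for m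
  have "conjug U (S m) \<in> simple_spec X" for m
    by (rule simple_spec_of_triangular[of f])
       (use T(1,2,4) s(1,2)[of m] unitary_invertible in \<open>auto simp: S_def bij_betw_def\<close>)
  moreover have "S \<longlonglongrightarrow> T"
  proof (intro vec_tendstoI)
    show "(\<lambda>m. S m $ i $ j) \<longlonglongrightarrow> T $ i $ j" for i j
      using s(3)[of i] by (cases "i = j") (auto simp: S_def)
  qed
  hence "(\<lambda>m. conjug U (S m)) \<longlonglongrightarrow> A" unfolding T(3) by (rule tendsto_conjug)
  ultimately show ?thesis by (intro exI[of _ "\<lambda>m. conjug U (S m)"]) auto
qed

text \<open>Only the eigenvalues move while \<open>P\<close> is fixed, so \<Phi> converges along
  this sequence by its explicit formula, whatever the divided differences do.\<close>

lemma simple_spec_dense_Phi: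
  assumes "perfect_set X" "A \<in> spec_semisimple X"
  shows "\<exists>s. (\<forall>m. s m \<in> simple_spec X) \<and> s \<longlonglongrightarrow> (A :: complex^'n^'n) \<and> (\<lambda>m. Phi (s m)) \<longlonglongrightarrow> Phi A"
proof -
  obtain P d where P: "invertible P" "range d \<subseteq> X" "A = conjug P (diagm d)" using assms(2) spec_semisimple_iff by blast
  obtain s where s': "\<forall>m. inj (s m)" "\<forall>m. range (s m) \<subseteq> X" "\<forall>i. (\<lambda>m. s m i) \<longlonglongrightarrow> d i"
    using perfect_set_approx_seq[OF assms(1) P(2)] .
  note s = s'[rule_format]
  have "conjug P (diagm (s m)) \<in> simple_spec X" for m unfolding simple_spec_def using P(1) s by blast
  moreover have "(\<lambda>m. conjug P (diagm (s m))) \<longlonglongrightarrow> A" unfolding P(3) by (intro tendsto_intros s)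
  moreover have "(\<lambda>m. Phi (conjug P (diagm (s m)))) \<longlonglongrightarrow> Phi A"
    unfolding P(3) Phi_conjug_diagm[OF P(1)] by (intro tendsto_intros s)
  ultimately show ?thesis by (intro exI[of _ "\<lambda>m. conjug P (diagm (s m))"]) auto
qed

text \<open>A diagonal choice: each \<open>x m\<close> is replaced by a point \<open>d m\<close> of
  \<open>D\<close> that is near it and at which \<phi> is near \<Psi> (x m). The limit hypothesis
  then applies to the sequence \<open>d\<close>.\<close>

lemma continuous_on_dense_limits:
  fixes \<Psi> :: "'a::metric_space \<Rightarrow> 'b::metric_space"
  assumes dense: "\<And>x. x \<in> E \<Longrightarrow> \<exists>s. (\<forall>m. s m \<in> D) \<and> s \<longlonglongrightarrow> x"
    and lim: "\<And>x s. x \<in> E \<Longrightarrow> (\<forall>m. s m \<in> D) \<Longrightarrow> s \<longlonglongrightarrow> x \<Longrightarrow> (\<lambda>m. \<phi> (s m)) \<longlonglongrightarrow> \<Psi> x"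
  shows "continuous_on E \<Psi>"
  unfolding continuous_on_sequentially
proof (intro allI ballI impI, elim conjE)
  fix x a assume a: "a \<in> E" "\<forall>m. x m \<in> E" "x \<longlonglongrightarrow> a"
  have "\<exists>d\<in>D. dist d (x m) < inverse (real (Suc m)) \<and> dist (\<phi> d) (\<Psi> (x m)) < inverse (real (Suc m))" for m
  proof -
    obtain s where s: "\<forall>k. s k \<in> D" "s \<longlonglongrightarrow> x m" using dense a(2) by blast
    have pos: "inverse (real (Suc m)) > 0" by simp
    have "\<forall>\<^sub>F k in sequentially. dist (s k) (x m) < inverse (real (Suc m)) \<and>
        dist (\<phi> (s k)) (\<Psi> (x m)) < inverse (real (Suc m))"
      using tendstoD[OF s(2) pos] tendstoD[OF lim[OF _ s] pos] a(2) by (intro eventually_conj) auto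
    thus ?thesis using s(1) by (auto simp: eventually_sequentially)
  qed
  then obtain d where d: "\<And>m. d m \<in> D" "\<And>m. dist (d m) (x m) < inverse (real (Suc m))"
    "\<And>m. dist (\<phi> (d m)) (\<Psi> (x m)) < inverse (real (Suc m))" by metis
  have z: "(\<lambda>m. dist (d m) (x m)) \<longlonglongrightarrow> 0" "(\<lambda>m. dist (\<phi> (d m)) (\<Psi> (x m))) \<longlonglongrightarrow> 0"
    by (rule tendsto_sandwich[OF _ _ tendsto_const LIMSEQ_inverse_real_of_nat];
        use d(2,3) in \<open>simp add: less_imp_le del: of_nat_Suc\<close>)+
  have tr: "(\<lambda>m. dist (u m) (w m)) \<longlonglongrightarrow> 0 \<Longrightarrow> u \<longlonglongrightarrow> l \<Longrightarrow> w \<longlonglongrightarrow> l" for u w :: "nat \<Rightarrow> 'c::metric_space" and l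
  proof -
    assume uw: "(\<lambda>m. dist (u m) (w m)) \<longlonglongrightarrow> 0" and ul: "u \<longlonglongrightarrow> l"
    have "(\<lambda>m. dist (u m) (w m) + dist (u m) l) \<longlonglongrightarrow> 0 + dist l l" by (intro tendsto_intros uw ul)
    hence "(\<lambda>m. dist (u m) (w m) + dist (u m) l) \<longlonglongrightarrow> 0" by simp
    thus "w \<longlonglongrightarrow> l"
      by (subst tendsto_dist_iff, rule_tac tendsto_sandwich[OF _ _ tendsto_const])
         (auto intro!: always_eventually dist_triangle3)
  qed
  have "d \<longlonglongrightarrow> a" using tr[of x d a] z(1) a(3) by (simp add: dist_commute)
  hence "(\<lambda>m. \<phi> (d m)) \<longlonglongrightarrow> \<Psi> a" using lim a(1) d(1) by blast
  hence "(\<lambda>m. \<Psi> (x m)) \<longlonglongrightarrow> \<Psi> a" by (rule tr[OF z(2)])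
  thus "(\<Psi> \<circ> x) \<longlonglongrightarrow> \<Psi> a" by (simp add: o_def)
qed

subsection \<open>Necessity of the conditions on divided differences\<close>

text \<open>With rows numbered by \<open>f\<close>, the second case is the superdiagonal. Distinct
  nodes give a diagonalizable matrix, while equal nodes with nonzero \<epsilon> give a scalar plus a
  nilpotent part: merging the nodes tests \<Phi> where its continuity is in doubt.\<close>

definition bidiagonal :: "('n::finite \<Rightarrow> nat) \<Rightarrow> (nat \<Rightarrow> complex) \<Rightarrow> complex \<Rightarrow> complex^'n^'n" where
  "bidiagonal f x \<epsilon> = (\<chi> a b. if a = b then x (f a) else if f b = Suc (f a) then \<epsilon> else 0)"

lemma bidiagonal_simple_spec:
  assumes f: "bij_betw f (UNIV :: 'n::finite set) {..<CARD('n)}" and x: "x \<in> config_space CARD('n) X"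
  shows "bidiagonal f x \<epsilon> \<in> simple_spec X"
proof -
  have "conjug (mat 1) (bidiagonal f x \<epsilon>) \<in> simple_spec X"
    by (rule simple_spec_of_triangular[of f])
       (use f config_space_inj[OF f x] invertible_mat1 in \<open>auto simp: bij_betw_def bidiagonal_def\<close>)
  thus ?thesis by simp
qed

text \<open>The first row has a single nonzero entry at most. Multiplying by the factor with node
  \<open>x j\<close> cancels the diagonal entry at position j, so this entry moves one place to the
  right and picks up \<epsilon>.\<close>

lemma newton_prod_bidiagonal:
  assumes f: "bij_betw f (UNIV :: 'n::finite set) {..<CARD('n)}" and a: "f a = 0" and j: "j < CARD('n)"
  shows "newton_prod (bidiagonal f x \<epsilon>) x j $ a $ b = (if f b = j then \<epsilon> ^ j else 0)"
  using j
proof (induction j arbitrary: b)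
  case 0
  have "f b = 0 \<longleftrightarrow> a = b" using f a unfolding bij_betw_def by (metis injD)
  thus ?case by (simp add: mat_nth)
next
  case (Suc j)
  obtain c where c: "f c = j" using f Suc.prems unfolding bij_betw_def by (metis Suc_lessD image_iff lessThan_iff)
  have inj: "f p = f q \<longleftrightarrow> p = q" for p q using f unfolding bij_betw_def by (metis injD)
  have fc: "f p = j \<longleftrightarrow> p = c" for p using c inj by metis
  have "newton_prod (bidiagonal f x \<epsilon>) x (Suc j) $ a $ b =
      (\<Sum>p\<in>UNIV. (if p = c then \<epsilon> ^ j else 0) * (bidiagonal f x \<epsilon> - mat (x j)) $ p $ b)"
    using Suc by (simp add: matrix_matrix_mult_def fc)
  also have "\<dots> = \<epsilon> ^ j * (bidiagonal f x \<epsilon> - mat (x j)) $ c $ b"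
    by (simp add: if_distrib[where f="\<lambda>y. y * _"] cong: if_cong)
  also have "\<dots> = (if f b = Suc j then \<epsilon> ^ Suc j else 0)"
    using c by (auto simp: bidiagonal_def mat_nth)
  finally show ?case .
qed

text \<open>Only the Newton product of order n - 1 reaches the last column of the first row, so the
  corner isolates the divided difference over all n nodes.\<close>

lemma Phi_bidiagonal_corner:
  assumes f: "bij_betw f (UNIV :: 'n::finite set) {..<CARD('n)}" and x: "x \<in> config_space CARD('n) X"
    and a: "f a = 0" "f b = CARD('n) - 1"
  shows "conj_transpose (Phi (bidiagonal f x \<epsilon>)) $ a $ b = ddiff (x ` {..<CARD('n)}) * \<epsilon> ^ (CARD('n) - 1)"
proof -
  have n: "CARD('n) > 0" by simp
  have inj: "inj (\<lambda>i. x (f i))" using config_space_inj[OF f x] by blast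
  have fi: "inj f" using f by (simp add: bij_betw_def)
  have "range (\<lambda>i. x (f i)) \<subseteq> matrix_spectrum (bidiagonal f x \<epsilon>)"
  proof -
    have "det (mat z - bidiagonal f x \<epsilon>) = (\<Prod>i\<in>UNIV. z - bidiagonal f x \<epsilon> $ i $ i)" for z
      by (rule det_char_triangular[OF fi]) (auto simp: bidiagonal_def)
    thus ?thesis by (auto simp: matrix_spectrum_det prod_zero_iff bidiagonal_def)
  qed
  then obtain P where P: "invertible P" "bidiagonal f x \<epsilon> = conjug P (diagm (\<lambda>i. x (f i)))"
    using distinct_eigenvalues_diagonalizable[OF inj] by blast
  have xi: "inj_on x {..<CARD('n)}" using x by (simp add: config_space_def)
  have "x (f k) \<in> x ` {..<CARD('n)}" for k using f unfolding bij_betw_def by auto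
  hence "conj_transpose (Phi (bidiagonal f x \<epsilon>)) =
      (\<Sum>j<CARD('n). mat (ddiff (x ` {..j})) ** newton_prod (bidiagonal f x \<epsilon>) x j)"
    using newton_matrix(1)[OF P(1) xi, of "\<lambda>i. x (f i)"] P by (simp add: Phi_conjug_diagm)
  hence "conj_transpose (Phi (bidiagonal f x \<epsilon>)) $ a $ b =
      (\<Sum>j<CARD('n). ddiff (x ` {..j}) * (if CARD('n) - 1 = j then \<epsilon> ^ j else 0))"
    by (simp add: mat_mult_nth newton_prod_bidiagonal[OF f a(1)] a(2))
  also have "\<dots> = (\<Sum>j<CARD('n). if j = CARD('n) - 1 then ddiff (x ` {..j}) * \<epsilon> ^ j else 0)"
    by (intro sum.cong) auto
  also have "\<dots> = ddiff (x ` {..CARD('n) - 1}) * \<epsilon> ^ (CARD('n) - 1)" using n by simp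
  also have "{..CARD('n) - 1} = {..<CARD('n)}" using n by (metis Suc_pred lessThan_Suc_atMost One_nat_def)
  finally show ?thesis .
qed

lemma tendsto_bidiagonal:
  assumes "\<And>i. i < CARD('n) \<Longrightarrow> ((\<lambda>m. x m i) \<longlongrightarrow> x0 i) F" "(\<epsilon> \<longlongrightarrow> \<epsilon>0) F"
    "bij_betw f (UNIV :: 'n::finite set) {..<CARD('n)}"
  shows "((\<lambda>m. bidiagonal f (x m) (\<epsilon> m)) \<longlongrightarrow> bidiagonal f x0 \<epsilon>0) F"
proof -
  have "f i < CARD('n)" for i using assms(3) unfolding bij_betw_def by auto
  hence "((\<lambda>m. bidiagonal f (x m) (\<epsilon> m) $ i $ j) \<longlongrightarrow> bidiagonal f x0 \<epsilon>0 $ i $ j) F" for i j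
    using assms(1,2) by (simp add: bidiagonal_def)
  thus ?thesis by (intro vec_tendstoI)
qed

lemma first_last_index:
  assumes "bij_betw f (UNIV :: 'n::finite set) {..<CARD('n)}" "CARD('n) \<ge> 2"
  obtains a b where "f a = 0" "f b = CARD('n) - 1" "a \<noteq> b"
proof -
  have "0 \<in> range f" "CARD('n) - 1 \<in> range f" using assms by (auto simp: bij_betw_def)
  then obtain a b where "f a = 0" "f b = CARD('n) - 1" by (metis image_iff)
  moreover from this have "a \<noteq> b" using assms(2) by auto
  ultimately show ?thesis using that by blast
qed

text \<open>If divided differences were unbounded near z, choose \<epsilon> with \<epsilon>^(n-1)
  equal to the reciprocal of their modulus. Then \<epsilon> tends to 0 and the bidiagonal matrices
  tend to \<open>mat z\<close>, yet the corner entry keeps modulus 1, whereas \<Phi> fixes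
  \<open>mat z\<close>.\<close>

lemma Phi_continuous_imp_locally_bounded:
  assumes n: "CARD('n::finite) \<ge> 2" and c: "continuous_on (spec_semisimple X :: (complex^'n^'n) set) Phi"
  shows "Delta_cnj_locally_bounded CARD('n) X"
proof -
  have n1: "CARD('n) \<ge> 1" "CARD('n) - 1 > 0" using n by auto
  obtain f :: "'n \<Rightarrow> nat" where f: "bij_betw f UNIV {..<CARD('n)}" using finite_enumeration_exists by blast
  obtain a b where ab: "f a = 0" "f b = CARD('n) - 1" "a \<noteq> b" using first_last_index[OF f n] .
  have "ddiff_bounded X z CARD('n)" if z: "z \<in> X" for z
  proof (rule ccontr)
    assume nb: "\<not> ddiff_bounded X z CARD('n)"
    have "\<exists>S. S \<subseteq> X \<inter> ball z (1 / real (Suc m)) \<and> card S = CARD('n) \<and> norm (ddiff S) > real (Suc m)" for m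
    proof (rule ccontr)
      assume "\<not> ?thesis"
      hence "\<forall>S. S \<subseteq> X \<inter> ball z (1 / real (Suc m)) \<and> card S = CARD('n) \<longrightarrow> norm (ddiff S) \<le> real (Suc m)"
        by (auto simp: not_less)
      moreover have "1 / real (Suc m) > 0" by simp
      ultimately show False using nb unfolding ddiff_bounded_def by blast
    qed
    then obtain S where S: "\<And>m. S m \<subseteq> X \<inter> ball z (1 / real (Suc m))" "\<And>m. card (S m) = CARD('n)"
      "\<And>m. norm (ddiff (S m)) > real (Suc m)" by metis
    obtain x where x: "\<forall>m. x m \<in> config_space CARD('n) X \<and> x m ` {..<CARD('n)} = S m"
      "\<forall>i<CARD('n). (\<lambda>m. x m i) \<longlonglongrightarrow> z" using shrinking_nodes[OF S(1,2) n1(1)] by metis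
    define \<epsilon> where "\<epsilon> m = root (CARD('n) - 1) (1 / norm (ddiff (S m)))" for m
    have dpos: "norm (ddiff (S m)) > 0" for m using S(3)[of m] by linarith
    have \<epsilon>p: "\<epsilon> m ^ (CARD('n) - 1) = 1 / norm (ddiff (S m))" for m
      unfolding \<epsilon>_def using n1(2) dpos[of m] by (intro real_root_pow_pos2) auto
    have "(\<lambda>m. 1 / norm (ddiff (S m))) \<longlonglongrightarrow> 0"
    proof (rule tendsto_sandwich[OF _ _ tendsto_const LIMSEQ_inverse_real_of_nat])
      show "\<forall>\<^sub>F m in sequentially. 1 / norm (ddiff (S m)) \<le> inverse (real (Suc m))"
      proof (rule always_eventually, rule allI)
        fix m show "1 / norm (ddiff (S m)) \<le> inverse (real (Suc m))"
          unfolding inverse_eq_divide using frac_le[of 1 1 "real (Suc m)" "norm (ddiff (S m))"] S(3)[of m] by simp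
      qed
    qed auto
    hence "(\<lambda>m. \<epsilon> m) \<longlonglongrightarrow> root (CARD('n) - 1) 0" unfolding \<epsilon>_def by (rule tendsto_real_root)
    hence \<epsilon>0: "(\<lambda>m. complex_of_real (\<epsilon> m)) \<longlonglongrightarrow> 0" using tendsto_of_real[of \<epsilon> 0] by simp
    define B where "B m = bidiagonal f (x m) (complex_of_real (\<epsilon> m))" for m
    have "B \<longlonglongrightarrow> bidiagonal f (\<lambda>_. z) 0" unfolding B_def
      by (rule tendsto_bidiagonal[OF _ \<epsilon>0 f]) (use x(2) in auto)
    moreover have zm: "bidiagonal f (\<lambda>_. z) 0 = mat z" by (simp add: bidiagonal_def mat_def vec_eq_iff)
    ultimately have Blim: "B \<longlonglongrightarrow> mat z" by simp
    have mz: "mat z = conjug (mat 1) (diagm (\<lambda>_. z))" by (simp add: diagm_const)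
    have zX: "mat z \<in> spec_semisimple X"
      unfolding spec_semisimple_iff
      by (rule exI[of _ "mat 1"], rule exI[of _ "\<lambda>_. z"]) (use mz invertible_mat1 z in auto)
    have Pz: "Phi (mat z) = mat z"
      unfolding mz Phi_conjug_diagm[OF invertible_mat1] by (simp add: diagm_const)
    have "B m \<in> spec_semisimple X" for m
      using bidiagonal_simple_spec[OF f] x(1) simple_spec_subset unfolding B_def by blast
    hence "(\<lambda>m. Phi (B m)) \<longlonglongrightarrow> Phi (mat z)"
      by (intro continuous_on_tendsto_compose[OF c Blim zX]) auto
    hence "(\<lambda>m. conj_transpose (Phi (B m)) $ a $ b) \<longlonglongrightarrow> conj_transpose (mat z) $ a $ b"
      unfolding Pz by (intro tendsto_intros)
    hence "(\<lambda>m. norm (conj_transpose (Phi (B m)) $ a $ b)) \<longlonglongrightarrow> 0"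
      using ab(3) by (simp add: mat_nth tendsto_norm_zero)
    moreover have "norm (conj_transpose (Phi (B m)) $ a $ b) = 1" for m
    proof -
      have "\<epsilon> m \<ge> 0" unfolding \<epsilon>_def by (rule real_root_ge_zero) simp
      hence "norm (complex_of_real (\<epsilon> m) ^ (CARD('n) - 1)) = 1 / norm (ddiff (S m))"
        using \<epsilon>p[of m] by (simp add: norm_power)
      thus ?thesis unfolding B_def using Phi_bidiagonal_corner[OF f, of "x m" X a b] x(1) ab dpos[of m]
        by (simp add: norm_mult)
    qed
    ultimately have "(\<lambda>m :: nat. 1 :: real) \<longlonglongrightarrow> 0" by simp
    thus False by (simp add: LIMSEQ_const_iff)
  qed
  thus ?thesis using locally_bounded_iff[OF n1(1)] by blast
qed

text \<open>With \<epsilon> = 1 the bidiagonal matrices converge to a Jordan block, at which the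
  extension is defined, and the corner entry is the divided difference itself.\<close>

lemma extension_imp_has_limits:
  assumes n: "CARD('n::finite) \<ge> 2"
    and c: "continuous_on (spec_all X) \<Psi>" "\<And>A. A \<in> spec_semisimple X \<Longrightarrow> \<Psi> A = Phi (A :: complex^'n^'n)"
  shows "Delta_cnj_has_limits CARD('n) X"
proof -
  have n1: "CARD('n) \<ge> 1" using n by auto
  obtain f :: "'n \<Rightarrow> nat" where f: "bij_betw f UNIV {..<CARD('n)}" using finite_enumeration_exists by blast
  have fi: "inj f" using f by (simp add: bij_betw_def)
  obtain a b where ab: "f a = 0" "f b = CARD('n) - 1" "a \<noteq> b" using first_last_index[OF f n] .
  have "\<exists>l. ddiff_limit X z CARD('n) l" if z: "z \<in> X" for z
  proof -
    define J where "J = bidiagonal f (\<lambda>_. z) 1"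
    define l where "l = conj_transpose (\<Psi> J) $ a $ b"
    have "det (mat y - J) = (\<Prod>i\<in>UNIV. y - J $ i $ i)" for y
      by (rule det_char_triangular[OF fi]) (auto simp: J_def bidiagonal_def)
    hence JX: "J \<in> spec_all X"
      using z by (auto simp: spec_all_def matrix_spectrum_det prod_zero_iff J_def bidiagonal_def)
    have "ddiff_limit X z CARD('n) l"
    proof (rule ccontr)
      assume "\<not> ddiff_limit X z CARD('n) l"
      then obtain \<eta> S where \<eta>: "\<eta> > 0" and S': "\<forall>m. S m \<subseteq> X \<inter> ball z (1 / real (Suc m))"
        "\<forall>m. card (S m) = CARD('n)" "\<forall>m. \<not> norm (ddiff (S m) - l) < \<eta>" by (rule not_ddiff_limit_seq)
      note S = S'[rule_format]
      obtain x where x: "\<forall>m. x m \<in> config_space CARD('n) X \<and> x m ` {..<CARD('n)} = S m"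
        "\<forall>i<CARD('n). (\<lambda>m. x m i) \<longlonglongrightarrow> z" using shrinking_nodes[OF S(1,2) n1] by metis
      define B where "B m = bidiagonal f (x m) 1" for m
      have Blim: "B \<longlonglongrightarrow> J" unfolding B_def J_def
        by (rule tendsto_bidiagonal[OF _ tendsto_const f]) (use x(2) in auto)
      have BX: "B m \<in> spec_semisimple X" for m
        using bidiagonal_simple_spec[OF f] x(1) simple_spec_subset unfolding B_def by blast
      hence "B m \<in> spec_all X" for m using spec_semisimple_subset by blast
      hence "(\<lambda>m. \<Psi> (B m)) \<longlonglongrightarrow> \<Psi> J"
        by (intro continuous_on_tendsto_compose[OF c(1) Blim JX]) auto
      hence "(\<lambda>m. conj_transpose (\<Psi> (B m)) $ a $ b) \<longlonglongrightarrow> l" unfolding l_def by (intro tendsto_intros)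
      moreover have "conj_transpose (\<Psi> (B m)) $ a $ b = ddiff (S m)" for m
        unfolding c(2)[OF BX] unfolding B_def using Phi_bidiagonal_corner[OF f, of "x m" X a b] x(1) ab by simp
      ultimately have "(\<lambda>m. ddiff (S m)) \<longlonglongrightarrow> l" by simp
      hence "\<forall>\<^sub>F m in sequentially. dist (ddiff (S m)) l < \<eta>" using \<eta>(1) by (rule tendstoD)
      thus False using S(3) by (auto simp: eventually_sequentially dist_norm)
    qed
    thus ?thesis ..
  qed
  thus ?thesis using has_limits_iff[OF n] by blast
qed

section \<open>The classification\<close>

lemma limits_all_orders:
  assumes "CARD('n::finite) \<ge> 2" "Delta_cnj_has_limits CARD('n) X" "z \<in> X" "1 \<le> k" "k \<le> CARD('n)"
  shows "\<exists>l. ddiff_limit X z k l"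
proof -
  obtain l where l: "ddiff_limit X z CARD('n) l" using assms(2,3) has_limits_iff[OF assms(1)] by blast
  show ?thesis
  proof (cases "k = CARD('n)")
    case False
    thus ?thesis using ddiff_bounded_lower(2)[OF ddiff_limit_bounded[OF l] assms(4,5)] assms(5) by simp
  qed (use l in auto)
qed

lemma locally_bounded_imp_Phi_continuous:
  assumes X: "perfect_set X" and lb: "Delta_cnj_locally_bounded CARD('n::finite) X"
  shows "continuous_on (spec_semisimple X :: (complex^'n^'n) set) Phi"
proof (rule continuous_on_dense_limits[where D="simple_spec X" and \<phi>=Phi])
  have n: "CARD('n) \<ge> 1" by (simp add: Suc_leI)
  show "\<exists>s. (\<forall>m. s m \<in> simple_spec X) \<and> s \<longlonglongrightarrow> A" if "A \<in> spec_semisimple X" for A :: "complex^'n^'n"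
    using simple_spec_dense_Phi[OF X that] by blast
  fix A and s :: "nat \<Rightarrow> complex^'n^'n"
  assume A: "A \<in> spec_semisimple X" "\<forall>m. s m \<in> simple_spec X" "s \<longlonglongrightarrow> A"
  have "ddiff_bounded X z k" if "z \<in> X" "1 \<le> k" "k \<le> CARD('n)" for z k
    using lb that locally_bounded_iff[OF n, of X] ddiff_bounded_lower(1) by blast
  thus "(\<lambda>m. Phi (s m)) \<longlonglongrightarrow> Phi A" using Phi_tendsto_semisimple A by blast
qed

lemma continuous_eq_on_spec_all:
  assumes X: "perfect_set X" and c: "continuous_on (spec_all X) \<phi>" "continuous_on (spec_all X) \<psi>"
    and eq: "\<And>A. A \<in> spec_semisimple X \<Longrightarrow> \<phi> A = \<psi> A" and A: "A \<in> spec_all X"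
  shows "\<phi> A = (\<psi> A :: complex^'n^'n)"
proof -
  obtain s where s: "\<And>m. s m \<in> simple_spec X" "s \<longlonglongrightarrow> A" using simple_spec_dense[OF X A] by blast
  have ss: "s m \<in> spec_semisimple X" "s m \<in> spec_all X" for m
    using s(1) simple_spec_subset spec_semisimple_subset by blast+
  have "(\<lambda>m. \<phi> (s m)) \<longlonglongrightarrow> \<phi> A" "(\<lambda>m. \<psi> (s m)) \<longlonglongrightarrow> \<psi> A"
    using c ss A s(2) by (auto intro!: continuous_on_tendsto_compose[of "spec_all X" _ s])
  thus ?thesis using eq ss LIMSEQ_unique by auto
qed

lemma continuous_extension_unique:
  assumes X: "perfect_set X"
    and 1: "is_continuous_extension (spec_semisimple X) (spec_all X) Phi (\<Psi>1 :: complex^'n^'n \<Rightarrow> complex^'n^'n)"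
    and 2: "is_continuous_extension (spec_semisimple X) (spec_all X) Phi \<Psi>2"
  shows "\<Psi>1 = \<Psi>2"
proof (rule extensionalityI)
  show "\<Psi>1 \<in> extensional (spec_all X)" "\<Psi>2 \<in> extensional (spec_all X)"
    using 1 2 by (auto simp: is_continuous_extension_def)
  fix A :: "complex^'n^'n" assume A: "A \<in> spec_all X"
  show "\<Psi>1 A = \<Psi>2 A"
    by (rule continuous_eq_on_spec_all[OF X _ _ _ A]) (use 1 2 in \<open>auto simp: is_continuous_extension_def\<close>)
qed

lemma newton_sum_commute:
  assumes "A ** B = B ** A"
  shows "(\<Sum>j<n. mat (c j) ** newton_prod A x j) ** (\<Sum>j<m. mat (e j) ** newton_prod B y j) =
    (\<Sum>j<m. mat (e j) ** newton_prod B y j) ** (\<Sum>j<n. mat (c j) ** newton_prod A x j)"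
proof -
  have c1: "(\<Sum>j<n. mat (c j) ** newton_prod A x j) ** M = M ** (\<Sum>j<n. mat (c j) ** newton_prod A x j)"
    if "A ** M = M ** A" for A M :: "complex^'n^'n" and n c x
  proof -
    have "(mat (c j) ** newton_prod A x j) ** M = M ** (mat (c j) ** newton_prod A x j)" for j
      unfolding mat_mult_swap[of M] matrix_mul_assoc[symmetric] newton_prod_commute[OF that] ..
    thus ?thesis by (simp add: matrix_sum_ldistrib matrix_sum_rdistrib)
  qed
  have "B ** (\<Sum>j<n. mat (c j) ** newton_prod A x j) = (\<Sum>j<n. mat (c j) ** newton_prod A x j) ** B"
    using c1[OF assms] by simp
  from c1[OF this] show ?thesis by simp
qed

text \<open>Limits along matrices with simple spectrum define the extension. Spectra pass to the
  limit through characteristic polynomials; commutation is obtained from the Newton sums, which are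
  polynomials in the two matrices, so no simultaneous approximation of a commuting pair is
  involved.\<close>

lemma extension_exists:
  assumes n: "CARD('n::finite) \<ge> 2" and X: "perfect_set X" and hl: "Delta_cnj_has_limits CARD('n) X"
  shows "\<exists>\<Psi> :: complex^'n^'n \<Rightarrow> complex^'n^'n.
    is_continuous_extension (spec_semisimple X) (spec_all X) Phi \<Psi> \<and> continuous_CS_preserver (spec_all X) \<Psi>"
proof -
  define good where "good A c y \<longleftrightarrow> (\<forall>s. (\<forall>m. s m \<in> simple_spec X) \<and> s \<longlonglongrightarrow> A \<longrightarrow>
    (\<lambda>m. conj_transpose (Phi (s m))) \<longlonglongrightarrow> (\<Sum>j<CARD('n). mat (c j) ** newton_prod A y j))"
    for A :: "complex^'n^'n" and c y
  define c where "c A = (SOME c. \<exists>y. good A c y)" for A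
  define y where "y A = (SOME y. good A (c A) y)" for A
  have cy: "good A (c A) (y A)" if "A \<in> spec_all X" for A
  proof -
    have "\<exists>c y. good A c y"
      unfolding good_def by (rule Phi_star_limit[OF limits_all_orders[OF n hl] that])
    hence "\<exists>y. good A (c A) y" unfolding c_def by (rule someI_ex)
    thus ?thesis unfolding y_def by (rule someI_ex)
  qed
  define S where "S A = (\<Sum>j<CARD('n). mat (c A j) ** newton_prod A (y A) j)" for A :: "complex^'n^'n"
  define \<Psi> where "\<Psi> = restrict (\<lambda>A. conj_transpose (S A)) (spec_all X)"
  have lim: "(\<lambda>m. Phi (s m)) \<longlonglongrightarrow> \<Psi> A" if "A \<in> spec_all X" "\<forall>m. s m \<in> simple_spec X" "s \<longlonglongrightarrow> A" for A s
  proof -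
    have "(\<lambda>m. conj_transpose (Phi (s m))) \<longlonglongrightarrow> S A" using cy[OF that(1)] that(2,3) unfolding S_def good_def by blast
    hence "(\<lambda>m. conj_transpose (conj_transpose (Phi (s m)))) \<longlonglongrightarrow> conj_transpose (S A)"
      by (rule tendsto_conj_transpose)
    thus ?thesis using that(1) by (simp add: \<Psi>_def)
  qed
  have cont: "continuous_on (spec_all X) \<Psi>"
    by (rule continuous_on_dense_limits[where D="simple_spec X" and \<phi>=Phi]) (use simple_spec_dense[OF X] lim in auto)
  have "\<Psi> A = Phi A" if A: "A \<in> spec_semisimple X" for A
  proof -
    obtain s where s: "\<forall>m. s m \<in> simple_spec X" "s \<longlonglongrightarrow> A" "(\<lambda>m. Phi (s m)) \<longlonglongrightarrow> Phi A"
      using simple_spec_dense_Phi[OF X A] by blast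
    have "A \<in> spec_all X" using A spec_semisimple_subset by blast
    thus ?thesis using lim[OF _ s(1,2)] s(3) LIMSEQ_unique by blast
  qed
  hence ext: "is_continuous_extension (spec_semisimple X) (spec_all X) Phi \<Psi>"
    unfolding is_continuous_extension_def using cont by (simp add: \<Psi>_def)
  have spec: "matrix_spectrum (\<Psi> A) = matrix_spectrum A" if A: "A \<in> spec_all X" for A
  proof -
    obtain s where s: "\<forall>m. s m \<in> simple_spec X" "s \<longlonglongrightarrow> A" using simple_spec_dense[OF X A] by blast
    have "det (mat z - \<Psi> A) = det (mat z - A)" for z
    proof (rule LIMSEQ_unique)
      show "(\<lambda>m. det (mat z - Phi (s m))) \<longlonglongrightarrow> det (mat z - \<Psi> A)"
        by (intro tendsto_det tendsto_intros lim[OF A s])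
      have "s m \<in> spec_semisimple X" for m using s(1) simple_spec_subset by blast
      hence "det (mat z - Phi (s m)) = det (mat z - s m)" for m
        by (simp add: spec_semisimple_def Phi_spectrum)
      thus "(\<lambda>m. det (mat z - Phi (s m))) \<longlonglongrightarrow> det (mat z - A)"
        by (simp add: tendsto_det tendsto_diff s(2))
    qed
    thus ?thesis by (auto simp: matrix_spectrum_det)
  qed
  have comm: "\<Psi> A ** \<Psi> B = \<Psi> B ** \<Psi> A" if A: "A \<in> spec_all X" "B \<in> spec_all X" "A ** B = B ** A" for A B
  proof -
    have "S A ** S B = S B ** S A" unfolding S_def by (rule newton_sum_commute[OF A(3)])
    thus ?thesis using A(1,2) by (simp add: \<Psi>_def conj_transpose_mult[symmetric])
  qed
  show ?thesis using ext cont spec comm unfolding continuous_CS_preserver_def CS_preserver_def by blast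
qed

lemma continuous_CS_preserver_cong:
  "(\<And>A. A \<in> S \<Longrightarrow> \<phi> A = \<psi> A) \<Longrightarrow> continuous_CS_preserver S \<phi> \<longleftrightarrow> continuous_CS_preserver S \<psi>"
  unfolding continuous_CS_preserver_def CS_preserver_def by (auto cong: continuous_on_cong)

lemma continuous_CS_preserver_subset:
  "continuous_CS_preserver S \<phi> \<Longrightarrow> S' \<subseteq> S \<Longrightarrow> continuous_CS_preserver S' \<phi>"
  unfolding continuous_CS_preserver_def CS_preserver_def using continuous_on_subset by blast

theorem theoremA:
  fixes X :: "complex set"
  assumes "CARD('n::finite) \<ge> 3"
    and "perfect_set X"
    and "connected (config_space CARD('n) X)"
  shows
    "(\<forall>\<phi> :: complex^'n^'n \<Rightarrow> complex^'n^'n.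
        continuous_CS_preserver (spec_normal X) \<phi> \<longleftrightarrow>
        (\<exists>\<alpha>\<in>matrix_conjugations \<union> transpose_conjugations. \<forall>A\<in>spec_normal X. \<phi> A = \<alpha> A))
     \<and>
     ((\<forall>\<phi> :: complex^'n^'n \<Rightarrow> complex^'n^'n.
        continuous_CS_preserver (spec_semisimple X) \<phi> \<longleftrightarrow>
        (\<exists>\<alpha>\<in>matrix_conjugations \<union> transpose_conjugations.
            \<forall>A\<in>spec_semisimple X. \<phi> A = \<alpha> A) \<or>
        (Delta_cnj_locally_bounded CARD('n) X \<and>
         (\<exists>\<alpha>\<in>matrix_conjugations \<union> transpose_conjugations.
            \<forall>A\<in>spec_semisimple X. \<phi> A = \<alpha> (Phi A)))) \<and>
      (\<forall>\<alpha>\<in>matrix_conjugations \<union> transpose_conjugations.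
        continuous_CS_preserver (spec_semisimple X :: (complex^'n^'n) set) (\<alpha> \<circ> Phi) \<longleftrightarrow>
        Delta_cnj_locally_bounded CARD('n) X))
     \<and>
     ((Delta_cnj_has_limits CARD('n) X \<longrightarrow>
        (\<exists>!\<Psi> :: complex^'n^'n \<Rightarrow> complex^'n^'n.
           is_continuous_extension (spec_semisimple X) (spec_all X) Phi \<Psi>)) \<and>
      (\<forall>\<phi> :: complex^'n^'n \<Rightarrow> complex^'n^'n.
        continuous_CS_preserver (spec_all X) \<phi> \<longleftrightarrow>
        (\<exists>\<alpha>\<in>matrix_conjugations \<union> transpose_conjugations.
            \<forall>A\<in>spec_all X. \<phi> A = \<alpha> A) \<or>
        (Delta_cnj_has_limits CARD('n) X \<and>
         (\<exists>\<Psi>. is_continuous_extension (spec_semisimple X) (spec_all X) Phi \<Psi> \<and>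
            (\<exists>\<alpha>\<in>matrix_conjugations \<union> transpose_conjugations.
               \<forall>A\<in>spec_all X. \<phi> A = \<alpha> (\<Psi> A))))) \<and>
      (\<forall>\<alpha>\<in>matrix_conjugations \<union> transpose_conjugations.
        (\<exists>\<Psi> :: complex^'n^'n \<Rightarrow> complex^'n^'n.
           is_continuous_extension (spec_semisimple X) (spec_all X) Phi \<Psi> \<and>
           continuous_CS_preserver (spec_all X) (\<alpha> \<circ> \<Psi>)) \<longleftrightarrow>
        Delta_cnj_has_limits CARD('n) X))"
proof -
  have n2: "CARD('n) \<ge> 2" using assms(1) by simp
  note X = assms(2)
  let ?N = "spec_normal X :: (complex^'n^'n) set"
  let ?S = "spec_semisimple X :: (complex^'n^'n) set"
  let ?A = "spec_all X :: (complex^'n^'n) set"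
  let ?LB = "Delta_cnj_locally_bounded CARD('n) X"
  let ?HL = "Delta_cnj_has_limits CARD('n) X"
  let ?G = "conj_maps :: (complex^'n^'n \<Rightarrow> complex^'n^'n) set"
  let ?ext = "\<lambda>\<Psi>. is_continuous_extension ?S ?A Phi \<Psi>"
  have conj: "continuous_CS_preserver S \<phi>" if "\<alpha> \<in> ?G" "\<forall>A\<in>S. \<phi> A = \<alpha> A" for \<alpha> \<phi> S
    using continuous_CS_preserver_cong[of S \<phi> \<alpha>] conj_maps_CS_preserver[OF that(1)] that(2) by auto
  have conj_comp: "continuous_CS_preserver S \<phi>"
    if "\<alpha> \<in> ?G" "continuous_CS_preserver S \<psi>" "\<forall>A\<in>S. \<phi> A = \<alpha> (\<psi> A)" for \<alpha> \<phi> \<psi> S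
    using continuous_CS_preserver_cong[of S \<phi> "\<lambda>A. \<alpha> (\<psi> A)"] compose_CS_preserver[OF that(1,2)] that(3) by auto
  have Phi_LB: "?LB" if \<alpha>: "\<alpha> \<in> ?G" and c: "continuous_on ?S (\<lambda>A. \<alpha> (Phi A))" for \<alpha>
  proof -
    obtain \<beta> where \<beta>: "\<beta> \<in> ?G" "\<And>A. \<beta> (\<alpha> A) = A" using conj_maps_inverse[OF \<alpha>] by metis
    have "continuous_on ?S (\<lambda>A. \<beta> (\<alpha> (Phi A)))"
      by (rule continuous_on_compose2[OF conj_maps_properties(1)[OF \<beta>(1), of UNIV] c]) auto
    hence "continuous_on ?S Phi" by (simp add: \<beta>(2))
    thus ?thesis by (rule Phi_continuous_imp_locally_bounded[OF n2])
  qed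
  have LB_Phi: "continuous_CS_preserver ?S Phi" if ?LB
    using locally_bounded_imp_Phi_continuous[OF X that] Phi_CS_preserver unfolding continuous_CS_preserver_def by blast
  have ext_HL: "?HL" if "?ext \<Psi>" for \<Psi>
    using that extension_imp_has_limits[OF n2, of X \<Psi>] unfolding is_continuous_extension_def by blast
  \<comment> \<open>Uniqueness identifies an arbitrary extension with the constructed one, for which
    preservation is known.\<close>
  have ext_CS: "continuous_CS_preserver ?A \<Psi>" if "?ext \<Psi>" for \<Psi>
    using extension_exists[OF n2 X ext_HL[OF that]] continuous_extension_unique[OF X that] by blast

  have part1: "continuous_CS_preserver ?N \<phi> \<longleftrightarrow> (\<exists>\<alpha>\<in>?G. \<forall>A\<in>?N. \<phi> A = \<alpha> A)" for \<phi>
    using preserver_on_normal[OF assms, of \<phi>] conj by blast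

  have part2a: "continuous_CS_preserver ?S \<phi> \<longleftrightarrow>
      (\<exists>\<alpha>\<in>?G. \<forall>A\<in>?S. \<phi> A = \<alpha> A) \<or> (?LB \<and> (\<exists>\<alpha>\<in>?G. \<forall>A\<in>?S. \<phi> A = \<alpha> (Phi A)))" for \<phi>
  proof
    assume c: "continuous_CS_preserver ?S \<phi>"
    then obtain \<alpha> where \<alpha>: "\<alpha> \<in> ?G" "(\<forall>A\<in>?S. \<phi> A = \<alpha> A) \<or> (\<forall>A\<in>?S. \<phi> A = \<alpha> (Phi A))"
      using preserver_on_semisimple[OF assms] by blast
    moreover have ?LB if "\<forall>A\<in>?S. \<phi> A = \<alpha> (Phi A)"
    proof -
      have "continuous_on ?S \<phi>" using c unfolding continuous_CS_preserver_def by blast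
      hence "continuous_on ?S (\<lambda>A. \<alpha> (Phi A))" using that by (simp cong: continuous_on_cong)
      thus ?thesis by (rule Phi_LB[OF \<alpha>(1)])
    qed
    ultimately show "(\<exists>\<alpha>\<in>?G. \<forall>A\<in>?S. \<phi> A = \<alpha> A) \<or> (?LB \<and> (\<exists>\<alpha>\<in>?G. \<forall>A\<in>?S. \<phi> A = \<alpha> (Phi A)))" by blast
  next
    assume "(\<exists>\<alpha>\<in>?G. \<forall>A\<in>?S. \<phi> A = \<alpha> A) \<or> (?LB \<and> (\<exists>\<alpha>\<in>?G. \<forall>A\<in>?S. \<phi> A = \<alpha> (Phi A)))"
    thus "continuous_CS_preserver ?S \<phi>" using conj conj_comp LB_Phi by blast
  qed
  have part2b: "continuous_CS_preserver ?S (\<alpha> \<circ> Phi) \<longleftrightarrow> ?LB" if \<alpha>: "\<alpha> \<in> ?G" for \<alpha>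
  proof
    assume "continuous_CS_preserver ?S (\<alpha> \<circ> Phi)"
    hence "continuous_on ?S (\<lambda>A. \<alpha> (Phi A))" unfolding continuous_CS_preserver_def o_def by blast
    thus ?LB by (rule Phi_LB[OF \<alpha>])
  next
    assume ?LB
    thus "continuous_CS_preserver ?S (\<alpha> \<circ> Phi)" unfolding o_def using compose_CS_preserver[OF \<alpha> LB_Phi] by blast
  qed

  have part3a: "\<exists>!\<Psi>. ?ext \<Psi>" if ?HL
    using extension_exists[OF n2 X that] continuous_extension_unique[OF X] by blast
  have part3b: "continuous_CS_preserver ?A \<phi> \<longleftrightarrow>
      (\<exists>\<alpha>\<in>?G. \<forall>A\<in>?A. \<phi> A = \<alpha> A) \<or> (?HL \<and> (\<exists>\<Psi>. ?ext \<Psi> \<and> (\<exists>\<alpha>\<in>?G. \<forall>A\<in>?A. \<phi> A = \<alpha> (\<Psi> A))))" for \<phi>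
  proof
    assume c: "continuous_CS_preserver ?A \<phi>"
    hence cont: "continuous_on ?A \<phi>" unfolding continuous_CS_preserver_def by blast
    obtain \<alpha> where \<alpha>: "\<alpha> \<in> ?G" "(\<forall>A\<in>?S. \<phi> A = \<alpha> A) \<or> (\<forall>A\<in>?S. \<phi> A = \<alpha> (Phi A))"
      using preserver_on_semisimple[OF assms continuous_CS_preserver_subset[OF c spec_semisimple_subset]] by blast
    from \<alpha>(2) show "(\<exists>\<alpha>\<in>?G. \<forall>A\<in>?A. \<phi> A = \<alpha> A) \<or>
        (?HL \<and> (\<exists>\<Psi>. ?ext \<Psi> \<and> (\<exists>\<alpha>\<in>?G. \<forall>A\<in>?A. \<phi> A = \<alpha> (\<Psi> A))))"
    proof
      assume "\<forall>A\<in>?S. \<phi> A = \<alpha> A"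
      hence "\<forall>A\<in>?A. \<phi> A = \<alpha> A"
        using continuous_eq_on_spec_all[OF X cont conj_maps_properties(1)[OF \<alpha>(1)]] by blast
      thus ?thesis using \<alpha>(1) by blast
    next
      assume e: "\<forall>A\<in>?S. \<phi> A = \<alpha> (Phi A)"
      obtain \<beta> where \<beta>: "\<beta> \<in> ?G" "\<And>A. \<beta> (\<alpha> A) = A" "\<And>A. \<alpha> (\<beta> A) = A"
        using conj_maps_inverse[OF \<alpha>(1)] by metis
      \<comment> \<open>Undoing \<alpha> turns \<phi> into a continuous extension of \<Phi>, and the
        existence of such an extension forces the limits.\<close>
      define \<Psi> where "\<Psi> = restrict (\<lambda>A. \<beta> (\<phi> A)) ?A"
      have "continuous_on ?A (\<lambda>A. \<beta> (\<phi> A))"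
        by (rule continuous_on_compose2[OF conj_maps_properties(1)[OF \<beta>(1), of UNIV] cont]) auto
      hence "continuous_on ?A \<Psi>" unfolding \<Psi>_def by (simp cong: continuous_on_cong)
      moreover have "\<Psi> A = Phi A" if "A \<in> ?S" for A
        using that e spec_semisimple_subset \<beta>(2) unfolding \<Psi>_def by auto
      ultimately have "?ext \<Psi>" unfolding is_continuous_extension_def by (simp add: \<Psi>_def)
      moreover have "\<forall>A\<in>?A. \<phi> A = \<alpha> (\<Psi> A)" by (simp add: \<Psi>_def \<beta>(3))
      ultimately show ?thesis using ext_HL \<alpha>(1) by blast
    qed
  next
    assume "(\<exists>\<alpha>\<in>?G. \<forall>A\<in>?A. \<phi> A = \<alpha> A) \<or> (?HL \<and> (\<exists>\<Psi>. ?ext \<Psi> \<and> (\<exists>\<alpha>\<in>?G. \<forall>A\<in>?A. \<phi> A = \<alpha> (\<Psi> A))))"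
    thus "continuous_CS_preserver ?A \<phi>" using conj conj_comp ext_CS by blast
  qed
  have part3c: "(\<exists>\<Psi>. ?ext \<Psi> \<and> continuous_CS_preserver ?A (\<alpha> \<circ> \<Psi>)) \<longleftrightarrow> ?HL" if \<alpha>: "\<alpha> \<in> ?G" for \<alpha>
  proof
    assume ?HL
    then obtain \<Psi> where \<Psi>: "?ext \<Psi>" "continuous_CS_preserver ?A \<Psi>" using extension_exists[OF n2 X] by blast
    hence "continuous_CS_preserver ?A (\<alpha> \<circ> \<Psi>)" unfolding o_def using compose_CS_preserver[OF \<alpha>] by blast
    thus "\<exists>\<Psi>. ?ext \<Psi> \<and> continuous_CS_preserver ?A (\<alpha> \<circ> \<Psi>)" using \<Psi>(1) by blast
  qed (use ext_HL in blast)
  show ?thesis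
    unfolding conj_maps_def[symmetric]
    using part1 part2a part2b part3a part3b part3c by (intro conjI allI ballI impI) assumption+
qed

end
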